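(* Fix $\varepsilon>0$. Let $L\ge1$ be an integer, $K_1,\dots,K_L\subseteq[N]$ pairwise disjoint, $x_0=\sum_{i=1}^L i\,\mathbb{1}_{K_i}$, $K=\bigcup_{i=1}^LK_i$, $\hat K=K\setminus K_L$, $k=|K|$, $\hat k=|\hat K|$, $k_L=|K_L|$. Let $A\in\mathbb{R}^{m\times N}$ be a Gaussian matrix and $b=Ax_0$. If $$m\ge\inf_{\tau\ge0}\Big\{\hat k(1+\tau^2)+k_L\int_{-\infty}^{\tau}(u-\tau)^2\phi(u)\,du+(N-k)\int_\tau^\infty(u-\tau)^2\phi(u)\,du\Big\}+\sqrt{8\log(4/\varepsilon)N},$$ with $\phi(u)=(2\pi)^{-1/2}e^{-u^2/2}$, then with probability larger than $1-\varepsilon$, $x_0$ is the unique solution of $\min\|x\|_1$ subject to $Ax=b$ and $x\in[0,L]^N$.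
   Context: $\mathbb{1}_S$ has entries $1$ on $S$, $0$ elsewhere. A Gaussian matrix is $A=m^{-1/2}[a_{ij}]$ with $a_{ij}$ i.i.d. standard normal. $\log$ is the natural logarithm. *)

theory Defs
  imports "HOL-Probability.Probability"
begin

definition phi :: "real \<Rightarrow> real" where
  "phi u = (1 / sqrt (2 * pi)) * exp (- u\<^sup>2 / 2)"

definition gauss_space :: "nat \<Rightarrow> nat \<Rightarrow> (nat \<times> nat \<Rightarrow> real) measure" where
  "gauss_space m N = PiM ({0..<m} \<times> {0..<N}) (\<lambda>_. density lborel phi)"

definition gauss_matrix :: "nat \<Rightarrow> (nat \<times> nat \<Rightarrow> real) \<Rightarrow> nat \<Rightarrow> nat \<Rightarrow> real" where
  "gauss_matrix m a i j = a (i, j) / sqrt (real m)"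

definition matvec :: "nat \<Rightarrow> (nat \<Rightarrow> nat \<Rightarrow> real) \<Rightarrow> (nat \<Rightarrow> real) \<Rightarrow> nat \<Rightarrow> real" where
  "matvec N A x i = (\<Sum>j<N. A i j * x j)"

definition l1norm :: "nat \<Rightarrow> (nat \<Rightarrow> real) \<Rightarrow> real" where
  "l1norm N x = (\<Sum>j<N. \<bar>x j\<bar>)"

text \<open>Feasible set {x in R^N : Ax = b, x in [0,L]^N}; vectors in R^N are
  functions nat => real vanishing outside {0..<N}.\<close>
definition feasible :: "nat \<Rightarrow> nat \<Rightarrow> (nat \<Rightarrow> nat \<Rightarrow> real) \<Rightarrow> (nat \<Rightarrow> real) \<Rightarrow> real \<Rightarrow> (nat \<Rightarrow> real) set" where
  "feasible m N A b L = {x. (\<forall>j. j \<ge> N \<longrightarrow> x j = 0) \<and> (\<forall>j<N. 0 \<le> x j \<and> x j \<le> L)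
      \<and> (\<forall>i<m. matvec N A x i = b i)}"

definition unique_l1_solution :: "nat \<Rightarrow> (nat \<Rightarrow> real) set \<Rightarrow> (nat \<Rightarrow> real) \<Rightarrow> bool" where
  "unique_l1_solution N F x0 \<longleftrightarrow> {x \<in> F. \<forall>y\<in>F. l1norm N x \<le> l1norm N y} = {x0}"

end

theory Submission
  imports Defs "HOL-Real_Asymp.Real_Asymp"
begin

text \<open>
  Recovery fails exactly when the kernel of the Gaussian matrix meets the unit sphere inside the cone of
  those \<open>x\<close> with \<open>x \<le> 0\<close> on \<open>K L\<close>, \<open>x \<ge> 0\<close> off \<open>K\<close> and \<open>sum x \<le> 0\<close>. For \<open>s > 0\<close>, Gordon's comparison,
  proved by Gaussian interpolation for the functional \<open>exp (- s * z)\<close>, bounds the probability of this event by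
  \<open>exp (- s^2 / 2) * E exp (- s * |h|) * E exp (s * R)\<close>. Here \<open>h\<close> is a standard Gaussian vector in dimension \<open>m\<close>,
  and \<open>R\<close> is the Euclidean norm of \<open>(\<psi> j (g j))\<close>, which by weak duality with multiplier \<open>\<tau>\<close> dominates the
  supremum of \<open>g \<bullet> x\<close> over the cone. The mean of \<open>R^2\<close> is the function of \<open>\<tau>\<close> in the hypothesis. The one-dimensional inequality
  \<open>E exp (a * \<psi>^2) \<le> exp (a / (1 - 2 a) * E \<psi>^2)\<close> gives \<open>E exp (s * R) \<le> exp (s * sqrt d + s^2 / 2)\<close>
  for \<open>d \<ge> E R^2\<close>, and a Chernoff bound gives \<open>E exp (- s * |h|) \<le> 3 * exp (- s * sqrt m + s^2 / 2)\<close>.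
  With \<open>s = sqrt m - sqrt d\<close> the failure probability is at most \<open>3 * exp (- (sqrt m - sqrt d)^2 / 2)\<close>, which is
  below \<open>\<epsilon>\<close> if \<open>m \<le> N\<close>. If \<open>m > N\<close>, letting \<open>s\<close> tend to infinity shows that the kernel is
  almost surely trivial.
\<close>

section \<open>One-dimensional Gaussian calculus\<close>

text \<open>Comparing Laplace transforms replaces the usual pair of Gordon's inequality for means
  and Lipschitz concentration, so the sharp variance factors must come out of the exponential
  moments themselves. The corner scalar that equalises variances contributes
  \<open>exp (- s^2 / 2)\<close>, while \<open>R\<close> and \<open>|h|\<close> contribute
  \<open>exp (s^2 / 2)\<close> each; the total exponent
  \<open>s^2 / 2 - s * (sqrt m - sqrt d)\<close> is smallest at \<open>s = sqrt m - sqrt d\<close>.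
  The hardest point is analytic: truncated coordinates must obey the same moment bound as full
  Gaussians relative to their own, smaller second moment, without loss of a constant. The comparison
  itself needs smooth functions of finitely many points. Hence a soft minimum, a norm kept away from
  0, and a relaxed event for finite sets; these parameters are removed by limits. Constants: the
  hypothesis bounds \<open>(sqrt m - sqrt d) * (sqrt m + sqrt d)\<close> below by
  \<open>sqrt (8 * ln (4 / \<epsilon>) * N)\<close>. For \<open>m \<le> N\<close> the second factor
  is at most \<open>2 * sqrt N\<close>, so the square of the first is at least
  \<open>2 * ln (4 / \<epsilon>)\<close>, and the final bound is
  \<open>3 * \<epsilon> / 4\<close>.\<close>

abbreviation gauss :: "real measure" where
  "gauss \<equiv> density lborel phi"

lemma phi_eq_std_normal_density: "phi = std_normal_density"
  by (simp add: phi_def std_normal_density_def fun_eq_iff)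

lemma phi_measurable [measurable]: "phi \<in> borel_measurable borel"
  by (simp add: phi_eq_std_normal_density)

lemma phi_nonneg [simp]: "0 \<le> phi x"
  by (simp add: phi_def)

lemma phi_minus [simp]: "phi (- x) = phi x"
  by (simp add: phi_def)

lemma phi_shift: "phi (z + x) = phi z * exp (- (z * x)) * exp (- x\<^sup>2 / 2)"
  by (simp add: phi_def exp_add [symmetric] power2_eq_square field_simps)

lemma DERIV_phi: "(phi has_real_derivative - (x * phi x)) (at x)"
proof -
  have "((\<lambda>u. exp (- u\<^sup>2 / 2)) has_real_derivative exp (- x\<^sup>2 / 2) * - x) (at x)"
    by (auto intro!: derivative_eq_intros)
  from DERIV_cmult [OF this, of "1 / sqrt (2 * pi)"] show ?thesis
    unfolding phi_def [abs_def] by (simp add: mult_ac)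
qed

lemmas DERIV_phi' [derivative_intros] = DERIV_chain2 [OF DERIV_phi]

interpretation gauss: prob_space gauss
  unfolding phi_eq_std_normal_density by (rule prob_space_normal_density) simp

lemma integral_gauss:
  fixes f :: "real \<Rightarrow> real"
  assumes [measurable]: "f \<in> borel_measurable borel"
  shows "(\<integral>x. f x \<partial>gauss) = (\<integral>x. phi x * f x \<partial>lborel)"
  by (subst integral_real_density) auto

lemma integrable_gauss_iff:
  fixes f :: "real \<Rightarrow> real"
  assumes [measurable]: "f \<in> borel_measurable borel"
  shows "integrable gauss f \<longleftrightarrow> integrable lborel (\<lambda>x. phi x * f x)"
  by (subst integrable_real_density) auto

lemma gauss_exp_square:
  fixes a t :: real
  assumes a: "a < 1 / 2"
  shows "has_bochner_integral gauss (\<lambda>u. exp (a * (u - t)\<^sup>2))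
           (1 / sqrt (1 - 2 * a) * exp (a * t\<^sup>2 / (1 - 2 * a)))"
proof -
  define b where "b = 1 - 2 * a"
  define r where "r = 1 / sqrt b"
  define c where "c = r * exp (a * t\<^sup>2 / b)"
  have b: "b > 0" and r: "r > 0" and r2: "r\<^sup>2 = 1 / b"
    using a by (auto simp: b_def r_def field_simps)
  \<comment> \<open>Completing the square: the integrand is \<open>c\<close> times the normal
    density with mean \<open>- 2 * a * t / b\<close> and standard deviation
    \<open>r = 1 / sqrt b\<close>, so the integral is \<open>c\<close>.\<close>
  have eq: "phi u * exp (a * (u - t)\<^sup>2) = c * normal_density (- 2 * a * t / b) r u" for u
  proof -
    have e: "- u\<^sup>2 / 2 + a * (u - t)\<^sup>2 = a * t\<^sup>2 / b - (u - - 2 * a * t / b)\<^sup>2 * b / 2"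
    proof -
      have "(u - - 2 * a * t / b)\<^sup>2 * b = b * u\<^sup>2 + 4 * a * t * u + 4 * a\<^sup>2 * t\<^sup>2 / b"
        using b by (simp add: power2_eq_square field_simps)
      moreover have "a * t\<^sup>2 / b - 2 * a\<^sup>2 * t\<^sup>2 / b = a * t\<^sup>2"
        using b by (simp add: field_simps) (simp add: b_def power2_eq_square algebra_simps)
      moreover have "b * u\<^sup>2 = u\<^sup>2 - 2 * a * u\<^sup>2"
        by (simp add: b_def algebra_simps)
      moreover have "a * (u - t)\<^sup>2 = a * u\<^sup>2 - 2 * a * t * u + a * t\<^sup>2"
        by (simp add: power2_eq_square algebra_simps)
      ultimately show ?thesis
        by argo
    qed
    have "c * normal_density (- 2 * a * t / b) r u
        = 1 / sqrt (2 * pi) * (exp (a * t\<^sup>2 / b) * exp (- ((u - - 2 * a * t / b)\<^sup>2 * b / 2)))"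
    proof -
      have "sqrt (2 * pi * r\<^sup>2) = sqrt (2 * pi) * r"
        using r by (simp add: real_sqrt_mult)
      moreover have "(x::real) / (2 * r\<^sup>2) = x * b / 2" for x
        using b by (simp add: r2)
      ultimately show ?thesis
        using r by (simp add: normal_density_def c_def)
    qed
    also have "\<dots> = phi u * exp (a * (u - t)\<^sup>2)"
      unfolding exp_add [symmetric] phi_def using e by (simp add: exp_add [symmetric])
    finally show ?thesis by simp
  qed
  have "has_bochner_integral lborel (\<lambda>u. phi u *\<^sub>R exp (a * (u - t)\<^sup>2)) (c * 1)"
    unfolding real_scaleR_def eq
    using r by (intro has_bochner_integral_mult_right) (simp add: has_bochner_integral_iff)
  then show ?thesis
    by (intro has_bochner_integral_density) (auto simp: c_def b_def r_def)
qed

lemma integrable_gauss_exp_abs: "integrable gauss (\<lambda>u. exp (k * \<bar>u\<bar>))"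
proof (rule Bochner_Integration.integrable_bound)
  show "integrable gauss (\<lambda>u. exp (k\<^sup>2) * exp (1/4 * (u - 0)\<^sup>2))"
    using gauss_exp_square [of "1/4" 0] by (intro integrable_mult_right) (auto simp: has_bochner_integral_iff)
  have "k * \<bar>u\<bar> \<le> k\<^sup>2 + 1/4 * u\<^sup>2" for u
    using zero_le_power2 [of "k - \<bar>u\<bar>/2"] by (simp add: power2_eq_square algebra_simps)
  then show "AE u in gauss. norm (exp (k * \<bar>u\<bar>)) \<le> norm (exp (k\<^sup>2) * exp (1/4 * (u - 0)\<^sup>2))"
    by (simp add: exp_add [symmetric])
qed simp

lemma phi_exp_tendsto_0: "((\<lambda>x. phi x * exp (k * \<bar>x\<bar>)) \<longlongrightarrow> 0) at_top"
    "((\<lambda>x. phi x * exp (k * \<bar>x\<bar>)) \<longlongrightarrow> 0) at_bot"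
proof -
  have "((\<lambda>x. 1 / sqrt (2 * pi) * exp (- x\<^sup>2 / 2) * exp (k * \<bar>x\<bar>)) \<longlongrightarrow> 0) at_top"
  proof -
    have "((\<lambda>x. exp (k * x - x\<^sup>2 / 2)) \<longlongrightarrow> 0) at_top"
      by real_asymp
    then have "((\<lambda>x. 1 / sqrt (2 * pi) * exp (k * x - x\<^sup>2 / 2)) \<longlongrightarrow> 0) at_top"
      by (rule tendsto_mult_right_zero)
    then have "((\<lambda>x. 1 / sqrt (2 * pi) * exp (- x\<^sup>2 / 2) * exp (k * x)) \<longlongrightarrow> 0) at_top"
      by (simp add: exp_add [symmetric] mult.assoc)
    moreover have "eventually (\<lambda>x. 1 / sqrt (2 * pi) * exp (- x\<^sup>2 / 2) * exp (k * x)
        = 1 / sqrt (2 * pi) * exp (- x\<^sup>2 / 2) * exp (k * \<bar>x\<bar>)) at_top"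
      using eventually_ge_at_top [of 0] by eventually_elim simp
    ultimately show ?thesis
      by (rule Lim_transform_eventually)
  qed
  then show *: "((\<lambda>x. phi x * exp (k * \<bar>x\<bar>)) \<longlongrightarrow> 0) at_top"
    by (simp add: phi_def)
  show "((\<lambda>x. phi x * exp (k * \<bar>x\<bar>)) \<longlongrightarrow> 0) at_bot"
    unfolding filterlim_at_bot_mirror using * by simp
qed

lemma LBINT_FTC_Icc:
  fixes f F :: "real \<Rightarrow> real"
  assumes "a \<le> b" "set_integrable lborel {a..b} f"
    and "\<And>x. a \<le> x \<Longrightarrow> x \<le> b \<Longrightarrow> (F has_real_derivative f x) (at x)"
  shows "(LBINT x:{a..b}. f x) = F b - F a"
proof -
  have "(f has_integral (F b - F a)) {a..b}"
    using assms by (intro fundamental_theorem_of_calculus)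
      (auto simp: has_real_derivative_iff_has_vector_derivative [symmetric] intro: DERIV_subset)
  then show ?thesis
    using set_borel_integral_eq_integral(2) [OF assms(2)] by (simp add: integral_unique)
qed

lemma LBINT_FTC_atLeast:
  fixes f F :: "real \<Rightarrow> real"
  assumes int: "set_integrable lborel {a..} f"
    and deriv: "\<And>x. a \<le> x \<Longrightarrow> (F has_real_derivative f x) (at x)"
    and lim: "(F \<longlongrightarrow> l) at_top"
  shows "(LBINT x:{a..}. f x) = l - F a"
proof (rule tendsto_unique)
  show "((\<lambda>b. LBINT x:{a..b}. f x) \<longlongrightarrow> (LBINT x:{a..}. f x)) at_top"
    using int by (intro tendsto_set_lebesgue_integral_at_top) auto
  have "eventually (\<lambda>b. (LBINT x:{a..b}. f x) = F b - F a) at_top"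
    using eventually_ge_at_top [of a]
    by eventually_elim (intro LBINT_FTC_Icc set_integrable_subset [OF int], auto intro: deriv)
  moreover have "((\<lambda>b. F b - F a) \<longlongrightarrow> l - F a) at_top"
    by (intro tendsto_intros lim)
  ultimately show "((\<lambda>b. LBINT x:{a..b}. f x) \<longlongrightarrow> l - F a) at_top"
    by (rule tendsto_cong [THEN iffD2])
qed simp

lemma LBINT_FTC_UNIV:
  fixes f F :: "real \<Rightarrow> real"
  assumes int: "integrable lborel f"
    and deriv: "\<And>x. (F has_real_derivative f x) (at x)"
    and lim: "(F \<longlongrightarrow> 0) at_top" "(F \<longlongrightarrow> 0) at_bot"
  shows "(\<integral>x. f x \<partial>lborel) = 0"
proof -
  have si: "set_integrable lborel A f" if "A \<in> sets borel" for A
    unfolding set_integrable_def using that int by (intro integrable_mult_indicator) auto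
  have p: "(LBINT x:{a..}. f x) = - F a" for a
    using LBINT_FTC_atLeast [OF si deriv lim(1), of a] by simp
  have "(\<lambda>n. LBINT x:{- real n..}. f x) \<longlonglongrightarrow> (\<integral>x. f x \<partial>lborel)"
    unfolding set_lebesgue_integral_def
  proof (rule integral_dominated_convergence)
    show "integrable lborel (\<lambda>x. norm (f x))" using int by simp
    show "AE x in lborel. (\<lambda>n. indicat_real {- real n..} x *\<^sub>R f x) \<longlonglongrightarrow> f x"
    proof (intro AE_I2 tendsto_eventually)
      fix x
      obtain k where "- x \<le> real k" using real_arch_simple by blast
      then show "eventually (\<lambda>n. indicat_real {- real n..} x *\<^sub>R f x = f x) sequentially"
        by (intro eventually_sequentiallyI [of k]) (auto simp: indicator_def)
    qed
    have [measurable]: "f \<in> borel_measurable borel"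
      using borel_measurable_integrable [OF int] by simp
    show "f \<in> borel_measurable lborel"
      by simp
    show "(\<lambda>x. indicat_real {- real n..} x *\<^sub>R f x) \<in> borel_measurable lborel" for n
      by simp
    show "AE x in lborel. norm (indicat_real {- real n..} x *\<^sub>R f x) \<le> norm (f x)" for n
      by (simp add: indicator_def)
  qed
  moreover have "(\<lambda>n. LBINT x:{- real n..}. f x) \<longlonglongrightarrow> - 0"
    unfolding p
    by (intro tendsto_minus filterlim_compose [OF lim(2)]) real_asymp
  ultimately show ?thesis
    by (simp add: LIMSEQ_unique)
qed

text \<open>Stein's identity. The derivative of \<open>phi x * f x\<close> is
  \<open>phi x * (f' x - x * f x)\<close>, and \<open>phi\<close> beats growth of order
  \<open>exp (k * \<bar>x\<bar>)\<close>, so both boundary terms vanish. The integrands of the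
  interpolation have this growth.\<close>

lemma gauss_integration_by_parts:
  fixes f f' :: "real \<Rightarrow> real"
  assumes [measurable]: "f' \<in> borel_measurable borel"
    and deriv: "\<And>x. (f has_real_derivative f' x) (at x)"
    and bound: "\<And>x. \<bar>f x\<bar> \<le> C * exp (k * \<bar>x\<bar>)" "\<And>x. \<bar>f' x\<bar> \<le> C * exp (k * \<bar>x\<bar>)"
  shows "(\<integral>x. x * f x \<partial>gauss) = (\<integral>x. f' x \<partial>gauss)"
proof -
  have fm [measurable]: "f \<in> borel_measurable borel"
    by (intro borel_measurable_continuous_onI continuous_at_imp_continuous_on ballI DERIV_isCont [OF deriv])
  have C: "C \<ge> 0"
    using bound(1) [of 0] by simp
  have i1: "integrable gauss (\<lambda>x. x * f x)"
  proof (rule Bochner_Integration.integrable_bound)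
    show "integrable gauss (\<lambda>x. C * exp ((k + 1) * \<bar>x\<bar>))"
      by (intro integrable_mult_right integrable_gauss_exp_abs)
    have "\<bar>x * f x\<bar> \<le> C * exp ((k + 1) * \<bar>x\<bar>)" for x
    proof -
      have "\<bar>x\<bar> \<le> exp \<bar>x\<bar>"
        using exp_ge_add_one_self [of "\<bar>x\<bar>"] by linarith
      then have "\<bar>x\<bar> * \<bar>f x\<bar> \<le> exp \<bar>x\<bar> * (C * exp (k * \<bar>x\<bar>))"
        using bound by (intro mult_mono) auto
      then show ?thesis
        by (simp add: abs_mult exp_add [symmetric] algebra_simps)
    qed
    then show "AE x in gauss. norm (x * f x) \<le> norm (C * exp ((k + 1) * \<bar>x\<bar>))"
      using C by simp
  qed simp
  have i2: "integrable gauss f'"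
  proof (rule Bochner_Integration.integrable_bound)
    show "integrable gauss (\<lambda>x. C * exp (k * \<bar>x\<bar>))"
      by (intro integrable_mult_right integrable_gauss_exp_abs)
  qed (use bound(2) C in auto)
  have "(\<integral>x. phi x * (f' x - x * f x) \<partial>lborel) = 0"
  proof (rule LBINT_FTC_UNIV)
    show "integrable lborel (\<lambda>x. phi x * (f' x - x * f x))"
      using i1 i2 by (subst integrable_gauss_iff [symmetric]) auto
    show "((\<lambda>x. phi x * f x) has_real_derivative phi x * (f' x - x * f x)) (at x)" for x
      by (auto intro!: derivative_eq_intros deriv simp: algebra_simps)
    have le: "norm (phi x * f x) \<le> C * (phi x * exp (k * \<bar>x\<bar>))" for x
      using mult_left_mono [OF bound(1) phi_nonneg] by (simp add: abs_mult mult_ac)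
    show "((\<lambda>x. phi x * f x) \<longlongrightarrow> 0) at_top" "((\<lambda>x. phi x * f x) \<longlongrightarrow> 0) at_bot"
      by (rule Lim_null_comparison [OF always_eventually [rule_format, OF le]],
          rule tendsto_mult_right_zero, rule phi_exp_tendsto_0)+
  qed
  then have "(\<integral>x. f' x - x * f x \<partial>gauss) = 0"
    by (subst integral_gauss) auto
  then show ?thesis
    using i1 i2 by simp
qed

text \<open>Dominated convergence for the difference quotients along a sequence tending to
  \<open>t0\<close>; the mean value inequality turns the bound on \<open>f'\<close> into a
  dominating function. It serves the parameter of \<open>half_moment\<close> and the angle of the
  interpolation alike.\<close>

lemma has_real_derivative_integral:
  fixes f f' :: "real \<Rightarrow> 'a \<Rightarrow> real"
  assumes d: "d > 0"
    and int: "\<And>t. \<bar>t - t0\<bar> < d \<Longrightarrow> integrable M (f t)"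
    and deriv: "\<And>t w. w \<in> space M \<Longrightarrow> \<bar>t - t0\<bar> < d \<Longrightarrow> ((\<lambda>t. f t w) has_real_derivative f' t w) (at t)"
    and bound: "\<And>t w. w \<in> space M \<Longrightarrow> \<bar>t - t0\<bar> < d \<Longrightarrow> \<bar>f' t w\<bar> \<le> g w"
    and g: "integrable M g"
    and meas [measurable]: "f' t0 \<in> borel_measurable M"
  shows "((\<lambda>t. \<integral>w. f t w \<partial>M) has_real_derivative (\<integral>w. f' t0 w \<partial>M)) (at t0)"
  unfolding has_field_derivative_iff tendsto_at_iff_sequentially comp_def
proof (intro allI impI)
  fix X :: "nat \<Rightarrow> real"
  assume X: "\<forall>i. X i \<in> UNIV - {t0}" and lim: "X \<longlonglongrightarrow> t0"
  obtain n0 where n0: "\<And>n. n \<ge> n0 \<Longrightarrow> \<bar>X n - t0\<bar> < d"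
    using lim d unfolding LIMSEQ_iff real_norm_def by blast
  define Y where "Y n = X (n + n0)" for n
  have Y: "\<bar>Y n - t0\<bar> < d" "Y n \<noteq> t0" for n
    using n0 X by (auto simp: Y_def)
  have Ylim: "Y \<longlonglongrightarrow> t0"
    using lim unfolding Y_def by (rule LIMSEQ_ignore_initial_segment)
  have *: "(\<lambda>n. \<integral>w. (f (Y n) w - f t0 w) / (Y n - t0) \<partial>M) \<longlonglongrightarrow> (\<integral>w. f' t0 w \<partial>M)"
  proof (rule integral_dominated_convergence)
    show "integrable M g" by fact
    show "(\<lambda>w. (f (Y n) w - f t0 w) / (Y n - t0)) \<in> borel_measurable M" for n
      using borel_measurable_integrable [OF int [OF Y(1)], of n] borel_measurable_integrable [OF int, of t0] d
      by simp
    show "AE w in M. (\<lambda>n. (f (Y n) w - f t0 w) / (Y n - t0)) \<longlonglongrightarrow> f' t0 w"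
    proof (intro AE_I2)
      fix w assume w: "w \<in> space M"
      have "((\<lambda>t. (f t w - f t0 w) / (t - t0)) \<longlongrightarrow> f' t0 w) (at t0)"
        using deriv [OF w, of t0] d by (simp add: has_field_derivative_iff)
      then show "(\<lambda>n. (f (Y n) w - f t0 w) / (Y n - t0)) \<longlonglongrightarrow> f' t0 w"
        using Ylim Y(2) unfolding tendsto_at_iff_sequentially comp_def by simp
    qed
    show "AE w in M. norm ((f (Y n) w - f t0 w) / (Y n - t0)) \<le> g w" for n
    proof (intro AE_I2)
      fix w assume w: "w \<in> space M"
      have "norm (f (Y n) w - f t0 w) \<le> g w * norm (Y n - t0)"
      proof (rule field_differentiable_bound [where S = "{t0 - d<..<t0 + d}" and f' = "\<lambda>t. f' t w"])
        fix z assume "z \<in> {t0 - d<..<t0 + d}"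
        then have z: "\<bar>z - t0\<bar> < d" by auto
        show "((\<lambda>t. f t w) has_real_derivative f' z w) (at z within {t0 - d<..<t0 + d})"
          using deriv [OF w z] by (rule DERIV_subset) simp
        show "norm (f' z w) \<le> g w"
          using bound [OF w z] by simp
      qed (use Y(1) [of n] d in \<open>simp_all add: abs_less_iff\<close>)
      then show "norm ((f (Y n) w - f t0 w) / (Y n - t0)) \<le> g w"
        using Y(2) [of n] by (simp add: field_simps)
    qed
  qed simp
  have "(\<lambda>n. ((\<integral>w. f (Y n) w \<partial>M) - (\<integral>w. f t0 w \<partial>M)) / (Y n - t0)) \<longlonglongrightarrow> (\<integral>w. f' t0 w \<partial>M)"
    using * by (simp add: int [OF Y(1)] int d)
  then show "(\<lambda>n. ((\<integral>w. f (X n) w \<partial>M) - (\<integral>w. f t0 w \<partial>M)) / (X n - t0)) \<longlonglongrightarrow> (\<integral>w. f' t0 w \<partial>M)"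
    unfolding Y_def by (rule LIMSEQ_offset)
qed

section \<open>Exponential moments of truncated Gaussians\<close>

text \<open>Up to the factor \<open>exp (- x^2 / 2)\<close> this is the moment of order
  \<open>k\<close> of the positive part of u + x for a standard Gaussian u; for \<open>k = 0\<close>
  it is the Gaussian distribution function at \<open>x\<close>. The shift trades a moving truncation
  point for an exponential weight on a fixed half-line, so differentiation in \<open>x\<close> just
  raises \<open>k\<close>.\<close>

definition half_moment :: "nat \<Rightarrow> real \<Rightarrow> real" where
  "half_moment k x = (\<integral>z. indicat_real {0..} z * z ^ k * exp (z * x) \<partial>gauss)"

lemma abs_power_le_exp: "\<bar>z\<bar> ^ k \<le> exp (real k * \<bar>z\<bar>)" for z :: real
proof -
  have "\<bar>z\<bar> \<le> exp \<bar>z\<bar>"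
    using exp_ge_add_one_self [of "\<bar>z\<bar>"] by linarith
  then have "\<bar>z\<bar> ^ k \<le> exp \<bar>z\<bar> ^ k"
    by (intro power_mono) auto
  then show ?thesis
    by (simp add: exp_of_nat_mult)
qed

lemma half_moment_integrand_bound:
  assumes "\<bar>x\<bar> \<le> b"
  shows "\<bar>indicat_real {0..} z * z ^ k * exp (z * x)\<bar> \<le> exp ((real k + b) * \<bar>z\<bar>)"
proof -
  have "z * x \<le> b * \<bar>z\<bar>"
    using mult_right_mono [OF assms, of "\<bar>z\<bar>"] abs_ge_self [of "z * x"]
    by (simp add: abs_mult mult.commute)
  then have "\<bar>z\<bar> ^ k * exp (z * x) \<le> exp (real k * \<bar>z\<bar>) * exp (b * \<bar>z\<bar>)"
    by (intro mult_mono abs_power_le_exp) auto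
  then have "\<bar>z\<bar> ^ k * exp (z * x) \<le> exp ((real k + b) * \<bar>z\<bar>)"
    by (simp add: exp_add [symmetric] algebra_simps)
  then show ?thesis
    by (auto simp: abs_mult power_abs indicator_def)
qed

lemma half_moment_integrable:
  "integrable gauss (\<lambda>z. indicat_real {0..} z * z ^ k * exp (z * x))"
proof (rule Bochner_Integration.integrable_bound)
  show "integrable gauss (\<lambda>z. exp ((real k + \<bar>x\<bar>) * \<bar>z\<bar>))"
    by (rule integrable_gauss_exp_abs)
qed (use half_moment_integrand_bound [of x "\<bar>x\<bar>"] in auto)

lemma half_moment_lborel:
  "half_moment k x = (\<integral>z. phi z * (indicat_real {0..} z * z ^ k * exp (z * x)) \<partial>lborel)"
  unfolding half_moment_def by (rule integral_gauss) simp

lemma half_moment_nonneg: "0 \<le> half_moment k x"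
  unfolding half_moment_def by (intro integral_nonneg_AE) (auto simp: indicator_def)

lemma half_moment_mono:
  assumes "x \<le> y"
  shows "half_moment k x \<le> half_moment k y"
  unfolding half_moment_def
  by (intro integral_mono half_moment_integrable)
    (use assms in \<open>auto simp: indicator_def intro!: mult_left_mono\<close>)

lemma DERIV_half_moment: "(half_moment k has_real_derivative half_moment (Suc k) x) (at x)"
proof -
  have "((\<lambda>t. \<integral>z. indicat_real {0..} z * z ^ k * exp (z * t) \<partial>gauss) has_real_derivative
      (\<integral>z. indicat_real {0..} z * z ^ Suc k * exp (z * x) \<partial>gauss)) (at x)"
  proof (rule has_real_derivative_integral [where d = 1])
    show "integrable gauss (\<lambda>z. exp ((real (Suc k) + (\<bar>x\<bar> + 1)) * \<bar>z\<bar>))"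
      by (rule integrable_gauss_exp_abs)
    show "\<bar>indicat_real {0..} z * z ^ Suc k * exp (z * t)\<bar> \<le> exp ((real (Suc k) + (\<bar>x\<bar> + 1)) * \<bar>z\<bar>)"
      if "\<bar>t - x\<bar> < 1" for t z
      using that by (intro half_moment_integrand_bound) linarith
  qed (auto intro!: derivative_eq_intros half_moment_integrable)
  then show ?thesis
    unfolding half_moment_def [abs_def] .
qed

lemmas DERIV_half_moment' [derivative_intros] = DERIV_chain2 [OF DERIV_half_moment]

text \<open>The derivative of \<open>- phi z * z ^ k * exp (z * x)\<close> is integrated over the
  half-line. The boundary value at 0 survives only for \<open>k = 0\<close>, where it gives
  \<open>phi 0\<close>.\<close>

lemma half_moment_rec:
  "half_moment (Suc k) x = (if k = 0 then phi 0 else real k * half_moment (k - 1) x) + x * half_moment k x"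
proof -
  let ?g = "\<lambda>k z. indicat_real {0..} z * z ^ k * exp (z * x)"
  define F where "F z = - (phi z * (z ^ k * exp (z * x)))" for z
  define f where "f z = phi z * ((z ^ Suc k - real k * z ^ (k - 1) - x * z ^ k) * exp (z * x))" for z
  have int: "integrable lborel (\<lambda>z. phi z * ?g j z)" for j
    using half_moment_integrable [of j x] by (subst (asm) integrable_gauss_iff) auto
  have f: "indicat_real {0..} z *\<^sub>R f z
      = phi z * ?g (Suc k) z - real k * (phi z * ?g (k - 1) z) - x * (phi z * ?g k z)" for z
    by (simp add: f_def algebra_simps)
  have "(LBINT z:{0..}. f z) = 0 - F 0"
  proof (rule LBINT_FTC_atLeast)
    show "set_integrable lborel {0..} f"
      unfolding set_integrable_def f by (intro Bochner_Integration.integrable_diff integrable_mult_right int)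
    show "(F has_real_derivative f z) (at z)" for z
    proof -
      have "(F has_real_derivative - (- (z * phi z) * (z ^ k * exp (z * x))
          + (real k * z ^ (k - 1) * exp (z * x) + z ^ k * (exp (z * x) * x)) * phi z)) (at z)"
        unfolding F_def by (rule derivative_eq_intros refl | simp)+
      then show ?thesis
        by (rule DERIV_cong) (simp add: f_def algebra_simps)
    qed
    have le: "norm (F z) \<le> phi z * exp ((real k + \<bar>x\<bar>) * \<bar>z\<bar>)" if "z \<ge> 0" for z
    proof -
      have "norm (F z) = phi z * \<bar>?g k z\<bar>"
        using that by (simp add: F_def abs_mult)
      also have "\<dots> \<le> phi z * exp ((real k + \<bar>x\<bar>) * \<bar>z\<bar>)"
        by (intro mult_left_mono half_moment_integrand_bound) auto
      finally show ?thesis .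
    qed
    show "(F \<longlongrightarrow> 0) at_top"
      using eventually_mono [OF eventually_ge_at_top [of 0] le] phi_exp_tendsto_0(1)
      by (rule Lim_null_comparison)
  qed
  also have "(LBINT z:{0..}. f z) = half_moment (Suc k) x - real k * half_moment (k - 1) x - x * half_moment k x"
    unfolding set_lebesgue_integral_def f by (simp add: int half_moment_lborel del: power_Suc)
  finally show ?thesis
    by (cases k) (auto simp: F_def)
qed

lemma half_moment_1: "half_moment 1 x = phi 0 + x * half_moment 0 x"
  using half_moment_rec [of 0 x] by simp

lemma half_moment_2: "half_moment 2 x = half_moment 0 x + x * half_moment 1 x"
  using half_moment_rec [of 1 x] by (simp add: numeral_2_eq_2)

lemma half_moment_3: "half_moment 3 x = 2 * half_moment 1 x + x * half_moment 2 x"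
  using half_moment_rec [of 2 x] by (simp add: numeral_3_eq_3 numeral_2_eq_2)

lemma LBINT_upper_moment:
  "(LBINT u:{t..}. (u - t)\<^sup>2 * phi u) = exp (- t\<^sup>2 / 2) * half_moment 2 (- t)"
proof -
  have "(LBINT u:{t..}. (u - t)\<^sup>2 * phi u)
      = (\<integral>z. indicat_real {t..} (t + 1 * z) *\<^sub>R ((t + 1 * z - t)\<^sup>2 * phi (t + 1 * z)) \<partial>lborel)"
    unfolding set_lebesgue_integral_def by (subst lborel_integral_real_affine [where c = 1 and t = t]) auto
  also have "\<dots> = (\<integral>z. exp (- t\<^sup>2 / 2) * (phi z * (indicat_real {0..} z * z\<^sup>2 * exp (z * - t))) \<partial>lborel)"
    by (intro Bochner_Integration.integral_cong)
      (auto simp: indicator_def phi_shift [of _ t] add.commute [of t])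
  finally show ?thesis
    by (simp add: half_moment_lborel)
qed

lemma LBINT_lower_moment:
  "(LBINT u:{..t}. (u - t)\<^sup>2 * phi u) = exp (- t\<^sup>2 / 2) * half_moment 2 t"
proof -
  have p: "phi (t - z) = phi z * exp (z * t) * exp (- t\<^sup>2 / 2)" for z
    using phi_shift [of "- z" t] by simp
  have "(LBINT u:{..t}. (u - t)\<^sup>2 * phi u)
      = (\<integral>z. indicat_real {..t} (t + (-1) * z) *\<^sub>R ((t + (-1) * z - t)\<^sup>2 * phi (t + (-1) * z)) \<partial>lborel)"
    unfolding set_lebesgue_integral_def by (subst lborel_integral_real_affine [where c = "-1" and t = t]) auto
  also have "\<dots> = (\<integral>z. exp (- t\<^sup>2 / 2) * (phi z * (indicat_real {0..} z * z\<^sup>2 * exp (z * t))) \<partial>lborel)"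
    by (intro Bochner_Integration.integral_cong) (auto simp: indicator_def p)
  finally show ?thesis
    by (simp add: half_moment_lborel)
qed

section \<open>Closed forms for exponential moments of squared positive parts\<close>

lemma nn_integral_half_moment:
  "(\<integral>\<^sup>+z. ennreal (c * (phi z * (indicat_real {0..} z * z ^ k * exp (z * x)))) \<partial>lborel)
    = ennreal (c * half_moment k x)" if "c \<ge> 0"
proof -
  have int: "integrable lborel (\<lambda>z. phi z * (indicat_real {0..} z * z ^ k * exp (z * x)))"
    using half_moment_integrable [of k x] by (subst (asm) integrable_gauss_iff) auto
  show ?thesis
    unfolding half_moment_lborel integral_mult_right_zero [symmetric]
  proof (rule nn_integral_eq_integral)
    show "integrable lborel (\<lambda>z. c * (phi z * (indicat_real {0..} z * z ^ k * exp (z * x))))"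
      by (intro integrable_mult_right int)
    show "AE z in lborel. 0 \<le> c * (phi z * (indicat_real {0..} z * z ^ k * exp (z * x)))"
      using that by (intro AE_I2) (auto simp: indicator_def)
  qed
qed

text \<open>Below \<open>- \<sigma>\<close> the exponent is 0 and only mass remains; above it the
  density and the exponential combine to a Gaussian of width \<open>r\<close>. The parameter
  \<open>r = 1 / sqrt (1 - 2 * a)\<close> replaces \<open>a\<close> because the result will be
  differentiated in \<open>r\<close>.\<close>

lemma nn_integral_exp_pos_part:
  fixes r \<sigma> :: real
  assumes r: "r > 0" and a: "a = (1 - 1 / r\<^sup>2) / 2"
  shows "(\<integral>\<^sup>+u. ennreal (exp (a * (max 0 (u + \<sigma>))\<^sup>2)) \<partial>gauss)
    = ennreal (exp (- \<sigma>\<^sup>2 / 2) * (half_moment 0 (- \<sigma>) + r * half_moment 0 (r * \<sigma>)))"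
proof -
  define f where "f u = ennreal (indicat_real {..- \<sigma>} u * phi u)" for u
  define g where "g u = ennreal (indicat_real {- \<sigma>..} u * (phi u * exp (a * (u + \<sigma>)\<^sup>2)))" for u
  have [measurable]: "f \<in> borel_measurable borel" "g \<in> borel_measurable borel"
    unfolding f_def g_def by measurable
  have "(\<integral>\<^sup>+u. ennreal (exp (a * (max 0 (u + \<sigma>))\<^sup>2)) \<partial>gauss)
      = (\<integral>\<^sup>+u. ennreal (phi u) * ennreal (exp (a * (max 0 (u + \<sigma>))\<^sup>2)) \<partial>lborel)"
    by (subst nn_integral_density) auto
  also have "\<dots> = (\<integral>\<^sup>+u. f u + g u \<partial>lborel)"
  proof (rule nn_integral_cong_AE)
    show "AE u in lborel. ennreal (phi u) * ennreal (exp (a * (max 0 (u + \<sigma>))\<^sup>2)) = f u + g u"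
      using AE_lborel_singleton [of "- \<sigma>"]
      by eventually_elim (auto simp: f_def g_def indicator_def max_def ennreal_mult)
  qed
  also have "\<dots> = (\<integral>\<^sup>+u. f u \<partial>lborel) + (\<integral>\<^sup>+u. g u \<partial>lborel)"
    by (rule nn_integral_add) auto
  also have "(\<integral>\<^sup>+u. f u \<partial>lborel) = (\<integral>\<^sup>+z. f (- \<sigma> + (-1) * z) \<partial>lborel)"
    by (subst nn_integral_real_affine [where c = "-1" and t = "- \<sigma>"]) auto
  also have "\<dots> = (\<integral>\<^sup>+z. ennreal (exp (- \<sigma>\<^sup>2 / 2) *
      (phi z * (indicat_real {0..} z * z ^ 0 * exp (z * - \<sigma>)))) \<partial>lborel)"
  proof (intro nn_integral_cong)
    fix z
    have "phi (- \<sigma> + (-1) * z) = phi z * exp (- (z * \<sigma>)) * exp (- \<sigma>\<^sup>2 / 2)"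
      using phi_shift [of z \<sigma>] phi_minus [of "z + \<sigma>"] by (simp add: add.commute)
    then show "f (- \<sigma> + (-1) * z)
        = ennreal (exp (- \<sigma>\<^sup>2 / 2) * (phi z * (indicat_real {0..} z * z ^ 0 * exp (z * - \<sigma>))))"
      by (simp add: f_def indicator_def)
  qed
  also have "\<dots> = ennreal (exp (- \<sigma>\<^sup>2 / 2) * half_moment 0 (- \<sigma>))"
    by (rule nn_integral_half_moment) simp
  also have "(\<integral>\<^sup>+u. g u \<partial>lborel) = ennreal r * (\<integral>\<^sup>+z. g (- \<sigma> + r * z) \<partial>lborel)"
    using r by (subst nn_integral_real_affine [where c = r and t = "- \<sigma>"]) auto
  also have "(\<integral>\<^sup>+z. g (- \<sigma> + r * z) \<partial>lborel) = (\<integral>\<^sup>+z. ennreal (exp (- \<sigma>\<^sup>2 / 2) *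
      (phi z * (indicat_real {0..} z * z ^ 0 * exp (z * (r * \<sigma>))))) \<partial>lborel)"
  proof (intro nn_integral_cong)
    fix z
    have ar: "a * r\<^sup>2 = (r\<^sup>2 - 1) / 2"
      using r by (simp add: a field_simps)
    have "- (- \<sigma> + r * z)\<^sup>2 / 2 + a * (r * z)\<^sup>2
        = - \<sigma>\<^sup>2 / 2 + (- z\<^sup>2 / 2 + z * (r * \<sigma>))"
      unfolding power_mult_distrib mult.assoc [symmetric] ar
      by (simp add: power2_eq_square field_simps)
    then have "phi (- \<sigma> + r * z) * exp (a * (r * z)\<^sup>2)
        = exp (- \<sigma>\<^sup>2 / 2) * (phi z * exp (z * (r * \<sigma>)))"
      unfolding phi_def by (simp add: exp_add [symmetric])
    then show "g (- \<sigma> + r * z)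
        = ennreal (exp (- \<sigma>\<^sup>2 / 2) * (phi z * (indicat_real {0..} z * z ^ 0 * exp (z * (r * \<sigma>)))))"
      using r by (simp add: g_def indicator_def zero_le_mult_iff)
  qed
  also have "\<dots> = ennreal (exp (- \<sigma>\<^sup>2 / 2) * half_moment 0 (r * \<sigma>))"
    by (rule nn_integral_half_moment) simp
  finally show ?thesis
    using r by (simp add: ennreal_mult' [symmetric] ennreal_plus [symmetric] half_moment_nonneg algebra_simps
        del: ennreal_plus)
qed

text \<open>The case \<open>a = 0\<close>, \<open>r = 1\<close>: the total mass of
  \<open>gauss\<close>. It normalises the moment generating function at \<open>r = 1\<close> and
  expresses the symmetry of the Gaussian distribution function.\<close>

lemma half_moment_0_add: "exp (- \<sigma>\<^sup>2 / 2) * (half_moment 0 (- \<sigma>) + half_moment 0 \<sigma>) = 1"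
proof -
  have "ennreal (exp (- \<sigma>\<^sup>2 / 2) * (half_moment 0 (- \<sigma>) + half_moment 0 \<sigma>)) = 1"
    using nn_integral_exp_pos_part [of 1 0 \<sigma>] gauss.emeasure_space_1 by simp
  then show ?thesis
    by (simp add: ennreal_eq_1)
qed

section \<open>Monotonicity arguments for the moment generating function of a truncated
  square\<close>

lemma half_moment_0_ge_half: "0 \<le> y \<Longrightarrow> 1 / 2 \<le> half_moment 0 y"
  using half_moment_mono [of 0 y 0] half_moment_0_add [of 0] by simp

lemma phi_0_le: "phi 0 \<le> 2 / 5"
proof -
  have "5 / 2 \<le> sqrt (2 * pi)"
    using pi_approx by (intro real_le_rsqrt) (simp add: power2_eq_square)
  then show ?thesis
    by (simp add: phi_def field_simps)
qed

text \<open>Let q y be \<open>exp (- y^2 / 2) * half_moment 2 y\<close>, with derivative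
  \<open>2 * exp (- y^2 / 2) * half_moment 1 y\<close>. The claim says that y q' / q is at most 1
  plus the Gaussian distribution function at \<open>y\<close>. By the recursion it reduces to
  \<open>(E * j) * (y * half_moment 1 y) \<le> (1 + E * i) * i\<close>, which leaves room for crude
  estimates: \<open>y * j \<le> phi 0\<close> (Mills ratio), \<open>E * y \<le> 1\<close>,
  \<open>phi 0 \<le> 2 / 5\<close> and \<open>1 / 2 \<le> i\<close>.\<close>

lemma half_moment_log_derivative_bound:
  assumes y: "0 \<le> y"
  shows "2 * y * half_moment 1 y \<le> (1 + exp (- y\<^sup>2 / 2) * half_moment 0 y) * half_moment 2 y"
proof -
  define E where "E = exp (- y\<^sup>2 / 2)"
  define i where "i = half_moment 0 y"
  define j where "j = half_moment 0 (- y)"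
  have E: "0 < E" "E \<le> 1"
    by (auto simp: E_def)
  have ij: "E * j = 1 - E * i"
    using half_moment_0_add [of y] by (simp add: E_def i_def j_def algebra_simps)
  have Ey: "E * y \<le> 1"
  proof -
    have "y \<le> 1 + y\<^sup>2 / 2"
      using zero_le_power2 [of "y - 1"] by (simp add: power2_eq_square algebra_simps)
    also have "\<dots> \<le> exp (y\<^sup>2 / 2)"
      by (rule exp_ge_add_one_self)
    finally show ?thesis
      by (simp add: E_def exp_minus field_simps)
  qed
  have yj: "y * j \<le> phi 0"
    using half_moment_1 [of "- y"] half_moment_nonneg [of 1 "- y"] by (simp add: j_def)
  have i: "1 / 2 \<le> i" and j: "0 \<le> j"
    using half_moment_0_ge_half [OF y] half_moment_nonneg by (auto simp: i_def j_def)
  have "(E * j) * (y * half_moment 1 y) = E * (y * j) * phi 0 + (E * y) * ((y * j) * i)"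
    unfolding half_moment_1 i_def [symmetric] by (simp add: algebra_simps)
  also have "\<dots> \<le> 1 * phi 0 * phi 0 + 1 * (phi 0 * i)"
    using E Ey yj i j y by (intro add_mono mult_mono mult_right_mono) auto
  also have "\<dots> \<le> 2 / 5 * (2 / 5) + 2 / 5 * i"
    using phi_0_le i mult_mono [OF phi_0_le phi_0_le] by (intro add_mono mult_right_mono) simp_all
  also have "\<dots> \<le> i"
    using i by simp
  also have "\<dots> \<le> (1 + E * i) * i"
    using i E by (simp add: algebra_simps)
  finally show ?thesis
    unfolding half_moment_2 ij E_def [symmetric] i_def [symmetric] by (simp add: algebra_simps)
qed

text \<open>The last factor is the moment generating function G of
  \<open>nn_integral_exp_pos_part\<close>, whose derivative in \<open>r\<close> is
  \<open>exp (- \<sigma>\<^sup>2 / 2) * half_moment 2 (r * \<sigma>)\<close>. So this is the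
  differential inequality (ln G)' \<le> \<kappa> r, where \<kappa> is the mean of the squared
  positive part.\<close>

lemma half_moment_2_scaled_le:
  assumes r: "1 \<le> r"
  shows "half_moment 2 (r * \<sigma>)
    \<le> r * half_moment 2 \<sigma> * (exp (- \<sigma>\<^sup>2 / 2) * (half_moment 0 (- \<sigma>) + r * half_moment 0 (r * \<sigma>)))"
proof (cases "\<sigma> \<le> 0")
  \<comment> \<open>For \<sigma> \<le> 0 the left side is nonincreasing in \<open>r\<close>, while G
    is nondecreasing and starts at 1.\<close>
  case True
  have "(half_moment 0 (- \<sigma>) + 1 * half_moment 0 (1 * \<sigma>)) \<le> (half_moment 0 (- \<sigma>) + r * half_moment 0 (r * \<sigma>))"
  proof (rule DERIV_nonneg_imp_nondecreasing [OF r])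
    fix x :: real
    have "((\<lambda>r. half_moment 0 (- \<sigma>) + r * half_moment 0 (r * \<sigma>)) has_real_derivative half_moment 2 (x * \<sigma>)) (at x)"
      by (auto intro!: derivative_eq_intros simp: half_moment_2 [of "x * \<sigma>"])
    then show "\<exists>y. ((\<lambda>r. half_moment 0 (- \<sigma>) + r * half_moment 0 (r * \<sigma>)) has_real_derivative y) (at x) \<and> 0 \<le> y"
      using half_moment_nonneg by blast
  qed
  then have G: "1 \<le> exp (- \<sigma>\<^sup>2 / 2) * (half_moment 0 (- \<sigma>) + r * half_moment 0 (r * \<sigma>))"
    using half_moment_0_add [of \<sigma>] by (smt (verit) exp_gt_zero mult_left_mono mult_1)
  have "half_moment 2 (r * \<sigma>) \<le> half_moment 2 \<sigma>"
    using r True mult_right_mono_neg [of 1 r \<sigma>] by (intro half_moment_mono) simp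
  also have "\<dots> = 1 * half_moment 2 \<sigma> * 1"
    by simp
  also have "\<dots> \<le> r * half_moment 2 \<sigma> * (exp (- \<sigma>\<^sup>2 / 2) * (half_moment 0 (- \<sigma>) + r * half_moment 0 (r * \<sigma>)))"
    using r G half_moment_nonneg [of 2 \<sigma>] by (intro mult_mono) auto
  finally show ?thesis .
next
  case False
  define x where "x = r * \<sigma>"
  define i where "i = half_moment 0 x"
  define j where "j = half_moment 0 (- x)"
  define q where "q y = exp (- y\<^sup>2 / 2) * half_moment 2 y" for y
  have x: "x > 0"
    using False r by (simp add: x_def)
  have i: "i \<ge> 0" and j: "j \<ge> 0"
    by (auto simp: i_def j_def half_moment_nonneg)
  have dq: "(q has_real_derivative 2 * exp (- y\<^sup>2 / 2) * half_moment 1 y) (at y)" for y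
  proof -
    have "(q has_real_derivative exp (- y\<^sup>2 / 2) * half_moment 3 y - y * exp (- y\<^sup>2 / 2) * half_moment 2 y) (at y)"
      unfolding q_def by (auto intro!: derivative_eq_intros simp: numeral_3_eq_3 numeral_2_eq_2)
    then show ?thesis
      by (rule DERIV_cong) (simp add: half_moment_3 algebra_simps)
  qed
  \<comment> \<open>The product \<open>x = r * \<sigma>\<close> is frozen and the shift is
    \<open>x / \<rho>\<close>, with \<rho> running from 1 to \<open>r\<close>. At \<rho> = 1 the
    expression equals \<open>half_moment 2 x\<close> by \<open>half_moment_0_add\<close>; at \<rho>
    = r it lies below the right-hand side because
    \<open>j \<le> half_moment 0 (- \<sigma>)\<close>.\<close>
  have "q (x / 1) * (1 * j + 1\<^sup>2 * i) \<le> q (x / r) * (r * j + r\<^sup>2 * i)"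
  proof (rule DERIV_nonneg_imp_nondecreasing [OF r])
    fix \<rho> assume \<rho>: "1 \<le> \<rho>" "\<rho> \<le> r"
    define y where "y = x / \<rho>"
    define E where "E = exp (- y\<^sup>2 / 2)"
    have y: "0 \<le> y" "y \<le> x"
      using x \<rho> by (auto simp: y_def field_simps)
    have "((\<lambda>\<rho>. q (x / \<rho>) * (\<rho> * j + \<rho>\<^sup>2 * i)) has_real_derivative
        2 * E * half_moment 1 y * (- x / \<rho>\<^sup>2) * (\<rho> * j + \<rho>\<^sup>2 * i) + q y * (j + 2 * \<rho> * i)) (at \<rho>)"
      unfolding E_def y_def using \<rho>
      by (auto intro!: derivative_eq_intros DERIV_chain2 [OF dq] simp: power2_eq_square)
    moreover have "2 * E * half_moment 1 y * (- x / \<rho>\<^sup>2) * (\<rho> * j + \<rho>\<^sup>2 * i)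
        = - (E * (2 * y * half_moment 1 y) * (j + \<rho> * i))"
      using \<rho> by (simp add: y_def power2_eq_square field_simps)
    \<comment> \<open>With \<open>p = E * half_moment 0 y\<close>, the logarithmic derivative bound
      leaves \<open>p * j \<le> (1 - p) * \<rho> * i\<close>. Since
      \<open>1 - p = E * half_moment 0 (- y)\<close>, this follows from the monotonicity of
      \<open>half_moment 0\<close>, from \<open>y \<le> x\<close> and from
      \<open>1 \<le> \<rho>\<close>.\<close>
    moreover have "E * (2 * y * half_moment 1 y) * (j + \<rho> * i) \<le> q y * (j + 2 * \<rho> * i)"
    proof -
      have Ey: "E * (half_moment 0 (- y) + half_moment 0 y) = 1"
        using half_moment_0_add [of y] by (simp add: E_def)
      have "E * (2 * y * half_moment 1 y) * (j + \<rho> * i)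
          \<le> E * ((1 + E * half_moment 0 y) * half_moment 2 y) * (j + \<rho> * i)"
        using half_moment_log_derivative_bound [OF y(1)] \<rho> i j
        by (intro mult_right_mono mult_left_mono) (auto simp: E_def)
      also have "\<dots> = q y * ((1 + E * half_moment 0 y) * (j + \<rho> * i))"
        by (simp add: q_def E_def)
      also have "\<dots> \<le> q y * (j + 2 * \<rho> * i)"
      proof (rule mult_left_mono)
        have "half_moment 0 y * j \<le> i * half_moment 0 (- y)"
          unfolding i_def j_def using y
          by (intro mult_mono half_moment_mono half_moment_nonneg) auto
        also have "\<dots> \<le> (\<rho> * i) * half_moment 0 (- y)"
          using \<rho> i mult_right_mono [OF \<rho>(1) i] by (intro mult_right_mono half_moment_nonneg) simp
        finally have "E * half_moment 0 y * j \<le> E * half_moment 0 (- y) * (\<rho> * i)"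
          using mult_left_mono [of "half_moment 0 y * j" "(\<rho> * i) * half_moment 0 (- y)" E]
          by (simp add: E_def mult_ac)
        moreover have "E * half_moment 0 (- y) = 1 - E * half_moment 0 y"
          using Ey by (simp add: algebra_simps)
        ultimately show "(1 + E * half_moment 0 y) * (j + \<rho> * i) \<le> j + 2 * \<rho> * i"
          by (simp add: algebra_simps)
      qed (simp add: q_def half_moment_nonneg)
      finally show ?thesis .
    qed
    ultimately show "\<exists>z. ((\<lambda>\<rho>. q (x / \<rho>) * (\<rho> * j + \<rho>\<^sup>2 * i)) has_real_derivative z) (at \<rho>) \<and> 0 \<le> z"
      by (intro exI [of _ "2 * E * half_moment 1 y * (- x / \<rho>\<^sup>2) * (\<rho> * j + \<rho>\<^sup>2 * i) + q y * (j + 2 * \<rho> * i)"]) simp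
  qed
  also have "q (x / 1) * (1 * j + 1\<^sup>2 * i) = half_moment 2 x"
    using half_moment_0_add [of x] by (simp add: q_def i_def j_def algebra_simps)
  also have "q (x / r) * (r * j + r\<^sup>2 * i) \<le> q \<sigma> * (r * half_moment 0 (- \<sigma>) + r\<^sup>2 * i)"
  proof -
    have "j \<le> half_moment 0 (- \<sigma>)"
      unfolding j_def using r False by (intro half_moment_mono) (simp add: x_def mult_le_cancel_right1)
    then show ?thesis
      using r by (intro mult_mono add_mono mult_left_mono)
        (auto simp: q_def x_def half_moment_nonneg i_def j_def)
  qed
  finally show ?thesis
    by (simp add: q_def x_def i_def power2_eq_square algebra_simps)
qed

text \<open>A Gronwall argument in the variable \<open>(r^2 - 1) / 2\<close>: by
  \<open>half_moment_2_scaled_le\<close> the quotient of the two sides is nonincreasing in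
  \<open>r\<close>, and it equals 1 at \<open>r = 1\<close>.\<close>

lemma pos_part_mgf_le:
  assumes r: "1 \<le> r"
  shows "exp (- \<sigma>\<^sup>2 / 2) * (half_moment 0 (- \<sigma>) + r * half_moment 0 (r * \<sigma>))
    \<le> exp (exp (- \<sigma>\<^sup>2 / 2) * half_moment 2 \<sigma> * ((r\<^sup>2 - 1) / 2))"
proof -
  define E where "E = exp (- \<sigma>\<^sup>2 / 2)"
  define \<kappa> where "\<kappa> = E * half_moment 2 \<sigma>"
  define G where "G r = E * (half_moment 0 (- \<sigma>) + r * half_moment 0 (r * \<sigma>))" for r
  have "G r * exp (- \<kappa> * ((r\<^sup>2 - 1) / 2)) \<le> G 1 * exp (- \<kappa> * ((1\<^sup>2 - 1) / 2))"
  proof (rule DERIV_nonpos_imp_nonincreasing [OF r])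
    fix x :: real assume x: "1 \<le> x"
    have dG: "(G has_real_derivative E * half_moment 2 (x * \<sigma>)) (at x)"
      unfolding G_def by (auto intro!: derivative_eq_intros simp: half_moment_2 [of "x * \<sigma>"])
    have "((\<lambda>r. G r * exp (- \<kappa> * ((r\<^sup>2 - 1) / 2))) has_real_derivative
        (E * half_moment 2 (x * \<sigma>) - \<kappa> * x * G x) * exp (- \<kappa> * ((x\<^sup>2 - 1) / 2))) (at x)"
      by (auto intro!: derivative_eq_intros dG simp: algebra_simps)
    moreover have "E * half_moment 2 (x * \<sigma>) - \<kappa> * x * G x \<le> 0"
      using mult_left_mono [OF half_moment_2_scaled_le [OF x, of \<sigma>], of E]
      by (simp add: \<kappa>_def G_def E_def mult_ac)
    ultimately show "\<exists>y. ((\<lambda>r. G r * exp (- \<kappa> * ((r\<^sup>2 - 1) / 2))) has_real_derivative y) (at x) \<and> y \<le> 0"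
      by (intro exI [of _ "(E * half_moment 2 (x * \<sigma>) - \<kappa> * x * G x) * exp (- \<kappa> * ((x\<^sup>2 - 1) / 2))"])
        (simp add: mult_nonpos_nonneg)
  qed
  moreover have "G 1 = 1"
    using half_moment_0_add [of \<sigma>] by (simp add: G_def E_def)
  ultimately have "G r * exp (- \<kappa> * ((r\<^sup>2 - 1) / 2)) * exp (\<kappa> * ((r\<^sup>2 - 1) / 2)) \<le> 1 * exp (\<kappa> * ((r\<^sup>2 - 1) / 2))"
    by (intro mult_right_mono) simp_all
  then show ?thesis
    unfolding G_def [symmetric] E_def [symmetric] \<kappa>_def [symmetric] mult.assoc exp_add [symmetric] by simp
qed

text \<open>The untruncated counterpart, in the same shape since \<open>1 + t^2\<close> is the mean
  of (u - t)^2. The prefactor is absorbed through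
  \<open>1 / b = 1 + 2 * (a / b) \<le> exp (2 * (a / b))\<close>.\<close>

lemma nn_integral_exp_square_le:
  assumes a: "0 \<le> a" "a < 1 / 2"
  shows "(\<integral>\<^sup>+u. ennreal (exp (a * (u - t)\<^sup>2)) \<partial>gauss) \<le> ennreal (exp (a / (1 - 2 * a) * (1 + t\<^sup>2)))"
proof -
  define b where "b = 1 - 2 * a"
  have b: "0 < b" "b \<le> 1"
    using a by (auto simp: b_def)
  have "1 / b \<le> (exp (a / b))\<^sup>2"
  proof -
    have "1 / b = 1 + 2 * (a / b)"
      using b by (simp add: b_def field_simps)
    also have "\<dots> \<le> exp (2 * (a / b))"
      by (rule exp_ge_add_one_self)
    finally show ?thesis
      by (simp add: exp_double [symmetric])
  qed
  then have "1 / sqrt b \<le> exp (a / b)"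
    using real_le_lsqrt [of "exp (a / b)" "1 / b"] by (simp add: real_sqrt_divide)
  then have "1 / sqrt b * exp (a * t\<^sup>2 / b) \<le> exp (a / b) * exp (a * t\<^sup>2 / b)"
    by (rule mult_right_mono) simp
  also have "\<dots> = exp (a / b * (1 + t\<^sup>2))"
    by (simp add: exp_add [symmetric] algebra_simps)
  finally show ?thesis
    using gauss_exp_square [OF a(2), of t] unfolding b_def
    by (subst nn_integral_eq_integral) (auto simp: has_bochner_integral_iff)
qed

text \<open>Back from \<open>r\<close> to \<open>a\<close>, using
  \<open>(r^2 - 1) / 2 = a / (1 - 2 * a)\<close>. The exponent is linear in the second moment, so a
  product over coordinates involves only the sum of the second moments.\<close>

lemma nn_integral_exp_pos_part_le:
  assumes a: "0 \<le> a" "a < 1 / 2"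
  shows "(\<integral>\<^sup>+u. ennreal (exp (a * (max 0 (u + \<sigma>))\<^sup>2)) \<partial>gauss)
    \<le> ennreal (exp (a / (1 - 2 * a) * (exp (- \<sigma>\<^sup>2 / 2) * half_moment 2 \<sigma>)))"
proof -
  define r where "r = 1 / sqrt (1 - 2 * a)"
  have r2: "r\<^sup>2 = 1 / (1 - 2 * a)" and r: "1 \<le> r"
    using a by (auto simp: r_def power_divide real_sqrt_le_1_iff)
  have ra: "a = (1 - 1 / r\<^sup>2) / 2" and ra': "(r\<^sup>2 - 1) / 2 = a / (1 - 2 * a)"
    using a by (auto simp: r2 field_simps)
  have "(\<integral>\<^sup>+u. ennreal (exp (a * (max 0 (u + \<sigma>))\<^sup>2)) \<partial>gauss)
      = ennreal (exp (- \<sigma>\<^sup>2 / 2) * (half_moment 0 (- \<sigma>) + r * half_moment 0 (r * \<sigma>)))"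
    using r by (intro nn_integral_exp_pos_part ra) simp
  also have "\<dots> \<le> ennreal (exp (exp (- \<sigma>\<^sup>2 / 2) * half_moment 2 \<sigma> * ((r\<^sup>2 - 1) / 2)))"
    by (intro ennreal_leI pos_part_mgf_le r)
  finally show ?thesis
    unfolding ra' by (simp only: mult.commute)
qed

lemma nn_integral_exp_upper_part_le:
  assumes a: "0 \<le> a" "a < 1 / 2"
  shows "(\<integral>\<^sup>+u. ennreal (exp (a * (max 0 (u - t))\<^sup>2)) \<partial>gauss)
    \<le> ennreal (exp (a / (1 - 2 * a) * (LBINT u:{t..}. (u - t)\<^sup>2 * phi u)))"
  using nn_integral_exp_pos_part_le [OF a, of "- t"] by (simp add: LBINT_upper_moment)

lemma nn_integral_exp_lower_part_le:
  assumes a: "0 \<le> a" "a < 1 / 2"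
  shows "(\<integral>\<^sup>+u. ennreal (exp (a * (max 0 (t - u))\<^sup>2)) \<partial>gauss)
    \<le> ennreal (exp (a / (1 - 2 * a) * (LBINT u:{..t}. (u - t)\<^sup>2 * phi u)))"
proof -
  have "(\<integral>\<^sup>+u. ennreal (exp (a * (max 0 (t - u))\<^sup>2)) \<partial>gauss)
      = (\<integral>\<^sup>+u. ennreal (phi u) * ennreal (exp (a * (max 0 (t - u))\<^sup>2)) \<partial>lborel)"
    by (subst nn_integral_density) auto
  also have "\<dots> = (\<integral>\<^sup>+u. ennreal (phi u) * ennreal (exp (a * (max 0 (u + t))\<^sup>2)) \<partial>lborel)"
    by (subst nn_integral_real_affine [where c = "-1" and t = 0]) (auto simp: add.commute)
  also have "\<dots> = (\<integral>\<^sup>+u. ennreal (exp (a * (max 0 (u + t))\<^sup>2)) \<partial>gauss)"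
    by (subst nn_integral_density) auto
  finally show ?thesis
    using nn_integral_exp_pos_part_le [OF a, of t] by (simp add: LBINT_lower_moment)
qed

text \<open>The decay \<open>1 / l\<close>, one power per coordinate, decides the case of more rows
  than columns. Each half-line contributes \<open>half_moment 0 (- l) \<le> phi 0 / l\<close>, and
  \<open>2 * phi 0 \<le> 1\<close>.\<close>

lemma nn_integral_exp_minus_abs_le:
  assumes l: "0 < l"
  shows "(\<integral>\<^sup>+u. ennreal (exp (- l * \<bar>u\<bar>)) \<partial>gauss) \<le> ennreal (1 / l)"
proof -
  have h: "half_moment 0 (- l) \<le> phi 0 / l"
    using half_moment_1 [of "- l"] half_moment_nonneg [of 1 "- l"] l by (simp add: field_simps)
  define g where "g u = ennreal (1 * (phi u * (indicat_real {0..} u * u ^ 0 * exp (u * - l))))" for u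
  have g [measurable]: "g \<in> borel_measurable borel"
    unfolding g_def by measurable
  have gi: "(\<integral>\<^sup>+u. g u \<partial>lborel) = ennreal (half_moment 0 (- l))"
    using nn_integral_half_moment [of 1 0 "- l"] by (simp add: g_def)
  have gi': "(\<integral>\<^sup>+u. g (0 + (-1) * u) \<partial>lborel) = (\<integral>\<^sup>+u. g u \<partial>lborel)"
    using nn_integral_real_affine [OF g, of "-1" 0] by simp
  have "(\<integral>\<^sup>+u. ennreal (exp (- l * \<bar>u\<bar>)) \<partial>gauss) = (\<integral>\<^sup>+u. ennreal (phi u) * ennreal (exp (- l * \<bar>u\<bar>)) \<partial>lborel)"
    by (subst nn_integral_density) auto
  also have "\<dots> \<le> (\<integral>\<^sup>+u. g u + g (0 + (-1) * u) \<partial>lborel)"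
  proof (intro nn_integral_mono)
    fix u
    show "ennreal (phi u) * ennreal (exp (- l * \<bar>u\<bar>)) \<le> g u + g (0 + (-1) * u)"
      by (cases "u \<ge> 0") (simp_all add: g_def ennreal_mult' [symmetric] mult.commute)
  qed
  also have "\<dots> = (\<integral>\<^sup>+u. g u \<partial>lborel) + (\<integral>\<^sup>+u. g (0 + (-1) * u) \<partial>lborel)"
    by (rule nn_integral_add) simp_all
  also have "\<dots> = ennreal (2 * half_moment 0 (- l))"
    unfolding gi' gi by (simp add: ennreal_plus [symmetric] half_moment_nonneg del: ennreal_plus)
  also have "\<dots> \<le> ennreal (1 / l)"
    using h phi_0_le l by (intro ennreal_leI) (simp add: field_simps)
  finally show ?thesis .
qed

section \<open>Products of standard Gaussians\<close>

abbreviation gauss_PiM :: "'i set \<Rightarrow> ('i \<Rightarrow> real) measure" where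
  "gauss_PiM I \<equiv> PiM I (\<lambda>_. gauss)"

interpretation gauss_prod: product_prob_space "\<lambda>_::'i. gauss" I for I :: "'i set"
  by standard

lemma measurable_gauss_component:
  "c \<in> I \<Longrightarrow> (\<lambda>w. w c) \<in> borel_measurable (gauss_PiM I)"
  using measurable_component_singleton [of c I "\<lambda>_. gauss"]
  by (simp cong: measurable_cong_sets)

lemma emeasure_space_gauss_PiM [simp]: "emeasure (gauss_PiM I) (space (gauss_PiM I)) = 1"
  by (rule gauss_prod.emeasure_space_1)

lemma nn_integral_gauss_PiM_prod:
  fixes f :: "'i \<Rightarrow> real \<Rightarrow> ennreal"
  assumes I: "finite I" "J \<subseteq> I" and f: "\<And>c. c \<in> J \<Longrightarrow> f c \<in> borel_measurable borel"
  shows "(\<integral>\<^sup>+w. (\<Prod>c\<in>J. f c (w c)) \<partial>gauss_PiM I) = (\<Prod>c\<in>J. \<integral>\<^sup>+u. f c u \<partial>gauss)"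
proof -
  define g where "g c = (if c \<in> J then f c else (\<lambda>_. 1))" for c
  have "(\<integral>\<^sup>+w. (\<Prod>c\<in>I. g c (w c)) \<partial>gauss_PiM I) = (\<Prod>c\<in>I. \<integral>\<^sup>+u. g c u \<partial>gauss)"
    using f by (intro gauss_prod.product_nn_integral_prod I) (auto simp: g_def)
  also have "(\<Prod>c\<in>I. \<integral>\<^sup>+u. g c u \<partial>gauss) = (\<Prod>c\<in>J. \<integral>\<^sup>+u. f c u \<partial>gauss)"
    using I gauss.emeasure_space_1 by (intro prod.mono_neutral_cong_right) (auto simp: g_def)
  also have "(\<integral>\<^sup>+w. (\<Prod>c\<in>I. g c (w c)) \<partial>gauss_PiM I) = (\<integral>\<^sup>+w. (\<Prod>c\<in>J. f c (w c)) \<partial>gauss_PiM I)"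
    using I by (intro nn_integral_cong prod.mono_neutral_cong_right) (auto simp: g_def)
  finally show ?thesis .
qed

text \<open>Independence of disjoint blocks of coordinates, with dependence on a block stated as
  invariance under changes elsewhere. Freezing the other block at 0 produces genuine functions
  \<open>F\<close>, \<open>G\<close> of one block each, and Fubini separates them.\<close>

lemma nn_integral_gauss_PiM_mult:
  fixes f g :: "('i \<Rightarrow> real) \<Rightarrow> ennreal"
  assumes I: "finite I" "A \<subseteq> I"
    and fm [measurable]: "f \<in> borel_measurable (gauss_PiM I)"
    and gm [measurable]: "g \<in> borel_measurable (gauss_PiM I)"
    and f: "\<And>w w'. (\<And>c. c \<in> A \<Longrightarrow> w c = w' c) \<Longrightarrow> f w = f w'"
    and g: "\<And>w w'. (\<And>c. c \<in> I - A \<Longrightarrow> w c = w' c) \<Longrightarrow> g w = g w'"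
  shows "(\<integral>\<^sup>+w. f w * g w \<partial>gauss_PiM I) = (\<integral>\<^sup>+w. f w \<partial>gauss_PiM I) * (\<integral>\<^sup>+w. g w \<partial>gauss_PiM I)"
proof -
  define B where "B = I - A"
  have AB: "A \<inter> B = {}" "finite A" "finite B" and IAB: "I = A \<union> B"
    using I finite_subset by (auto simp: B_def)
  define y0 where "y0 = (\<lambda>i\<in>B. 0::real)"
  define x0 where "x0 = (\<lambda>i\<in>A. 0::real)"
  have sp: "y0 \<in> space (gauss_PiM B)" "x0 \<in> space (gauss_PiM A)"
    by (auto simp: space_PiM y0_def x0_def)
  define F where "F x = f (merge A B (x, y0))" for x
  define G where "G y = g (merge A B (x0, y))" for y
  have fm' [measurable]: "f \<in> borel_measurable (gauss_PiM (A \<union> B))"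
    and gm' [measurable]: "g \<in> borel_measurable (gauss_PiM (A \<union> B))"
    using fm gm IAB by auto
  have [measurable]: "F \<in> borel_measurable (gauss_PiM A)" "G \<in> borel_measurable (gauss_PiM B)"
    unfolding F_def G_def using sp by measurable
  have fF: "f (merge A B (x, y)) = F x" and gG: "g (merge A B (x, y)) = G y" for x y
    using AB unfolding F_def G_def by (auto intro!: f g simp: merge_def B_def)
  have 1: "(\<integral>\<^sup>+w. f w * g w \<partial>gauss_PiM I) = (\<integral>\<^sup>+x. F x \<partial>gauss_PiM A) * (\<integral>\<^sup>+y. G y \<partial>gauss_PiM B)"
    unfolding IAB
    by (subst gauss_prod.product_nn_integral_fold [OF AB])
      (simp_all add: fF gG nn_integral_cmult nn_integral_multc)
  have 2: "(\<integral>\<^sup>+w. f w \<partial>gauss_PiM I) = (\<integral>\<^sup>+x. F x \<partial>gauss_PiM A)"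
    unfolding IAB by (subst gauss_prod.product_nn_integral_fold [OF AB]) (simp_all add: fF)
  have 3: "(\<integral>\<^sup>+w. g w \<partial>gauss_PiM I) = (\<integral>\<^sup>+y. G y \<partial>gauss_PiM B)"
    unfolding IAB by (subst gauss_prod.product_nn_integral_fold [OF AB]) (simp_all add: gG)
  show ?thesis
    unfolding 1 2 3 ..
qed

lemma integrable_gauss_PiM_exp_abs:
  assumes I: "finite I"
  shows "integrable (gauss_PiM I) (\<lambda>w. exp (k * (\<Sum>c\<in>I. \<bar>w c\<bar>)))"
proof -
  have "integrable (gauss_PiM I) (\<lambda>w. \<Prod>c\<in>I. exp (k * \<bar>w c\<bar>))"
    by (intro gauss_prod.product_integrable_prod I integrable_gauss_exp_abs)
  then show ?thesis
    by (simp add: sum_distrib_left exp_sum I)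
qed

lemma integrable_gauss_PiM_bound:
  fixes F :: "('i \<Rightarrow> real) \<Rightarrow> real"
  assumes I: "finite I" and "F \<in> borel_measurable (gauss_PiM I)"
    and "\<And>w. \<bar>F w\<bar> \<le> C * exp (k * (\<Sum>c\<in>I. \<bar>w c\<bar>))"
  shows "integrable (gauss_PiM I) F"
proof (rule Bochner_Integration.integrable_bound)
  show "integrable (gauss_PiM I) (\<lambda>w. C * exp (k * (\<Sum>c\<in>I. \<bar>w c\<bar>)))"
    by (intro integrable_mult_right integrable_gauss_PiM_exp_abs I)
  show "F \<in> borel_measurable (gauss_PiM I)" by fact
  show "AE w in gauss_PiM I. norm (F w) \<le> norm (C * exp (k * (\<Sum>c\<in>I. \<bar>w c\<bar>)))"
    unfolding real_norm_def by (intro AE_I2 order_trans [OF assms(3) abs_ge_self])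
qed

lemma integrable_gauss_PiM_coord_mult:
  fixes F :: "('i \<Rightarrow> real) \<Rightarrow> real"
  assumes I: "finite I" and c: "c \<in> I" and F: "F \<in> borel_measurable (gauss_PiM I)"
    and bound: "\<And>w. \<bar>F w\<bar> \<le> C * exp (k * (\<Sum>c\<in>I. \<bar>w c\<bar>))"
  shows "integrable (gauss_PiM I) (\<lambda>w. w c * F w)"
proof (rule integrable_gauss_PiM_bound [OF I])
  show "(\<lambda>w. w c * F w) \<in> borel_measurable (gauss_PiM I)"
    by (intro borel_measurable_times F measurable_gauss_component c)
  fix w :: "'i \<Rightarrow> real"
  have "\<bar>w c\<bar> \<le> (\<Sum>c\<in>I. \<bar>w c\<bar>)"
    using member_le_sum [of c I "\<lambda>c. \<bar>w c\<bar>"] c I by auto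
  also have "\<dots> \<le> exp (\<Sum>c\<in>I. \<bar>w c\<bar>)"
    using exp_ge_add_one_self [of "\<Sum>c\<in>I. \<bar>w c\<bar>"] by linarith
  finally have "\<bar>w c\<bar> * \<bar>F w\<bar> \<le> exp (\<Sum>c\<in>I. \<bar>w c\<bar>) * (C * exp (k * (\<Sum>c\<in>I. \<bar>w c\<bar>)))"
    by (intro mult_mono bound) auto
  then show "\<bar>w c * F w\<bar> \<le> C * exp ((k + 1) * (\<Sum>c\<in>I. \<bar>w c\<bar>))"
    by (simp add: abs_mult distrib_right exp_add mult_ac)
qed

text \<open>Stein's identity in one coordinate, after Fubini. The exponential envelope factors over
  the coordinates, so with the others fixed it is a bound in one variable whose constant absorbs
  their factors.\<close>

lemma gauss_PiM_integration_by_parts: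
  fixes F F' :: "('i \<Rightarrow> real) \<Rightarrow> real"
  assumes I: "finite I" and c: "c \<in> I"
    and F: "F \<in> borel_measurable (gauss_PiM I)" and F': "F' \<in> borel_measurable (gauss_PiM I)"
    and deriv: "\<And>w t. ((\<lambda>t. F (w(c := t))) has_real_derivative F' (w(c := t))) (at t)"
    and bound: "\<And>w. \<bar>F w\<bar> \<le> C * exp (k * (\<Sum>c\<in>I. \<bar>w c\<bar>))"
      "\<And>w. \<bar>F' w\<bar> \<le> C * exp (k * (\<Sum>c\<in>I. \<bar>w c\<bar>))"
  shows "(\<integral>w. w c * F w \<partial>gauss_PiM I) = (\<integral>w. F' w \<partial>gauss_PiM I)"
proof -
  define J where "J = I - {c}"
  have J: "finite J" "c \<notin> J" and IJ: "I = insert c J"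
    using I c by (auto simp: J_def)
  have i1: "integrable (gauss_PiM (insert c J)) (\<lambda>w. w c * F w)"
    using integrable_gauss_PiM_coord_mult [OF I c F bound(1)] by (simp add: IJ)
  have i2: "integrable (gauss_PiM (insert c J)) F'"
    using integrable_gauss_PiM_bound [OF I F' bound(2)] by (simp add: IJ)
  have sum: "(\<Sum>d\<in>I. \<bar>(x(c := y)) d\<bar>) = \<bar>y\<bar> + (\<Sum>d\<in>J. \<bar>x d\<bar>)" for x :: "'i \<Rightarrow> real" and y
  proof -
    have "(\<Sum>d\<in>J. \<bar>(x(c := y)) d\<bar>) = (\<Sum>d\<in>J. \<bar>x d\<bar>)"
      using J by (intro sum.cong) auto
    then show ?thesis
      using J by (simp add: IJ)
  qed
  have "(\<integral>w. w c * F w \<partial>gauss_PiM I) = (\<integral>x. (\<integral>y. y * F (x(c := y)) \<partial>gauss) \<partial>gauss_PiM J)"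
    unfolding IJ by (subst gauss_prod.product_integral_insert [OF J i1]) simp
  also have "\<dots> = (\<integral>x. (\<integral>y. F' (x(c := y)) \<partial>gauss) \<partial>gauss_PiM J)"
  proof (rule Bochner_Integration.integral_cong [OF refl])
    fix x assume x: "x \<in> space (gauss_PiM J)"
    have "(\<lambda>y. x(c := y)) \<in> measurable gauss (gauss_PiM (insert c J))"
      using measurable_component_update [OF x J(2)] .
    then have m: "(\<lambda>y. F' (x(c := y))) \<in> borel_measurable gauss"
      using F' unfolding IJ by (rule measurable_compose)
    show "(\<integral>y. y * F (x(c := y)) \<partial>gauss) = (\<integral>y. F' (x(c := y)) \<partial>gauss)"
    proof (rule gauss_integration_by_parts)
      show "(\<lambda>y. F' (x(c := y))) \<in> borel_measurable borel"
        using m unfolding measurable_density_eq1 measurable_lborel2 .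
      show "\<bar>F (x(c := y))\<bar> \<le> C * exp (k * (\<Sum>d\<in>J. \<bar>x d\<bar>)) * exp (k * \<bar>y\<bar>)"
        "\<bar>F' (x(c := y))\<bar> \<le> C * exp (k * (\<Sum>d\<in>J. \<bar>x d\<bar>)) * exp (k * \<bar>y\<bar>)" for y
        using bound [of "x(c := y)"] unfolding sum distrib_left exp_add
        by (simp_all only: mult.assoc mult.commute [of "exp (k * \<bar>y\<bar>)"])
    qed (rule deriv)
  qed
  also have "\<dots> = (\<integral>w. F' w \<partial>gauss_PiM I)"
    unfolding IJ by (rule gauss_prod.product_integral_insert [OF J i2, symmetric])
  finally show ?thesis .
qed

lemma nn_integral_gauss_PiM_restrict:
  assumes I: "finite I" "J \<subseteq> I" and [measurable]: "f \<in> borel_measurable (gauss_PiM J)"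
  shows "(\<integral>\<^sup>+w. f (restrict w J) \<partial>gauss_PiM I) = (\<integral>\<^sup>+w. f w \<partial>gauss_PiM J)"
proof -
  have J: "finite J"
    using I finite_subset by blast
  have "(\<integral>\<^sup>+w. f w \<partial>gauss_PiM J) = (\<integral>\<^sup>+w. f w \<partial>distr (gauss_PiM I) (gauss_PiM J) (\<lambda>x. restrict x J))"
    using gauss_prod.distr_PiM_restrict_finite [OF J I(2)] by simp
  also have "\<dots> = (\<integral>\<^sup>+w. f (restrict w J) \<partial>gauss_PiM I)"
    using I by (subst nn_integral_distr) (auto intro!: measurable_restrict_subset)
  finally show ?thesis ..
qed

section \<open>Gaussian interpolation for Gordon's comparison\<close>

lemma integral_sum_sum_add_sum:
  fixes a b :: "_ \<Rightarrow> real"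
  assumes "\<And>i j. i \<in> A \<Longrightarrow> j \<in> B \<Longrightarrow> integrable M (f i j)" "\<And>j. j \<in> B \<Longrightarrow> integrable M (g j)"
  shows "(\<integral>w. (\<Sum>i\<in>A. \<Sum>j\<in>B. a j * f i j w) + (\<Sum>j\<in>B. b j * g j w) \<partial>M)
    = (\<Sum>i\<in>A. \<Sum>j\<in>B. a j * (\<integral>w. f i j w \<partial>M)) + (\<Sum>j\<in>B. b j * (\<integral>w. g j w \<partial>M))"
proof -
  have 1: "integrable M (\<lambda>w. \<Sum>j\<in>B. a j * f i j w)" if "i \<in> A" for i
    using that assms by (intro Bochner_Integration.integrable_sum integrable_mult_right) auto
  have 2: "integrable M (\<lambda>w. \<Sum>j\<in>B. b j * g j w)"
    using assms by (intro Bochner_Integration.integrable_sum integrable_mult_right) auto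
  have "(\<integral>w. (\<Sum>i\<in>A. \<Sum>j\<in>B. a j * f i j w) + (\<Sum>j\<in>B. b j * g j w) \<partial>M)
      = (\<Sum>i\<in>A. \<integral>w. (\<Sum>j\<in>B. a j * f i j w) \<partial>M) + (\<integral>w. (\<Sum>j\<in>B. b j * g j w) \<partial>M)"
    by (subst Bochner_Integration.integral_add [OF Bochner_Integration.integrable_sum [OF 1] 2])
      (simp_all add: Bochner_Integration.integral_sum [OF 1])
  also have "\<dots> = (\<Sum>i\<in>A. \<Sum>j\<in>B. a j * (\<integral>w. f i j w \<partial>M)) + (\<Sum>j\<in>B. b j * (\<integral>w. g j w \<partial>M))"
    using assms by (simp add: Bochner_Integration.integral_sum)
  finally show ?thesis .
qed

text \<open>\<open>T\<close> is finite so that the minimum over it can be smoothed, with \<beta> as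
  inverse temperature; \<delta> keeps the norm away from 0, where it is not differentiable. The
  condition \<open>s \<le> \<beta>\<close> makes \<open>1 - s / \<beta>\<close> nonnegative, and
  this factor carries the sign of the drift.\<close>

locale gordon_interpolation =
  fixes m N :: nat and T :: "(nat \<Rightarrow> real) set" and s \<beta> \<delta> :: real
  assumes finT: "finite T" and T_ne: "T \<noteq> {}"
    and unit: "\<And>x. x \<in> T \<Longrightarrow> (\<Sum>j<N. (x j)\<^sup>2) = 1"
    and s_pos: "0 < s" and s_le: "s \<le> \<beta>" and delta_pos: "0 < \<delta>"
begin

text \<open>Row \<open>m\<close> of the enlarged Gaussian matrix holds the auxiliary vector \<open>g\<close>, column \<open>N\<close> holds \<open>h\<close>,
  and the corner entry is the scalar that makes the variances of the two compared processes agree.\<close>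

definition IX :: "(nat \<times> nat) set" where
  "IX = {..<Suc m} \<times> {..<Suc N}"

text \<open>For unit x this is a unit vector in dimension N + 1, rotating from the last basis vector
  at angle 0 to x at pi / 2, and \<open>P'\<close> is its velocity. Applying the first
  \<open>m\<close> rows to \<open>P\<close> and row \<open>m\<close> to \<open>P'\<close> joins the
  two processes of Gordon's comparison by one angle, smoothly up to both ends.\<close>

definition P :: "real \<Rightarrow> (nat \<Rightarrow> real) \<Rightarrow> nat \<Rightarrow> real" where
  "P \<theta> x j = (if j < N then sin \<theta> * x j else cos \<theta>)"

definition P' :: "real \<Rightarrow> (nat \<Rightarrow> real) \<Rightarrow> nat \<Rightarrow> real" where
  "P' \<theta> x j = (if j < N then cos \<theta> * x j else - sin \<theta>)"

definition V :: "real \<Rightarrow> (nat \<times> nat \<Rightarrow> real) \<Rightarrow> (nat \<Rightarrow> real) \<Rightarrow> nat \<Rightarrow> real" where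
  "V \<theta> w x i = (\<Sum>j<Suc N. w (i, j) * P \<theta> x j)"

definition U :: "real \<Rightarrow> (nat \<times> nat \<Rightarrow> real) \<Rightarrow> (nat \<Rightarrow> real) \<Rightarrow> real" where
  "U \<theta> w x = (\<Sum>j<Suc N. w (m, j) * P' \<theta> x j)"

definition nr :: "real \<Rightarrow> (nat \<times> nat \<Rightarrow> real) \<Rightarrow> (nat \<Rightarrow> real) \<Rightarrow> real" where
  "nr \<theta> w x = sqrt (\<delta> + (\<Sum>i<m. (V \<theta> w x i)\<^sup>2))"

definition Z :: "real \<Rightarrow> (nat \<times> nat \<Rightarrow> real) \<Rightarrow> (nat \<Rightarrow> real) \<Rightarrow> real" where
  "Z \<theta> w x = nr \<theta> w x - U \<theta> w x"

definition D :: "real \<Rightarrow> (nat \<times> nat \<Rightarrow> real) \<Rightarrow> (nat \<Rightarrow> real) \<Rightarrow> nat \<Rightarrow> real" where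
  "D \<theta> w x i = V \<theta> w x i / nr \<theta> w x"

definition S :: "((nat \<Rightarrow> real) \<Rightarrow> real) \<Rightarrow> real" where
  "S z = (\<Sum>x\<in>T. exp (- \<beta> * z x))"

text \<open>Up to the factor \<open>- s\<close>, the partial derivative of
  \<open>S z powr (s / \<beta>)\<close> in \<open>z x\<close>. Differentiating \<open>Q\<close> once
  more along a direction \<open>z'\<close> gives \<open>dQ\<close>, where the Gibbs distribution
  \<open>wt\<close> on \<open>T\<close> appears.\<close>

definition Q :: "((nat \<Rightarrow> real) \<Rightarrow> real) \<Rightarrow> (nat \<Rightarrow> real) \<Rightarrow> real" where
  "Q z x = exp (- \<beta> * z x) * S z powr (s / \<beta> - 1)"

definition wt :: "((nat \<Rightarrow> real) \<Rightarrow> real) \<Rightarrow> (nat \<Rightarrow> real) \<Rightarrow> real" where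
  "wt z x = exp (- \<beta> * z x) / S z"

text \<open>A smooth substitute for the maximum over \<open>T\<close> of
  \<open>exp (- s * Z \<theta> w x)\<close>. It exceeds that maximum at most by the factor
  \<open>K\<close>, which tends to 1 as \<beta> grows.\<close>

definition Phi :: "real \<Rightarrow> (nat \<times> nat \<Rightarrow> real) \<Rightarrow> real" where
  "Phi \<theta> w = S (Z \<theta> w) powr (s / \<beta>)"

definition W :: "(nat \<times> nat \<Rightarrow> real) \<Rightarrow> real" where
  "W w = (\<Sum>c\<in>IX. \<bar>w c\<bar>)"

definition dQ :: "((nat \<Rightarrow> real) \<Rightarrow> real) \<Rightarrow> ((nat \<Rightarrow> real) \<Rightarrow> real) \<Rightarrow> (nat \<Rightarrow> real) \<Rightarrow> real" where
  "dQ z z' x = \<beta> * Q z x * ((1 - s / \<beta>) * (\<Sum>y\<in>T. wt z y * z' y) - z' x)"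

section \<open>Calculus of the smoothed minimum\<close>

lemma beta_pos: "0 < \<beta>"
  using s_pos s_le by linarith

lemma finite_IX: "finite IX"
  by (simp add: IX_def)

lemma S_pos: "0 < S z"
  unfolding S_def by (intro sum_pos finT T_ne) simp

lemma Q_pos: "0 < Q z x"
  using S_pos [of z] by (simp add: Q_def)

lemma wt_nonneg: "0 \<le> wt z x"
  using S_pos [of z] by (simp add: wt_def)

lemma sum_wt: "(\<Sum>x\<in>T. wt z x) = 1"
  using S_pos [of z] by (simp add: wt_def S_def sum_divide_distrib [symmetric])

lemma abs_sum_wt_le:
  assumes "\<And>x. x \<in> T \<Longrightarrow> \<bar>z' x\<bar> \<le> c"
  shows "\<bar>\<Sum>x\<in>T. wt z x * z' x\<bar> \<le> c"
proof -
  have "\<bar>\<Sum>x\<in>T. wt z x * z' x\<bar> \<le> (\<Sum>x\<in>T. wt z x * c)"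
    using assms wt_nonneg by (intro order_trans [OF sum_abs] sum_mono) (auto simp: abs_mult intro!: mult_left_mono)
  then show ?thesis
    by (simp add: sum_distrib_right [symmetric] sum_wt)
qed

lemma DERIV_S:
  assumes "\<And>x. x \<in> T \<Longrightarrow> ((\<lambda>t. z t x) has_real_derivative z' x) (at t)"
  shows "((\<lambda>t. S (z t)) has_real_derivative - \<beta> * (\<Sum>x\<in>T. exp (- \<beta> * z t x) * z' x)) (at t)"
  unfolding S_def using assms
  by (auto intro!: derivative_eq_intros simp: sum_distrib_left mult_ac)

lemma DERIV_S_powr:
  assumes "\<And>x. x \<in> T \<Longrightarrow> ((\<lambda>t. z t x) has_real_derivative z' x) (at t)"
  shows "((\<lambda>t. S (z t) powr p) has_real_derivative
    - \<beta> * p * S (z t) powr (p - 1) * (\<Sum>x\<in>T. exp (- \<beta> * z t x) * z' x)) (at t)"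
proof -
  have "((\<lambda>t. S (z t) powr p) has_real_derivative
      p * S (z t) powr (p - of_nat 1) * (- \<beta> * (\<Sum>x\<in>T. exp (- \<beta> * z t x) * z' x))) (at t)"
    by (rule DERIV_fun_powr [OF DERIV_S [OF assms] S_pos])
  then show ?thesis
    by (rule DERIV_cong) simp
qed

lemma DERIV_Phi_aux:
  assumes "\<And>x. x \<in> T \<Longrightarrow> ((\<lambda>t. z t x) has_real_derivative z' x) (at t)"
  shows "((\<lambda>t. S (z t) powr (s / \<beta>)) has_real_derivative - s * (\<Sum>x\<in>T. Q (z t) x * z' x)) (at t)"
  by (rule DERIV_cong [OF DERIV_S_powr [OF assms]])
    (use beta_pos in \<open>auto simp: Q_def sum_distrib_left sum_negf [symmetric] mult_ac intro!: sum.cong\<close>)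

lemma DERIV_Q:
  assumes z: "\<And>x. x \<in> T \<Longrightarrow> ((\<lambda>t. z t x) has_real_derivative z' x) (at t)" and x: "x \<in> T"
  shows "((\<lambda>t. Q (z t) x) has_real_derivative dQ (z t) z' x) (at t)"
proof -
  define A where "A = (\<Sum>y\<in>T. exp (- \<beta> * z t y) * z' y)"
  have wt: "(\<Sum>y\<in>T. wt (z t) y * z' y) = A / S (z t)"
    by (simp add: A_def wt_def sum_divide_distrib)
  have pw: "S (z t) powr (s / \<beta> - 1 - 1) = S (z t) powr (s / \<beta> - 1) / S (z t)"
    using S_pos [of "z t"] by (subst powr_diff) simp
  have "((\<lambda>t. Q (z t) x) has_real_derivative
     exp (- \<beta> * z t x) * (- \<beta> * (s / \<beta> - 1) * S (z t) powr (s / \<beta> - 1 - 1) * A)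
     + exp (- \<beta> * z t x) * (- \<beta> * z' x) * S (z t) powr (s / \<beta> - 1)) (at t)"
    unfolding Q_def
  proof (rule DERIV_mult')
    show "((\<lambda>t. exp (- \<beta> * z t x)) has_real_derivative exp (- \<beta> * z t x) * (- \<beta> * z' x)) (at t)"
      by (intro DERIV_fun_exp DERIV_cmult z x)
    show "((\<lambda>t. S (z t) powr (s / \<beta> - 1)) has_real_derivative
        - \<beta> * (s / \<beta> - 1) * S (z t) powr (s / \<beta> - 1 - 1) * A) (at t)"
      unfolding A_def by (rule DERIV_S_powr [OF z])
  qed
  then show ?thesis
    by (rule DERIV_cong) (unfold dQ_def wt pw Q_def, simp add: algebra_simps)
qed

section \<open>Derivatives in the angle and in a single matrix entry\<close>

lemma DERIV_P: "((\<lambda>\<theta>. P \<theta> x j) has_real_derivative P' \<theta> x j) (at \<theta>)"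
  unfolding P_def P'_def by (cases "j < N") (auto intro!: derivative_eq_intros)

lemma DERIV_P': "((\<lambda>\<theta>. P' \<theta> x j) has_real_derivative - P \<theta> x j) (at \<theta>)"
  unfolding P_def P'_def by (cases "j < N") (auto intro!: derivative_eq_intros)

lemma nr_pos: "0 < nr \<theta> w x"
  using delta_pos by (simp add: nr_def add_pos_nonneg sum_nonneg)

lemma nr_square: "(nr \<theta> w x)\<^sup>2 = \<delta> + (\<Sum>i<m. (V \<theta> w x i)\<^sup>2)"
  using delta_pos by (simp add: nr_def add_nonneg_nonneg sum_nonneg)

lemma sqrt_delta_le_nr: "sqrt \<delta> \<le> nr \<theta> w x"
  unfolding nr_def by (simp add: sum_nonneg)

lemma DERIV_nr:
  assumes "\<And>i. i < m \<Longrightarrow> ((\<lambda>t. V (\<theta> t) (w t) x i) has_real_derivative v i) (at t)"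
  shows "((\<lambda>t. nr (\<theta> t) (w t) x) has_real_derivative (\<Sum>i<m. D (\<theta> t) (w t) x i * v i)) (at t)"
proof -
  have "((\<lambda>t. \<delta> + (\<Sum>i<m. (V (\<theta> t) (w t) x i)\<^sup>2)) has_real_derivative (\<Sum>i<m. 2 * V (\<theta> t) (w t) x i * v i)) (at t)"
    using assms by (auto intro!: derivative_eq_intros simp: mult_ac)
  moreover have "0 < \<delta> + (\<Sum>i<m. (V (\<theta> t) (w t) x i)\<^sup>2)"
    using delta_pos by (simp add: add_pos_nonneg sum_nonneg)
  ultimately have "((\<lambda>t. nr (\<theta> t) (w t) x) has_real_derivative
      inverse (nr (\<theta> t) (w t) x) / 2 * (\<Sum>i<m. 2 * V (\<theta> t) (w t) x i * v i)) (at t)"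
    unfolding nr_def by (intro DERIV_chain2 [OF DERIV_real_sqrt])
  moreover have "inverse (nr (\<theta> t) (w t) x) / 2 * (\<Sum>i<m. 2 * V (\<theta> t) (w t) x i * v i)
      = (\<Sum>i<m. D (\<theta> t) (w t) x i * v i)"
    unfolding sum_distrib_left by (intro sum.cong refl) (simp add: D_def field_simps)
  ultimately show ?thesis
    by (simp only:)
qed

lemma DERIV_V_angle: "((\<lambda>\<theta>. V \<theta> w x i) has_real_derivative (\<Sum>j<Suc N. w (i, j) * P' \<theta> x j)) (at \<theta>)"
  unfolding V_def by (intro DERIV_sum DERIV_cmult DERIV_P)

lemma DERIV_U_angle: "((\<lambda>\<theta>. U \<theta> w x) has_real_derivative - (\<Sum>j<Suc N. w (m, j) * P \<theta> x j)) (at \<theta>)"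
  unfolding U_def sum_negf [symmetric] mult_minus_right [symmetric]
  by (intro DERIV_sum DERIV_cmult DERIV_P')

definition dZ :: "real \<Rightarrow> (nat \<times> nat \<Rightarrow> real) \<Rightarrow> (nat \<Rightarrow> real) \<Rightarrow> real" where
  "dZ \<theta> w x = (\<Sum>i<m. D \<theta> w x i * (\<Sum>j<Suc N. w (i, j) * P' \<theta> x j)) + (\<Sum>j<Suc N. w (m, j) * P \<theta> x j)"

lemma DERIV_Z_angle: "((\<lambda>\<theta>. Z \<theta> w x) has_real_derivative dZ \<theta> w x) (at \<theta>)"
  unfolding Z_def
  by (rule DERIV_cong [OF DERIV_diff [OF DERIV_nr [OF DERIV_V_angle] DERIV_U_angle]]) (simp add: dZ_def)

lemma DERIV_Phi: "((\<lambda>\<theta>. Phi \<theta> w) has_real_derivative - s * (\<Sum>x\<in>T. Q (Z \<theta> w) x * dZ \<theta> w x)) (at \<theta>)"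
  unfolding Phi_def by (rule DERIV_Phi_aux [OF DERIV_Z_angle])

lemma DERIV_coord: "((\<lambda>t. (w(c := t)) c') has_real_derivative (if c' = c then 1 else 0)) (at t)"
  by auto

lemma DERIV_V_coord:
  assumes "j < Suc N"
  shows "((\<lambda>t. V \<theta> (w((i, j) := t)) x k) has_real_derivative (if k = i then P \<theta> x j else 0)) (at t)"
proof -
  have "((\<lambda>t. V \<theta> (w((i, j) := t)) x k) has_real_derivative
      (\<Sum>l<Suc N. (if (k, l) = (i, j) then 1 else 0) * P \<theta> x l)) (at t)"
    unfolding V_def by (intro DERIV_sum DERIV_cmult_right DERIV_coord)
  then show ?thesis
    by (rule DERIV_cong) (use assms in \<open>auto simp: if_distrib [of "\<lambda>u. u * _"] sum.delta cong: if_cong\<close>)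
qed

lemma DERIV_U_coord:
  assumes "j < Suc N"
  shows "((\<lambda>t. U \<theta> (w((i, j) := t)) x) has_real_derivative (if m = i then P' \<theta> x j else 0)) (at t)"
proof -
  have "((\<lambda>t. U \<theta> (w((i, j) := t)) x) has_real_derivative
      (\<Sum>l<Suc N. (if (m, l) = (i, j) then 1 else 0) * P' \<theta> x l)) (at t)"
    unfolding U_def by (intro DERIV_sum DERIV_cmult_right DERIV_coord)
  then show ?thesis
    by (rule DERIV_cong) (use assms in \<open>auto simp: if_distrib [of "\<lambda>u. u * _"] sum.delta cong: if_cong\<close>)
qed

lemma DERIV_nr_coord:
  assumes "i < m" "j < Suc N"
  shows "((\<lambda>t. nr \<theta> (w((i, j) := t)) x) has_real_derivative D \<theta> (w((i, j) := t)) x i * P \<theta> x j) (at t)"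
  by (rule DERIV_cong [OF DERIV_nr [where \<theta> = "\<lambda>_. \<theta>", OF DERIV_V_coord [OF assms(2)]]])
    (use assms in \<open>simp add: if_distrib [of "\<lambda>u. _ * u"] sum.delta cong: if_cong\<close>)

lemma DERIV_Z_coord:
  assumes "i < m" "j < Suc N"
  shows "((\<lambda>t. Z \<theta> (w((i, j) := t)) x) has_real_derivative D \<theta> (w((i, j) := t)) x i * P \<theta> x j) (at t)"
  unfolding Z_def
  by (rule DERIV_cong [OF DERIV_diff [OF DERIV_nr_coord [OF assms] DERIV_U_coord [OF assms(2)]]])
    (use assms in simp)

lemma DERIV_Z_coord_last:
  assumes "j < Suc N"
  shows "((\<lambda>t. Z \<theta> (w((m, j) := t)) x) has_real_derivative - P' \<theta> x j) (at t)"
proof -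
  have "((\<lambda>t. nr \<theta> (w((m, j) := t)) x) has_real_derivative
      (\<Sum>k<m. D \<theta> (w((m, j) := t)) x k * (if k = m then P \<theta> x j else 0))) (at t)"
    by (rule DERIV_nr [where \<theta> = "\<lambda>_. \<theta>", OF DERIV_V_coord [OF assms]])
  from DERIV_diff [OF this DERIV_U_coord [OF assms, of \<theta> w m x]] show ?thesis
    unfolding Z_def by (rule DERIV_cong) simp
qed

text \<open>Diagonal of the Hessian of the smoothed norm \<open>nr\<close> in the variables
  \<open>V\<close>, whose gradient is \<open>D\<close>. Integration by parts in row \<open>i\<close>
  meets only \<open>D\<close> with the same index, so no off-diagonal entry occurs.\<close>

definition H :: "real \<Rightarrow> (nat \<times> nat \<Rightarrow> real) \<Rightarrow> (nat \<Rightarrow> real) \<Rightarrow> nat \<Rightarrow> real" where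
  "H \<theta> w x i = (1 - (D \<theta> w x i)\<^sup>2) / nr \<theta> w x"

lemma DERIV_D_coord:
  assumes "i < m" "j < Suc N"
  shows "((\<lambda>t. D \<theta> (w((i, j) := t)) x i) has_real_derivative P \<theta> x j * H \<theta> (w((i, j) := t)) x i) (at t)"
proof -
  let ?w = "w((i, j) := t)"
  have nz: "nr \<theta> ?w x \<noteq> 0"
    using nr_pos [of \<theta> ?w x] by simp
  have V: "((\<lambda>t. V \<theta> (w((i, j) := t)) x i) has_real_derivative P \<theta> x j) (at t)"
    using DERIV_V_coord [OF assms(2), of \<theta> w i x i] by simp
  have "((\<lambda>t. D \<theta> (w((i, j) := t)) x i) has_real_derivative
      (P \<theta> x j * nr \<theta> ?w x - V \<theta> ?w x i * (D \<theta> ?w x i * P \<theta> x j)) / (nr \<theta> ?w x * nr \<theta> ?w x)) (at t)"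
    using DERIV_divide [OF V DERIV_nr_coord [OF assms(1,2)] nz] by (simp only: D_def)
  then show ?thesis
    by (rule DERIV_cong) (use nz in \<open>simp add: H_def D_def field_simps power2_eq_square\<close>)
qed

definition dF :: "real \<Rightarrow> (nat \<times> nat \<Rightarrow> real) \<Rightarrow> (nat \<Rightarrow> real) \<Rightarrow> nat \<Rightarrow> nat \<Rightarrow> real" where
  "dF \<theta> w x i j = dQ (Z \<theta> w) (\<lambda>y. D \<theta> w y i * P \<theta> y j) x * D \<theta> w x i + P \<theta> x j * H \<theta> w x i * Q (Z \<theta> w) x"

lemma DERIV_F_coord:
  assumes "i < m" "j < Suc N" "x \<in> T"
  shows "((\<lambda>t. Q (Z \<theta> (w((i, j) := t))) x * D \<theta> (w((i, j) := t)) x i) has_real_derivative dF \<theta> (w((i, j) := t)) x i j) (at t)"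
  unfolding dF_def
  by (rule DERIV_mult [OF DERIV_Q [OF DERIV_Z_coord [OF assms(1,2)] assms(3)] DERIV_D_coord [OF assms(1,2)]])

lemma DERIV_F_coord_last:
  assumes "j < Suc N" "x \<in> T"
  shows "((\<lambda>t. Q (Z \<theta> (w((m, j) := t))) x) has_real_derivative dQ (Z \<theta> (w((m, j) := t))) (\<lambda>y. - P' \<theta> y j) x) (at t)"
  by (rule DERIV_Q [OF DERIV_Z_coord_last [OF assms(1)] assms(2)])

text \<open>The covariances between velocity at \<open>x\<close> and position at \<open>y\<close>.
  For unit \<open>x\<close> the one at \<open>y = x\<close> is 0, which expresses equal variances
  along the path; for angles in the first quadrant the others are never positive, because inner
  products of unit vectors are at most 1.\<close>

lemma inner_P'_P:
  "(\<Sum>j<Suc N. P' \<theta> x j * P \<theta> y j) = - (sin \<theta> * cos \<theta> * (1 - (\<Sum>j<N. x j * y j)))"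
proof -
  have "(\<Sum>j<N. P' \<theta> x j * P \<theta> y j) = sin \<theta> * cos \<theta> * (\<Sum>j<N. x j * y j)"
    unfolding sum_distrib_left by (intro sum.cong) (auto simp: P_def P'_def)
  then show ?thesis
    by (simp add: P_def P'_def algebra_simps)
qed

section \<open>Sign of the drift\<close>

lemma inner_le_1:
  assumes "x \<in> T" "y \<in> T"
  shows "(\<Sum>j<N. x j * y j) \<le> 1"
proof -
  have "(\<Sum>j<N. x j * y j) \<le> (\<Sum>j<N. ((x j)\<^sup>2 + (y j)\<^sup>2) / 2)"
  proof (intro sum_mono)
    fix j show "x j * y j \<le> ((x j)\<^sup>2 + (y j)\<^sup>2) / 2"
      using zero_le_power2 [of "x j - y j"] by (simp add: power2_eq_square algebra_simps)
  qed
  also have "\<dots> = 1"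
    by (simp add: sum_divide_distrib [symmetric] sum.distrib unit assms)
  finally show ?thesis .
qed

lemma sum_D_square_le_1: "(\<Sum>i<m. (D \<theta> w x i)\<^sup>2) \<le> 1"
proof -
  have "(\<Sum>i<m. (D \<theta> w x i)\<^sup>2) = (\<Sum>i<m. (V \<theta> w x i)\<^sup>2) / (nr \<theta> w x)\<^sup>2"
    by (simp add: D_def power_divide sum_divide_distrib)
  also have "\<dots> \<le> 1"
    using delta_pos by (simp add: nr_square divide_le_eq add_pos_nonneg sum_nonneg)
  finally show ?thesis .
qed

lemma sum_D_D_le_1: "(\<Sum>i<m. D \<theta> w x i * D \<theta> w y i) \<le> 1"
proof -
  have "(\<Sum>i<m. D \<theta> w x i * D \<theta> w y i) \<le> (\<Sum>i<m. ((D \<theta> w x i)\<^sup>2 + (D \<theta> w y i)\<^sup>2) / 2)"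
  proof (intro sum_mono)
    fix i show "D \<theta> w x i * D \<theta> w y i \<le> ((D \<theta> w x i)\<^sup>2 + (D \<theta> w y i)\<^sup>2) / 2"
      using zero_le_power2 [of "D \<theta> w x i - D \<theta> w y i"] by (simp add: power2_eq_square algebra_simps)
  qed
  also have "\<dots> \<le> 1"
    using sum_D_square_le_1 [of \<theta> w x] sum_D_square_le_1 [of \<theta> w y]
    by (simp add: sum_divide_distrib [symmetric] sum.distrib)
  finally show ?thesis .
qed

lemma abs_D_le_1: "i < m \<Longrightarrow> \<bar>D \<theta> w x i\<bar> \<le> 1"
  using member_le_sum [of i "{..<m}" "\<lambda>i. (D \<theta> w x i)\<^sup>2"] sum_D_square_le_1 [of \<theta> w x]
  by (simp add: abs_square_le_1 [symmetric])

lemma abs_coord_le_1: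
  assumes "x \<in> T" "j < N"
  shows "\<bar>x j\<bar> \<le> 1"
  using member_le_sum [of j "{..<N}" "\<lambda>j. (x j)\<^sup>2"] unit [OF assms(1)] assms(2)
  by (simp add: abs_square_le_1 [symmetric])

lemma abs_P_le_1: "x \<in> T \<Longrightarrow> \<bar>P \<theta> x j\<bar> \<le> 1"
  using abs_coord_le_1 [of x j] mult_mono [of "\<bar>sin \<theta>\<bar>" 1 "\<bar>x j\<bar>" 1]
  by (auto simp: P_def abs_mult)

lemma abs_P'_le_1: "x \<in> T \<Longrightarrow> \<bar>P' \<theta> x j\<bar> \<le> 1"
  using abs_coord_le_1 [of x j] mult_mono [of "\<bar>cos \<theta>\<bar>" 1 "\<bar>x j\<bar>" 1]
  by (auto simp: P'_def abs_mult)

text \<open>Linearity of \<open>dQ\<close> in the direction. It moves the sums over rows and columns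
  inside, onto the inner products controlled by \<open>inner_P'_P\<close> and
  \<open>sum_D_D_le_1\<close>.\<close>

lemma sum_dQ:
  "(\<Sum>k\<in>A. a k * dQ z (\<lambda>y. b y k) x) = dQ z (\<lambda>y. \<Sum>k\<in>A. a k * b y k) x"
proof -
  have "(\<Sum>k\<in>A. a k * (\<Sum>y\<in>T. wt z y * b y k)) = (\<Sum>y\<in>T. wt z y * (\<Sum>k\<in>A. a k * b y k))"
    unfolding sum_distrib_left by (subst sum.swap) (simp add: mult_ac)
  then show ?thesis
    unfolding dQ_def
    by (simp add: sum_distrib_left [symmetric] right_diff_distrib sum_subtractf mult.left_commute [of "a _"])
qed

text \<open>The sign in Gordon's comparison: both inner products are at most one, so all cross terms push in the same direction.\<close>

lemma drift_nonneg:
  assumes x: "x \<in> T" and \<theta>: "0 \<le> \<theta>" "\<theta> \<le> pi / 2"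
  shows "0 \<le> (\<Sum>i<m. \<Sum>j<Suc N. P' \<theta> x j * dF \<theta> w x i j)
    + (\<Sum>j<Suc N. P \<theta> x j * dQ (Z \<theta> w) (\<lambda>y. - P' \<theta> y j) x)"
proof -
  define \<kappa> where "\<kappa> y = sin \<theta> * cos \<theta> * (1 - (\<Sum>j<N. x j * y j))" for y
  have sc: "0 \<le> sin \<theta> * cos \<theta>"
    using \<theta> by (intro mult_nonneg_nonneg sin_ge_zero cos_ge_zero) auto
  have \<kappa>: "0 \<le> \<kappa> y" if "y \<in> T" for y
    unfolding \<kappa>_def using inner_le_1 [OF x that] by (intro mult_nonneg_nonneg sc) simp
  have \<kappa>x: "\<kappa> x = 0"
    using unit [OF x] by (simp add: \<kappa>_def power2_eq_square)
  have PP: "(\<Sum>j<Suc N. P' \<theta> x j * P \<theta> y j) = - \<kappa> y" for y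
    unfolding \<kappa>_def by (rule inner_P'_P)
  have PP': "(\<Sum>j<Suc N. P \<theta> x j * - P' \<theta> y j) = \<kappa> y" for y
    using inner_P'_P [of \<theta> y x] unfolding \<kappa>_def mult_minus_right sum_negf
    by (simp only: mult.commute [of "P \<theta> x _"] mult.commute [of "x _"] minus_minus)
  have 1: "(\<Sum>j<Suc N. P' \<theta> x j * dF \<theta> w x i j) = dQ (Z \<theta> w) (\<lambda>y. D \<theta> w y i * - \<kappa> y) x * D \<theta> w x i" for i
  proof -
    have "(\<Sum>j<Suc N. P' \<theta> x j * dF \<theta> w x i j)
        = (\<Sum>j<Suc N. P' \<theta> x j * dQ (Z \<theta> w) (\<lambda>y. D \<theta> w y i * P \<theta> y j) x) * D \<theta> w x i
        + (\<Sum>j<Suc N. P' \<theta> x j * P \<theta> x j) * (H \<theta> w x i * Q (Z \<theta> w) x)"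
      unfolding dF_def distrib_left sum.distrib sum_distrib_right by (simp only: mult_ac)
    \<comment> \<open>The velocity of a unit vector is orthogonal to its position, so the
      second-order term with \<open>H\<close> drops out.\<close>
    also have "(\<Sum>j<Suc N. P' \<theta> x j * P \<theta> x j) = 0"
      using PP [of x] \<kappa>x by simp
    also have "(\<Sum>j<Suc N. P' \<theta> x j * dQ (Z \<theta> w) (\<lambda>y. D \<theta> w y i * P \<theta> y j) x)
        = dQ (Z \<theta> w) (\<lambda>y. \<Sum>j<Suc N. P' \<theta> x j * (D \<theta> w y i * P \<theta> y j)) x"
      by (rule sum_dQ)
    also have "(\<lambda>y. \<Sum>j<Suc N. P' \<theta> x j * (D \<theta> w y i * P \<theta> y j)) = (\<lambda>y. D \<theta> w y i * - \<kappa> y)"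
      unfolding PP [symmetric] sum_distrib_left by (simp only: mult.left_commute)
    finally show ?thesis by simp
  qed
  have 2: "(\<Sum>j<Suc N. P \<theta> x j * dQ (Z \<theta> w) (\<lambda>y. - P' \<theta> y j) x) = dQ (Z \<theta> w) \<kappa> x"
    unfolding sum_dQ PP' ..
  have 3: "(\<Sum>i<m. dQ (Z \<theta> w) (\<lambda>y. D \<theta> w y i * - \<kappa> y) x * D \<theta> w x i)
      = dQ (Z \<theta> w) (\<lambda>y. - (\<kappa> y * (\<Sum>i<m. D \<theta> w x i * D \<theta> w y i))) x"
  proof -
    have "(\<Sum>i<m. D \<theta> w x i * (D \<theta> w y i * - \<kappa> y)) = - (\<kappa> y * (\<Sum>i<m. D \<theta> w x i * D \<theta> w y i))" for y
      unfolding sum_distrib_left sum_negf [symmetric] by (intro sum.cong refl) simp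
    then show ?thesis
      using sum_dQ [of "\<lambda>i. D \<theta> w x i" "Z \<theta> w" "\<lambda>y i. D \<theta> w y i * - \<kappa> y" x "{..<m}"]
      by (simp only: mult.commute [of "dQ _ _ _"])
  qed
  \<comment> \<open>As \<open>\<kappa> x = 0\<close>, only the Gibbs average in \<open>dQ\<close>
    remains. The parts from the first \<open>m\<close> rows and from row \<open>m\<close> merge into
    \<open>\<kappa> y\<close> times 1 minus the inner product of \<open>D\<close> at
    \<open>x\<close> and at \<open>y\<close>, and both factors are nonnegative.\<close>
  have "dQ (Z \<theta> w) (\<lambda>y. - (\<kappa> y * (\<Sum>i<m. D \<theta> w x i * D \<theta> w y i))) x + dQ (Z \<theta> w) \<kappa> x
      = \<beta> * Q (Z \<theta> w) x * ((1 - s / \<beta>) *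
        (\<Sum>y\<in>T. wt (Z \<theta> w) y * (\<kappa> y * (1 - (\<Sum>i<m. D \<theta> w x i * D \<theta> w y i)))))"
  proof -
    have "(\<Sum>y\<in>T. wt (Z \<theta> w) y * (\<kappa> y * (1 - (\<Sum>i<m. D \<theta> w x i * D \<theta> w y i))))
        = (\<Sum>y\<in>T. wt (Z \<theta> w) y * - (\<kappa> y * (\<Sum>i<m. D \<theta> w x i * D \<theta> w y i)))
          + (\<Sum>y\<in>T. wt (Z \<theta> w) y * \<kappa> y)"
      unfolding sum.distrib [symmetric] by (intro sum.cong refl) (simp add: right_diff_distrib)
    then show ?thesis
      unfolding dQ_def \<kappa>x by (simp only: distrib_left mult_zero_left minus_zero diff_zero)
  qed
  also have "\<dots> \<ge> 0"
    using beta_pos s_le Q_pos [of "Z \<theta> w" x] sum_D_D_le_1 [of \<theta> w x]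
    by (intro mult_nonneg_nonneg sum_nonneg wt_nonneg \<kappa>) auto
  finally show ?thesis
    unfolding 1 2 3 .
qed

section \<open>Growth bounds, uniform in the angle\<close>

lemma W_split: "W w = (\<Sum>i<m. \<Sum>j<Suc N. \<bar>w (i, j)\<bar>) + (\<Sum>j<Suc N. \<bar>w (m, j)\<bar>)"
  unfolding W_def IX_def sum.cartesian_product [symmetric, where g = "\<lambda>i j. \<bar>w (i, j)\<bar>", simplified] by simp

lemma abs_row_le:
  fixes w :: "nat \<times> nat \<Rightarrow> real"
  assumes "\<And>j. j < Suc N \<Longrightarrow> \<bar>p j\<bar> \<le> 1"
  shows "\<bar>\<Sum>j<Suc N. w (i, j) * p j\<bar> \<le> (\<Sum>j<Suc N. \<bar>w (i, j)\<bar>)"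
proof (rule order_trans [OF sum_abs], rule sum_mono)
  fix j assume "j \<in> {..<Suc N}"
  then show "\<bar>w (i, j) * p j\<bar> \<le> \<bar>w (i, j)\<bar>"
    using mult_left_mono [OF assms, of j "\<bar>w (i, j)\<bar>"] by (simp add: abs_mult)
qed

lemma abs_U_le: "x \<in> T \<Longrightarrow> \<bar>U \<theta> w x\<bar> \<le> W w"
  unfolding U_def
  by (rule order_trans [OF abs_row_le]) (auto simp: abs_P'_le_1 W_split sum_nonneg simp del: sum.lessThan_Suc)

lemma abs_dZ_le:
  assumes x: "x \<in> T"
  shows "\<bar>dZ \<theta> w x\<bar> \<le> W w"
proof -
  have "\<bar>D \<theta> w x i * (\<Sum>j<Suc N. w (i, j) * P' \<theta> x j)\<bar> \<le> 1 * (\<Sum>j<Suc N. \<bar>w (i, j)\<bar>)" if "i < m" for i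
    unfolding abs_mult using that x by (intro mult_mono abs_row_le abs_P'_le_1 abs_D_le_1) auto
  then have "(\<Sum>i<m. \<bar>D \<theta> w x i * (\<Sum>j<Suc N. w (i, j) * P' \<theta> x j)\<bar>) \<le> (\<Sum>i<m. \<Sum>j<Suc N. \<bar>w (i, j)\<bar>)"
    by (intro sum_mono) simp
  then have "\<bar>\<Sum>i<m. D \<theta> w x i * (\<Sum>j<Suc N. w (i, j) * P' \<theta> x j)\<bar> \<le> (\<Sum>i<m. \<Sum>j<Suc N. \<bar>w (i, j)\<bar>)"
    by (rule order_trans [OF sum_abs])
  moreover have "\<bar>\<Sum>j<Suc N. w (m, j) * P \<theta> x j\<bar> \<le> (\<Sum>j<Suc N. \<bar>w (m, j)\<bar>)"
    using x by (intro abs_row_le abs_P_le_1)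
  ultimately show ?thesis
    unfolding dZ_def W_split by linarith
qed

definition K :: real where
  "K = real (card T) powr (s / \<beta>)"

lemma K_pos: "0 < K"
  using finT T_ne by (simp add: K_def card_gt_0_iff)

text \<open>The upper half of the sandwich around the maximum: the number of points costs the factor
  \<open>K\<close>. The lower half \<open>S_powr_ge\<close> costs nothing, since one summand is
  enough.\<close>

lemma S_powr_le:
  assumes "\<And>x. x \<in> T \<Longrightarrow> - z x \<le> b"
  shows "S z powr (s / \<beta>) \<le> K * exp (s * b)"
proof -
  have "S z \<le> (\<Sum>x\<in>T. exp (\<beta> * b))"
    unfolding S_def
  proof (rule sum_mono)
    fix x assume "x \<in> T"
    from mult_left_mono [OF assms [OF this], of \<beta>] show "exp (- \<beta> * z x) \<le> exp (\<beta> * b)"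
      using beta_pos by simp
  qed
  then have "S z powr (s / \<beta>) \<le> (real (card T) * exp (\<beta> * b)) powr (s / \<beta>)"
    using S_pos [of z] beta_pos s_pos by (intro powr_mono2) auto
  also have "\<dots> = K * exp (s * b)"
    using beta_pos by (simp add: powr_mult K_def exp_powr_real)
  finally show ?thesis .
qed

lemma S_powr_ge:
  assumes "x \<in> T"
  shows "exp (- s * z x) \<le> S z powr (s / \<beta>)"
proof -
  have "exp (- s * z x) = exp (- \<beta> * z x) powr (s / \<beta>)"
    using beta_pos by (simp add: exp_powr_real)
  also have "\<dots> \<le> S z powr (s / \<beta>)"
    unfolding S_def using assms finT beta_pos s_pos
    by (intro powr_mono2 member_le_sum) auto
  finally show ?thesis .
qed

lemma Phi_le: "Phi \<theta> w \<le> K * exp (s * W w)"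
  unfolding Phi_def
proof (rule S_powr_le)
  fix x assume "x \<in> T"
  then show "- Z \<theta> w x \<le> W w"
    using abs_U_le [of x \<theta> w] nr_pos [of \<theta> w x] by (simp add: Z_def)
qed

lemma Q_le:
  assumes "x \<in> T"
  shows "Q (Z \<theta> w) x \<le> K * exp (s * W w)"
proof -
  have "Q (Z \<theta> w) x \<le> S (Z \<theta> w) * S (Z \<theta> w) powr (s / \<beta> - 1)"
    unfolding Q_def using assms finT
    by (intro mult_right_mono) (auto simp: S_def [of "Z \<theta> w"] intro!: member_le_sum [of x T "\<lambda>x. exp (- \<beta> * Z \<theta> w x)", simplified])
  also have "\<dots> = Phi \<theta> w"
    using S_pos [of "Z \<theta> w"] powr_add [of "S (Z \<theta> w)" 1 "s / \<beta> - 1"] by (simp add: Phi_def)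
  also have "\<dots> \<le> K * exp (s * W w)"
    by (rule Phi_le)
  finally show ?thesis .
qed

lemma abs_dQ_le:
  assumes "\<And>y. y \<in> T \<Longrightarrow> \<bar>z' y\<bar> \<le> 1" "x \<in> T"
  shows "\<bar>dQ z z' x\<bar> \<le> 2 * \<beta> * Q z x"
proof -
  have "\<bar>(1 - s / \<beta>) * (\<Sum>y\<in>T. wt z y * z' y)\<bar> \<le> 1 * 1"
    unfolding abs_mult using s_pos s_le beta_pos assms
    by (intro mult_mono abs_sum_wt_le) auto
  then have "\<bar>(1 - s / \<beta>) * (\<Sum>y\<in>T. wt z y * z' y) - z' x\<bar> \<le> 2"
    using assms(1) [OF assms(2)] by linarith
  then have "\<beta> * Q z x * \<bar>(1 - s / \<beta>) * (\<Sum>y\<in>T. wt z y * z' y) - z' x\<bar> \<le> \<beta> * Q z x * 2"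
    using Q_pos [of z x] beta_pos by (intro mult_left_mono) auto
  moreover have "\<bar>\<beta> * Q z x\<bar> = \<beta> * Q z x"
    using Q_pos [of z x] beta_pos by simp
  ultimately show ?thesis
    unfolding dQ_def abs_mult [of "\<beta> * Q z x"] by (simp only: mult_ac)
qed

lemma abs_H_le:
  assumes "i < m"
  shows "\<bar>H \<theta> w x i\<bar> \<le> 1 / sqrt \<delta>"
proof -
  have "(D \<theta> w x i)\<^sup>2 \<le> 1"
    using abs_D_le_1 [OF assms, of \<theta> w x] by (simp add: abs_square_le_1)
  then have "\<bar>H \<theta> w x i\<bar> \<le> 1 / nr \<theta> w x"
    using nr_pos [of \<theta> w x] by (simp add: H_def divide_le_cancel)
  also have "\<dots> \<le> 1 / sqrt \<delta>"
    using sqrt_delta_le_nr [of \<theta> w x] delta_pos by (simp add: frac_le)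
  finally show ?thesis .
qed

definition C :: real where
  "C = (2 * \<beta> + 1 / sqrt \<delta> + 1) * K"

text \<open>One constant for both kinds of integrand in the integrations by parts and for their
  derivatives: \<open>2 * \<beta>\<close> comes from \<open>dQ\<close>,
  \<open>1 / sqrt \<delta>\<close> from \<open>H\<close>, and 1 from \<open>Q\<close>.\<close>

lemma C_bound:
  assumes x: "x \<in> T" and a: "\<bar>a\<bar> \<le> (2 * \<beta> + 1 / sqrt \<delta> + 1) * Q (Z \<theta> w) x"
  shows "\<bar>a\<bar> \<le> C * exp (s * (\<Sum>c\<in>IX. \<bar>w c\<bar>))"
proof -
  have "(2 * \<beta> + 1 / sqrt \<delta> + 1) * Q (Z \<theta> w) x \<le> (2 * \<beta> + 1 / sqrt \<delta> + 1) * (K * exp (s * W w))"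
    using beta_pos delta_pos by (intro mult_left_mono Q_le x) simp
  with a show ?thesis
    by (simp add: C_def W_def)
qed

lemma abs_QD_le: "x \<in> T \<Longrightarrow> i < m \<Longrightarrow> \<bar>Q (Z \<theta> w) x * D \<theta> w x i\<bar> \<le> C * exp (s * (\<Sum>c\<in>IX. \<bar>w c\<bar>))"
proof (rule C_bound)
  assume "i < m"
  then have "\<bar>Q (Z \<theta> w) x * D \<theta> w x i\<bar> \<le> Q (Z \<theta> w) x"
    using mult_left_mono [OF abs_D_le_1 [of i \<theta> w x], of "Q (Z \<theta> w) x"] Q_pos [of "Z \<theta> w" x] by (simp add: abs_mult)
  also have "\<dots> \<le> (2 * \<beta> + 1 / sqrt \<delta> + 1) * Q (Z \<theta> w) x"
    using mult_right_mono [of 1 "2 * \<beta> + 1 / sqrt \<delta> + 1" "Q (Z \<theta> w) x"] beta_pos delta_pos Q_pos [of "Z \<theta> w" x] by simp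
  finally show "\<bar>Q (Z \<theta> w) x * D \<theta> w x i\<bar> \<le> (2 * \<beta> + 1 / sqrt \<delta> + 1) * Q (Z \<theta> w) x" .
qed

lemma abs_Q_le: "x \<in> T \<Longrightarrow> \<bar>Q (Z \<theta> w) x\<bar> \<le> C * exp (s * (\<Sum>c\<in>IX. \<bar>w c\<bar>))"
  by (rule C_bound [where \<theta> = \<theta>])
    (use mult_right_mono [of 1 "2 * \<beta> + 1 / sqrt \<delta> + 1" "Q (Z \<theta> w) x"] beta_pos delta_pos Q_pos [of "Z \<theta> w" x] in auto)

lemma abs_dQ_last_le:
  assumes x: "x \<in> T"
  shows "\<bar>dQ (Z \<theta> w) (\<lambda>y. - P' \<theta> y j) x\<bar> \<le> C * exp (s * (\<Sum>c\<in>IX. \<bar>w c\<bar>))"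
proof (rule C_bound [OF x])
  have "\<bar>dQ (Z \<theta> w) (\<lambda>y. - P' \<theta> y j) x\<bar> \<le> 2 * \<beta> * Q (Z \<theta> w) x"
    using abs_P'_le_1 x by (intro abs_dQ_le) auto
  also have "\<dots> \<le> (2 * \<beta> + 1 / sqrt \<delta> + 1) * Q (Z \<theta> w) x"
    using Q_pos [of "Z \<theta> w" x] delta_pos by (intro mult_right_mono) auto
  finally show "\<bar>dQ (Z \<theta> w) (\<lambda>y. - P' \<theta> y j) x\<bar> \<le> (2 * \<beta> + 1 / sqrt \<delta> + 1) * Q (Z \<theta> w) x" .
qed

lemma abs_dF_le:
  assumes x: "x \<in> T" and i: "i < m"
  shows "\<bar>dF \<theta> w x i j\<bar> \<le> C * exp (s * (\<Sum>c\<in>IX. \<bar>w c\<bar>))"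
proof (rule C_bound [OF x])
  have Q: "0 < Q (Z \<theta> w) x"
    by (rule Q_pos)
  have "\<bar>D \<theta> w y i * P \<theta> y j\<bar> \<le> 1" if "y \<in> T" for y
  proof -
    have "\<bar>D \<theta> w y i\<bar> * \<bar>P \<theta> y j\<bar> \<le> 1 * 1"
      by (intro mult_mono abs_D_le_1 abs_P_le_1 i that) auto
    then show ?thesis
      by (simp add: abs_mult)
  qed
  then have "\<bar>dQ (Z \<theta> w) (\<lambda>y. D \<theta> w y i * P \<theta> y j) x\<bar> \<le> 2 * \<beta> * Q (Z \<theta> w) x"
    using x by (intro abs_dQ_le)
  then have 1: "\<bar>dQ (Z \<theta> w) (\<lambda>y. D \<theta> w y i * P \<theta> y j) x * D \<theta> w x i\<bar> \<le> 2 * \<beta> * Q (Z \<theta> w) x * 1"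
    unfolding abs_mult using i Q beta_pos by (intro mult_mono abs_D_le_1) auto
  have "\<bar>P \<theta> x j * H \<theta> w x i\<bar> \<le> 1 * (1 / sqrt \<delta>)"
    unfolding abs_mult using i x delta_pos by (intro mult_mono abs_P_le_1 abs_H_le) auto
  then have 2: "\<bar>P \<theta> x j * H \<theta> w x i * Q (Z \<theta> w) x\<bar> \<le> 1 / sqrt \<delta> * Q (Z \<theta> w) x"
    unfolding abs_mult [of _ "Q _ _"] using Q delta_pos by (intro mult_mono) auto
  show "\<bar>dF \<theta> w x i j\<bar> \<le> (2 * \<beta> + 1 / sqrt \<delta> + 1) * Q (Z \<theta> w) x"
    unfolding dF_def distrib_right
    by (rule order_trans [OF abs_triangle_ineq]) (use 1 2 Q in linarith)
qed

section \<open>Measurability of the interpolation quantities\<close>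

lemma measurable_V: "i < Suc m \<Longrightarrow> (\<lambda>w. V \<theta> w x i) \<in> borel_measurable (gauss_PiM IX)"
  unfolding V_def
  by (intro borel_measurable_sum borel_measurable_times borel_measurable_const measurable_gauss_component)
    (auto simp: IX_def)

lemma measurable_U: "(\<lambda>w. U \<theta> w x) \<in> borel_measurable (gauss_PiM IX)"
  unfolding U_def
  by (intro borel_measurable_sum borel_measurable_times borel_measurable_const measurable_gauss_component)
    (auto simp: IX_def)

lemma measurable_nr: "(\<lambda>w. nr \<theta> w x) \<in> borel_measurable (gauss_PiM IX)"
proof -
  have "(\<lambda>w. \<Sum>i<m. (V \<theta> w x i)\<^sup>2) \<in> borel_measurable (gauss_PiM IX)"
    by (intro borel_measurable_sum borel_measurable_power measurable_V) simp
  then show ?thesis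
    unfolding nr_def by (intro measurable_compose [OF _ borel_measurable_sqrt] borel_measurable_add borel_measurable_const)
qed

lemma measurable_Z: "(\<lambda>w. Z \<theta> w x) \<in> borel_measurable (gauss_PiM IX)"
  unfolding Z_def by (intro borel_measurable_diff measurable_nr measurable_U)

lemma measurable_D: "i < Suc m \<Longrightarrow> (\<lambda>w. D \<theta> w x i) \<in> borel_measurable (gauss_PiM IX)"
  unfolding D_def by (intro borel_measurable_divide measurable_nr measurable_V)

lemma measurable_S: "(\<lambda>w. S (Z \<theta> w)) \<in> borel_measurable (gauss_PiM IX)"
  unfolding S_def
  by (intro borel_measurable_sum measurable_compose [OF _ borel_measurable_exp] borel_measurable_times borel_measurable_const measurable_Z)

lemma measurable_Q: "(\<lambda>w. Q (Z \<theta> w) x) \<in> borel_measurable (gauss_PiM IX)"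
  unfolding Q_def
  by (intro borel_measurable_times measurable_compose [OF _ borel_measurable_exp] powr_real_measurable borel_measurable_const measurable_Z measurable_S)

lemma measurable_wt: "(\<lambda>w. wt (Z \<theta> w) x) \<in> borel_measurable (gauss_PiM IX)"
  unfolding wt_def
  by (intro borel_measurable_divide borel_measurable_times measurable_compose [OF _ borel_measurable_exp] borel_measurable_const measurable_Z measurable_S)

lemma measurable_Phi: "Phi \<theta> \<in> borel_measurable (gauss_PiM IX)"
  unfolding Phi_def [abs_def] by (intro powr_real_measurable borel_measurable_const measurable_S)

lemma measurable_dQ:
  assumes "\<And>y. (\<lambda>w. z' w y) \<in> borel_measurable (gauss_PiM IX)"
  shows "(\<lambda>w. dQ (Z \<theta> w) (z' w) x) \<in> borel_measurable (gauss_PiM IX)"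
  unfolding dQ_def
  by (intro borel_measurable_times borel_measurable_diff borel_measurable_sum borel_measurable_const
      measurable_Q measurable_wt assms)

lemma measurable_dF: "i < m \<Longrightarrow> (\<lambda>w. dF \<theta> w x i j) \<in> borel_measurable (gauss_PiM IX)"
  unfolding dF_def H_def
  by (intro borel_measurable_add borel_measurable_times measurable_dQ measurable_D measurable_Q
      borel_measurable_const borel_measurable_divide borel_measurable_diff borel_measurable_power measurable_nr) auto

lemma measurable_dZ: "(\<lambda>w. dZ \<theta> w x) \<in> borel_measurable (gauss_PiM IX)"
  unfolding dZ_def
  by (intro borel_measurable_add borel_measurable_sum borel_measurable_times borel_measurable_const
      measurable_gauss_component measurable_D) (auto simp: IX_def)

text \<open>Apart from the factors \<open>D\<close>, \<open>dZ\<close> is linear in the Gaussian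
  entries, so each entry is integrated by parts separately; what comes out is the integrand of
  \<open>drift_nonneg\<close>.\<close>

lemma integral_Q_dZ:
  assumes x: "x \<in> T"
  shows "integrable (gauss_PiM IX) (\<lambda>w. Q (Z \<theta> w) x * dZ \<theta> w x)"
    and "(\<integral>w. Q (Z \<theta> w) x * dZ \<theta> w x \<partial>gauss_PiM IX)
      = (\<integral>w. (\<Sum>i<m. \<Sum>j<Suc N. P' \<theta> x j * dF \<theta> w x i j)
          + (\<Sum>j<Suc N. P \<theta> x j * dQ (Z \<theta> w) (\<lambda>y. - P' \<theta> y j) x) \<partial>gauss_PiM IX)"
proof -
  let ?M = "gauss_PiM IX"
  have IX: "(i, j) \<in> IX" if "i < m" "j < Suc N" for i j
    using that by (auto simp: IX_def)
  have IXm: "(m, j) \<in> IX" if "j < Suc N" for j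
    using that by (auto simp: IX_def)
  have mQD: "(\<lambda>w. Q (Z \<theta> w) x * D \<theta> w x i) \<in> borel_measurable ?M" if "i < m" for i
    using that by (intro borel_measurable_times measurable_Q measurable_D) simp
  have mdQ: "(\<lambda>w. dQ (Z \<theta> w) (\<lambda>y. - P' \<theta> y j) x) \<in> borel_measurable ?M" for j
    by (intro measurable_dQ) simp
  have eq: "Q (Z \<theta> w) x * dZ \<theta> w x
      = (\<Sum>i<m. \<Sum>j<Suc N. P' \<theta> x j * (w (i, j) * (Q (Z \<theta> w) x * D \<theta> w x i)))
        + (\<Sum>j<Suc N. P \<theta> x j * (w (m, j) * Q (Z \<theta> w) x))" for w
    unfolding dZ_def distrib_left sum_distrib_left by (simp only: mult_ac)
  have i1: "integrable ?M (\<lambda>w. w (i, j) * (Q (Z \<theta> w) x * D \<theta> w x i))" if "i < m" "j < Suc N" for i j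
    using that x by (intro integrable_gauss_PiM_coord_mult [OF finite_IX IX mQD abs_QD_le])
  have i2: "integrable ?M (\<lambda>w. w (m, j) * Q (Z \<theta> w) x)" if "j < Suc N" for j
    using that x by (intro integrable_gauss_PiM_coord_mult [OF finite_IX IXm measurable_Q abs_Q_le])
  have i3: "integrable ?M (\<lambda>w. dF \<theta> w x i j)" if "i < m" for i j
    using that x by (intro integrable_gauss_PiM_bound [OF finite_IX measurable_dF abs_dF_le])
  have i4: "integrable ?M (\<lambda>w. dQ (Z \<theta> w) (\<lambda>y. - P' \<theta> y j) x)" for j
    using x by (intro integrable_gauss_PiM_bound [OF finite_IX mdQ abs_dQ_last_le])
  have e1: "(\<integral>w. w (i, j) * (Q (Z \<theta> w) x * D \<theta> w x i) \<partial>?M) = (\<integral>w. dF \<theta> w x i j \<partial>?M)"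
    if "i < m" "j < Suc N" for i j
    using that x by (intro gauss_PiM_integration_by_parts [OF finite_IX IX mQD measurable_dF DERIV_F_coord abs_QD_le abs_dF_le])
  have e2: "(\<integral>w. w (m, j) * Q (Z \<theta> w) x \<partial>?M) = (\<integral>w. dQ (Z \<theta> w) (\<lambda>y. - P' \<theta> y j) x \<partial>?M)"
    if "j < Suc N" for j
    using that x by (intro gauss_PiM_integration_by_parts [OF finite_IX IXm measurable_Q mdQ DERIV_F_coord_last abs_Q_le abs_dQ_last_le])
  show "integrable ?M (\<lambda>w. Q (Z \<theta> w) x * dZ \<theta> w x)"
    unfolding eq
    by (intro Bochner_Integration.integrable_add Bochner_Integration.integrable_sum integrable_mult_right i1 i2) auto
  have "(\<integral>w. Q (Z \<theta> w) x * dZ \<theta> w x \<partial>?M)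
      = (\<Sum>i<m. \<Sum>j<Suc N. P' \<theta> x j * (\<integral>w. w (i, j) * (Q (Z \<theta> w) x * D \<theta> w x i) \<partial>?M))
        + (\<Sum>j<Suc N. P \<theta> x j * (\<integral>w. w (m, j) * Q (Z \<theta> w) x \<partial>?M))"
    unfolding eq by (rule integral_sum_sum_add_sum) (auto intro: i1 i2 simp del: sum.lessThan_Suc)
  also have "\<dots> = (\<Sum>i<m. \<Sum>j<Suc N. P' \<theta> x j * (\<integral>w. dF \<theta> w x i j \<partial>?M))
        + (\<Sum>j<Suc N. P \<theta> x j * (\<integral>w. dQ (Z \<theta> w) (\<lambda>y. - P' \<theta> y j) x \<partial>?M))"
    by (intro arg_cong2 [where f = "(+)"] sum.cong refl) (simp_all only: e1 e2 lessThan_iff)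
  also have "\<dots> = (\<integral>w. (\<Sum>i<m. \<Sum>j<Suc N. P' \<theta> x j * dF \<theta> w x i j)
          + (\<Sum>j<Suc N. P \<theta> x j * dQ (Z \<theta> w) (\<lambda>y. - P' \<theta> y j) x) \<partial>?M)"
    by (rule integral_sum_sum_add_sum [symmetric]) (auto intro: i3 i4 simp del: sum.lessThan_Suc)
  finally show "(\<integral>w. Q (Z \<theta> w) x * dZ \<theta> w x \<partial>?M)
      = (\<integral>w. (\<Sum>i<m. \<Sum>j<Suc N. P' \<theta> x j * dF \<theta> w x i j)
          + (\<Sum>j<Suc N. P \<theta> x j * dQ (Z \<theta> w) (\<lambda>y. - P' \<theta> y j) x) \<partial>?M)" .
qed

lemma integrable_Phi: "integrable (gauss_PiM IX) (Phi t)"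
proof (rule integrable_gauss_PiM_bound [OF finite_IX measurable_Phi])
  show "\<bar>Phi t w\<bar> \<le> K * exp (s * (\<Sum>c\<in>IX. \<bar>w c\<bar>))" for w
    using Phi_le [of t w] by (simp add: W_def) (simp add: Phi_def)
qed

text \<open>The angle derivative is \<open>- s\<close> times a sum of expectations of drifts, each
  nonnegative on the first quadrant. The matrix process sits at pi / 2, the decoupled one at
  0.\<close>

lemma integral_Phi_mono: "(\<integral>w. Phi (pi / 2) w \<partial>gauss_PiM IX) \<le> (\<integral>w. Phi 0 w \<partial>gauss_PiM IX)"
proof (rule DERIV_nonpos_imp_nonincreasing [where f = "\<lambda>\<theta>. \<integral>w. Phi \<theta> w \<partial>gauss_PiM IX"])
  fix \<theta> :: real assume \<theta>: "0 \<le> \<theta>" "\<theta> \<le> pi / 2"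
  let ?M = "gauss_PiM IX"
  let ?d = "\<lambda>\<theta> w. - s * (\<Sum>x\<in>T. Q (Z \<theta> w) x * dZ \<theta> w x)"
  have "((\<lambda>\<theta>. \<integral>w. Phi \<theta> w \<partial>?M) has_real_derivative (\<integral>w. ?d \<theta> w \<partial>?M)) (at \<theta>)"
  proof (rule has_real_derivative_integral [where d = 1])
    show "integrable ?M (Phi t)" for t
      by (rule integrable_Phi)
    show "((\<lambda>t. Phi t w) has_real_derivative ?d t w) (at t)" for t w
      by (rule DERIV_Phi)
    show "integrable ?M (\<lambda>w. s * (real (card T) * K) * exp ((s + 1) * (\<Sum>c\<in>IX. \<bar>w c\<bar>)))"
      by (intro integrable_mult_right integrable_gauss_PiM_exp_abs finite_IX)
    show "\<bar>?d t w\<bar> \<le> s * (real (card T) * K) * exp ((s + 1) * (\<Sum>c\<in>IX. \<bar>w c\<bar>))" for t w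
    proof -
      have "\<bar>\<Sum>x\<in>T. Q (Z t w) x * dZ t w x\<bar> \<le> (\<Sum>x\<in>T. K * exp (s * W w) * exp (W w))"
      proof (rule order_trans [OF sum_abs], rule sum_mono)
        fix x assume x: "x \<in> T"
        have "\<bar>dZ t w x\<bar> \<le> exp (W w)"
          using abs_dZ_le [OF x, of t w] exp_ge_add_one_self [of "W w"] by linarith
        then show "\<bar>Q (Z t w) x * dZ t w x\<bar> \<le> K * exp (s * W w) * exp (W w)"
          unfolding abs_mult using x Q_pos [of "Z t w" x] Q_le [OF x, of t w] K_pos by (intro mult_mono) auto
      qed
      also have "\<dots> = real (card T) * K * exp ((s + 1) * W w)"
        by (simp add: distrib_right exp_add)
      finally have "s * \<bar>\<Sum>x\<in>T. Q (Z t w) x * dZ t w x\<bar> \<le> s * (real (card T) * K * exp ((s + 1) * W w))"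
        using s_pos by (intro mult_left_mono) auto
      then show ?thesis
        using s_pos by (simp add: abs_mult W_def)
    qed
    show "?d \<theta> \<in> borel_measurable ?M"
      by (intro borel_measurable_times borel_measurable_sum borel_measurable_const measurable_Q measurable_dZ)
  qed simp
  moreover have "(\<integral>w. ?d \<theta> w \<partial>?M) \<le> 0"
  proof -
    have "0 \<le> (\<integral>w. Q (Z \<theta> w) x * dZ \<theta> w x \<partial>?M)" if "x \<in> T" for x
      unfolding integral_Q_dZ(2) [OF that] by (intro integral_nonneg_AE AE_I2 drift_nonneg that \<theta>)
    then have "0 \<le> (\<Sum>x\<in>T. \<integral>w. Q (Z \<theta> w) x * dZ \<theta> w x \<partial>?M)"
      by (rule sum_nonneg)
    also have "\<dots> = (\<integral>w. (\<Sum>x\<in>T. Q (Z \<theta> w) x * dZ \<theta> w x) \<partial>?M)"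
      by (rule Bochner_Integration.integral_sum [symmetric], rule integral_Q_dZ(1))
    finally show ?thesis
      using s_pos by (simp add: mult_nonneg_nonneg)
  qed
  ultimately show "\<exists>y. ((\<lambda>\<theta>. \<integral>w. Phi \<theta> w \<partial>?M) has_real_derivative y) (at \<theta>) \<and> y \<le> 0"
    by (intro exI [of _ "\<integral>w. ?d \<theta> w \<partial>?M"] conjI)
qed simp

section \<open>End points of the path\<close>

lemma V_pi_half: "V (pi / 2) w x i = (\<Sum>j<N. w (i, j) * x j)"
  by (simp add: V_def P_def)

lemma V_0: "V 0 w x i = w (i, N)"
  by (simp add: V_def P_def)

lemma U_pi_half: "U (pi / 2) w x = - w (m, N)"
  by (simp add: U_def P'_def)

lemma U_0: "U 0 w x = (\<Sum>j<N. w (m, j) * x j)"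
  by (simp add: U_def P'_def)

text \<open>Both ends of \<open>integral_Phi_mono\<close> made explicit. On the event, one suitable
  \<open>x\<close> forces \<open>Z \<le> sqrt (\<delta> + b) + w (m, N)\<close> at pi / 2; at 0 the
  bound \<open>R\<close> disposes of the dependence on \<open>x\<close>. The corner entry stays in
  the integral, to be factored out later by independence from the event.\<close>

lemma nn_integral_comparison:
  assumes Rm: "R \<in> borel_measurable (gauss_PiM IX)"
    and R: "\<And>w x. x \<in> T \<Longrightarrow> (\<Sum>j<N. w (m, j) * x j) \<le> R w"
  shows "(\<integral>\<^sup>+w. indicator {w. \<exists>x\<in>T. (\<Sum>i<m. (\<Sum>j<N. w (i, j) * x j)\<^sup>2) \<le> b} w * ennreal (exp (- s * w (m, N))) \<partial>gauss_PiM IX)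
    \<le> ennreal (exp (s * sqrt (\<delta> + b)) * K) *
      (\<integral>\<^sup>+w. ennreal (exp (- s * sqrt (\<Sum>i<m. (w (i, N))\<^sup>2))) * ennreal (exp (s * R w)) \<partial>gauss_PiM IX)"
proof -
  let ?M = "gauss_PiM IX"
  let ?E = "{w. \<exists>x\<in>T. (\<Sum>i<m. (\<Sum>j<N. w (i, j) * x j)\<^sup>2) \<le> b}"
  have nn: "(\<integral>\<^sup>+w. ennreal (Phi t w) \<partial>?M) = ennreal (\<integral>w. Phi t w \<partial>?M)" for t
    by (rule nn_integral_eq_integral [OF integrable_Phi]) (simp add: Phi_def)
  have "(\<integral>\<^sup>+w. indicator ?E w * ennreal (exp (- s * w (m, N))) \<partial>?M)
      \<le> (\<integral>\<^sup>+w. ennreal (exp (s * sqrt (\<delta> + b))) * ennreal (Phi (pi / 2) w) \<partial>?M)"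
  proof (rule nn_integral_mono)
    fix w :: "nat \<times> nat \<Rightarrow> real"
    show "indicator ?E w * ennreal (exp (- s * w (m, N))) \<le> ennreal (exp (s * sqrt (\<delta> + b))) * ennreal (Phi (pi / 2) w)"
    proof (cases "w \<in> ?E")
      case True
      then obtain x where x: "x \<in> T" and xb: "(\<Sum>i<m. (\<Sum>j<N. w (i, j) * x j)\<^sup>2) \<le> b"
        by auto
      have "Z (pi / 2) w x \<le> sqrt (\<delta> + b) + w (m, N)"
        unfolding Z_def nr_def V_pi_half U_pi_half using xb by simp
      then have "- s * w (m, N) \<le> s * sqrt (\<delta> + b) + - s * Z (pi / 2) w x"
        using mult_left_mono [of "Z (pi / 2) w x" "sqrt (\<delta> + b) + w (m, N)" s] s_pos by (simp add: distrib_left)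
      then have "exp (- s * w (m, N)) \<le> exp (s * sqrt (\<delta> + b)) * exp (- s * Z (pi / 2) w x)"
        unfolding exp_add [symmetric] by simp
      also have "\<dots> \<le> exp (s * sqrt (\<delta> + b)) * Phi (pi / 2) w"
        unfolding Phi_def by (intro mult_left_mono S_powr_ge x) simp
      finally show ?thesis
        using True by (simp add: ennreal_mult' [symmetric] ennreal_leI)
    qed simp
  qed
  also have "\<dots> = ennreal (exp (s * sqrt (\<delta> + b))) * (\<integral>\<^sup>+w. ennreal (Phi (pi / 2) w) \<partial>?M)"
    by (rule nn_integral_cmult) (intro measurable_compose [OF measurable_Phi measurable_ennreal])
  also have "(\<integral>\<^sup>+w. ennreal (Phi (pi / 2) w) \<partial>?M) \<le> (\<integral>\<^sup>+w. ennreal (Phi 0 w) \<partial>?M)"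
    unfolding nn by (intro ennreal_leI integral_Phi_mono)
  also have "\<dots> \<le> (\<integral>\<^sup>+w. ennreal K * (ennreal (exp (- s * sqrt (\<Sum>i<m. (w (i, N))\<^sup>2))) * ennreal (exp (s * R w))) \<partial>?M)"
  proof (rule nn_integral_mono)
    fix w :: "nat \<times> nat \<Rightarrow> real"
    have "Phi 0 w \<le> K * exp (s * (R w - sqrt (\<Sum>i<m. (w (i, N))\<^sup>2)))"
      unfolding Phi_def
    proof (rule S_powr_le)
      fix x assume "x \<in> T"
      moreover have "sqrt (\<Sum>i<m. (w (i, N))\<^sup>2) \<le> sqrt (\<delta> + (\<Sum>i<m. (w (i, N))\<^sup>2))"
        using delta_pos by simp
      ultimately show "- Z 0 w x \<le> R w - sqrt (\<Sum>i<m. (w (i, N))\<^sup>2)"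
        using R [of x w] unfolding Z_def nr_def V_0 U_0 by linarith
    qed
    also have "\<dots> = K * (exp (- s * sqrt (\<Sum>i<m. (w (i, N))\<^sup>2)) * exp (s * R w))"
      by (simp add: exp_add [symmetric] algebra_simps)
    finally show "ennreal (Phi 0 w) \<le> ennreal K * (ennreal (exp (- s * sqrt (\<Sum>i<m. (w (i, N))\<^sup>2))) * ennreal (exp (s * R w)))"
      using K_pos by (simp add: ennreal_mult [symmetric] ennreal_leI)
  qed
  also have "\<dots> = ennreal K * (\<integral>\<^sup>+w. ennreal (exp (- s * sqrt (\<Sum>i<m. (w (i, N))\<^sup>2))) * ennreal (exp (s * R w)) \<partial>?M)"
  proof (rule nn_integral_cmult)
    have h: "(\<lambda>w. \<Sum>i<m. (w (i, N))\<^sup>2) \<in> borel_measurable ?M"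
      by (intro borel_measurable_sum borel_measurable_power measurable_gauss_component) (auto simp: IX_def)
    show "(\<lambda>w. ennreal (exp (- s * sqrt (\<Sum>i<m. (w (i, N))\<^sup>2))) * ennreal (exp (s * R w))) \<in> borel_measurable ?M"
      by (intro borel_measurable_times_ennreal measurable_compose [OF _ measurable_ennreal]
          measurable_compose [OF _ borel_measurable_exp] borel_measurable_times borel_measurable_const
          measurable_compose [OF h borel_measurable_sqrt] Rm)
  qed
  finally show ?thesis
    using K_pos by (simp add: ennreal_mult mult.assoc mult_left_mono)
qed

end

section \<open>Exponential moments of Gaussian norms\<close>

lemma nn_integral_gauss_exp_linear: "(\<integral>\<^sup>+u. ennreal (exp (- s * u)) \<partial>gauss) = ennreal (exp (s\<^sup>2 / 2))"
proof -
  have m: "(\<lambda>u. ennreal (phi u)) \<in> borel_measurable borel"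
    by simp
  have "(\<integral>\<^sup>+u. ennreal (exp (- s * u)) \<partial>gauss) = (\<integral>\<^sup>+u. ennreal (phi u) * ennreal (exp (- s * u)) \<partial>lborel)"
    by (subst nn_integral_density) auto
  also have "\<dots> = (\<integral>\<^sup>+u. ennreal (exp (s\<^sup>2 / 2)) * ennreal (phi (s + 1 * u)) \<partial>lborel)"
  proof (intro nn_integral_cong)
    fix u
    have "phi u * exp (- s * u) = exp (s\<^sup>2 / 2) * phi (s + 1 * u)"
      using phi_shift [of u s] by (simp add: add.commute exp_minus field_simps)
    then show "ennreal (phi u) * ennreal (exp (- s * u)) = ennreal (exp (s\<^sup>2 / 2)) * ennreal (phi (s + 1 * u))"
      by (simp add: ennreal_mult' [symmetric])
  qed
  also have "\<dots> = ennreal (exp (s\<^sup>2 / 2)) * (\<integral>\<^sup>+u. ennreal (phi (s + 1 * u)) \<partial>lborel)"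
    by (rule nn_integral_cmult) simp
  also have "(\<integral>\<^sup>+u. ennreal (phi (s + 1 * u)) \<partial>lborel) = (\<integral>\<^sup>+u. ennreal (phi u) \<partial>lborel)"
    using nn_integral_real_affine [OF m, of 1 s] by simp
  also have "\<dots> = 1"
    using gauss.emeasure_space_1 by (simp add: emeasure_density)
  finally show ?thesis by simp
qed

text \<open>The quadratic term doubles the exponent in \<open>gauss_norm_lower_tail\<close>, from
  x^2 / 2 to x^2.\<close>

lemma ln_one_minus_le:
  fixes y :: real
  assumes "0 \<le> y" "y < 1"
  shows "ln (1 - y) \<le> - y - y\<^sup>2 / 2"
proof -
  have "ln (1 - y) + y + y\<^sup>2 / 2 \<le> ln (1 - 0) + 0 + 0\<^sup>2 / 2"
  proof (rule DERIV_nonpos_imp_nonincreasing [OF assms(1), where f = "\<lambda>y. ln (1 - y) + y + y\<^sup>2 / 2"])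
    fix x assume x: "0 \<le> x" "x \<le> y"
    have "((\<lambda>y. ln (1 - y) + y + y\<^sup>2 / 2) has_real_derivative - (x\<^sup>2 / (1 - x))) (at x)"
      using x assms by (auto intro!: derivative_eq_intros simp: field_simps power2_eq_square)
    moreover have "- (x\<^sup>2 / (1 - x)) \<le> 0"
      using x assms by simp
    ultimately show "\<exists>z. ((\<lambda>y. ln (1 - y) + y + y\<^sup>2 / 2) has_real_derivative z) (at x) \<and> z \<le> 0"
      by (intro exI conjI)
  qed
  then show ?thesis by simp
qed

lemma gauss_norm_measurable:
  assumes "J \<subseteq> I"
  shows "(\<lambda>w. sqrt (\<Sum>c\<in>J. (w c)\<^sup>2)) \<in> borel_measurable (gauss_PiM I)"
  using assms
  by (intro measurable_compose [OF _ borel_measurable_sqrt] borel_measurable_sum borel_measurable_power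
      measurable_gauss_component) auto

text \<open>Chernoff's bound for the sum of squares. The rate x^2, twice that of Lipschitz
  concentration, makes the exponential of half the squared deficit integrable.\<close>

lemma gauss_norm_lower_tail:
  assumes I: "finite I" "J \<subseteq> I" and x: "0 \<le> x" "x < sqrt (real (card J))"
  shows "emeasure (gauss_PiM I) {w \<in> space (gauss_PiM I). sqrt (\<Sum>c\<in>J. (w c)\<^sup>2) \<le> sqrt (real (card J)) - x}
    \<le> ennreal (exp (- x\<^sup>2))"
proof -
  let ?M = "gauss_PiM I"
  define n where "n = real (card J)"
  define \<rho> where "\<rho> = sqrt n - x"
  \<comment> \<open>The minimiser of the Chernoff bound, given by
    \<open>1 + 2 * l = n / \<rho>\<^sup>2\<close>.\<close>
  define l where "l = (n / \<rho>\<^sup>2 - 1) / 2"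
  have J: "finite J"
    using I finite_subset by blast
  have n: "n > 0" and \<rho>: "0 < \<rho>" "\<rho> \<le> sqrt n"
    using x by (auto simp: n_def \<rho>_def intro: ccontr)
  have "\<rho>\<^sup>2 \<le> n"
    using \<rho> n power_mono [OF \<rho>(2), of 2] by simp
  then have l0: "l \<ge> 0" and l2: "1 - 2 * - l = n / \<rho>\<^sup>2"
    using \<rho> by (auto simp: l_def field_simps)
  have meas: "(\<lambda>w. sqrt (\<Sum>c\<in>J. (w c)\<^sup>2)) \<in> borel_measurable ?M"
    by (rule gauss_norm_measurable [OF I(2)])
  have "emeasure ?M {w \<in> space ?M. sqrt (\<Sum>c\<in>J. (w c)\<^sup>2) \<le> \<rho>}
      = (\<integral>\<^sup>+w. indicator {w \<in> space ?M. sqrt (\<Sum>c\<in>J. (w c)\<^sup>2) \<le> \<rho>} w \<partial>?M)"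
    by (rule nn_integral_indicator [symmetric], rule borel_measurable_le [OF meas borel_measurable_const])
  also have "\<dots> \<le> (\<integral>\<^sup>+w. ennreal (exp (l * \<rho>\<^sup>2)) * (\<Prod>c\<in>J. ennreal (exp (- l * (w c)\<^sup>2))) \<partial>?M)"
  proof (rule nn_integral_mono)
    fix w :: "'a \<Rightarrow> real"
    have eq: "(\<Prod>c\<in>J. ennreal (exp (- l * (w c)\<^sup>2))) = ennreal (exp (- l * (\<Sum>c\<in>J. (w c)\<^sup>2)))"
      by (simp add: prod_ennreal exp_sum [OF J] sum_distrib_left)
    have "1 \<le> exp (l * \<rho>\<^sup>2) * exp (- l * (\<Sum>c\<in>J. (w c)\<^sup>2))" if "sqrt (\<Sum>c\<in>J. (w c)\<^sup>2) \<le> \<rho>"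
    proof -
      have "(\<Sum>c\<in>J. (w c)\<^sup>2) \<le> \<rho>\<^sup>2"
        using that by (rule sqrt_le_D)
      from mult_left_mono [OF this l0] show ?thesis
        by (simp add: exp_add [symmetric])
    qed
    then show "indicator {w \<in> space ?M. sqrt (\<Sum>c\<in>J. (w c)\<^sup>2) \<le> \<rho>} w
        \<le> ennreal (exp (l * \<rho>\<^sup>2)) * (\<Prod>c\<in>J. ennreal (exp (- l * (w c)\<^sup>2)))"
      unfolding eq by (auto simp: indicator_def ennreal_mult' [symmetric])
  qed
  also have "\<dots> = ennreal (exp (l * \<rho>\<^sup>2)) * (\<integral>\<^sup>+w. (\<Prod>c\<in>J. ennreal (exp (- l * (w c)\<^sup>2))) \<partial>?M)"
  proof (rule nn_integral_cmult)
    have "(\<lambda>w. ennreal (exp (- l * (w c)\<^sup>2))) \<in> borel_measurable ?M" if "c \<in> J" for c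
      using that I(2) by (intro measurable_compose [OF measurable_gauss_component [of c I], of "\<lambda>u. ennreal (exp (- l * u\<^sup>2))"]) auto
    then show "(\<lambda>w. \<Prod>c\<in>J. ennreal (exp (- l * (w c)\<^sup>2))) \<in> borel_measurable ?M"
      by (rule borel_measurable_prod_ennreal)
  qed
  also have "(\<integral>\<^sup>+w. (\<Prod>c\<in>J. ennreal (exp (- l * (w c)\<^sup>2))) \<partial>?M) = (\<Prod>c\<in>J. \<integral>\<^sup>+u. ennreal (exp (- l * u\<^sup>2)) \<partial>gauss)"
    by (rule nn_integral_gauss_PiM_prod [OF I]) simp
  also have "(\<integral>\<^sup>+u. ennreal (exp (- l * u\<^sup>2)) \<partial>gauss) = ennreal (\<rho> / sqrt n)"
  proof -
    have "has_bochner_integral gauss (\<lambda>u. exp (- l * u\<^sup>2)) (\<rho> / sqrt n)"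
      using gauss_exp_square [of "- l" 0] l0 \<rho> unfolding l2 by (simp add: real_sqrt_divide)
    then show ?thesis
      by (subst nn_integral_eq_integral) (auto simp: has_bochner_integral_iff)
  qed
  also have "(\<Prod>c\<in>J. ennreal (\<rho> / sqrt n)) = ennreal ((\<rho> / sqrt n) ^ card J)"
    using \<rho> n by (simp add: ennreal_power)
  also have "ennreal (exp (l * \<rho>\<^sup>2)) * \<dots> = ennreal (exp (l * \<rho>\<^sup>2) * (\<rho> / sqrt n) ^ card J)"
    by (simp add: ennreal_mult')
  also have "\<dots> \<le> ennreal (exp (- x\<^sup>2))"
  proof (rule ennreal_leI)
    define y where "y = x / sqrt n"
    have y: "0 \<le> y" "y < 1" and ry: "\<rho> / sqrt n = 1 - y"
      using x n by (auto simp: y_def \<rho>_def n_def field_simps)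
    have xy: "n * y = sqrt n * x" "n * y\<^sup>2 = x\<^sup>2"
      using n by (auto simp: y_def field_simps power2_eq_square)
    have r2: "\<rho>\<^sup>2 = n - 2 * (sqrt n * x) + x\<^sup>2"
      using n by (simp add: \<rho>_def power2_diff)
    have lr: "l * \<rho>\<^sup>2 = (n - \<rho>\<^sup>2) / 2"
      using \<rho> by (simp add: l_def field_simps)
    have "(\<rho> / sqrt n) ^ card J = exp (n * ln (1 - y))"
      unfolding ry using y by (simp add: exp_of_nat_mult n_def)
    also have "\<dots> \<le> exp (n * (- y - y\<^sup>2 / 2))"
      using n ln_one_minus_le [OF y] by simp
    finally have "exp (l * \<rho>\<^sup>2) * (\<rho> / sqrt n) ^ card J \<le> exp (l * \<rho>\<^sup>2) * exp (n * (- y - y\<^sup>2 / 2))"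
      by (intro mult_left_mono) auto
    also have "\<dots> = exp (- x\<^sup>2)"
    proof -
      have "l * \<rho>\<^sup>2 + n * (- y - y\<^sup>2 / 2) = (n - \<rho>\<^sup>2) / 2 - n * y - n * y\<^sup>2 / 2"
        unfolding lr by (simp add: algebra_simps)
      also have "\<dots> = - x\<^sup>2"
        unfolding xy r2 by (simp add: field_simps)
      finally show ?thesis
        by (simp only: exp_add [symmetric])
    qed
    finally show "exp (l * \<rho>\<^sup>2) * (\<rho> / sqrt n) ^ card J \<le> exp (- x\<^sup>2)" .
  qed
  finally show ?thesis
    by (simp add: \<rho>_def n_def)
qed

text \<open>A dyadic layer-cake bound: the levels below \<open>u\<close> form a geometric sum of at
  least \<open>u - 2\<close>. It converts tail probabilities at these levels into a bound on a
  mean.\<close>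

lemma le_sum_dyadic_indicators:
  fixes u :: real
  assumes "u \<le> 2 ^ Suc n"
  shows "u \<le> 2 + (\<Sum>k<n. 2 ^ Suc k * indicat_real {2 ^ Suc k<..} u)"
  using assms
proof (induction n)
  case (Suc n)
  show ?case
  proof (cases "u \<le> 2 ^ Suc n")
    case True
    have "0 \<le> 2 ^ Suc n * indicat_real {2 ^ Suc n<..} u"
      by simp
    with Suc.IH [OF True] show ?thesis
      unfolding sum.lessThan_Suc by linarith
  next
    case False
    have "(\<Sum>k<Suc n. 2 ^ Suc k * indicat_real {2 ^ Suc k<..} u) = (\<Sum>k<Suc n. 2 ^ Suc k)"
    proof (intro sum.cong refl)
      fix k assume "k \<in> {..<Suc n}"
      then have "(2::real) ^ Suc k \<le> 2 ^ Suc n"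
        by (intro power_increasing) auto
      with False have "2 ^ Suc k < u"
        by linarith
      then show "2 ^ Suc k * indicat_real {2 ^ Suc k<..} u = 2 ^ Suc k"
        by (simp del: power_Suc)
    qed
    also have "\<dots> = 2 ^ Suc (Suc n) - 2"
      by (induction n) auto
    finally show ?thesis
      using Suc.prems by linarith
  qed
qed simp

text \<open>With \<open>X\<close> the positive part of the deficit of the norm against
  \<open>sqrt n\<close>, \<open>s * X \<le> s^2 / 2 + X^2 / 2\<close>, so it remains to bound the
  mean of \<open>exp (X^2 / 2)\<close> by 3. This value exceeds \<open>2 ^ Suc k\<close> with
  probability at most \<open>(1 / 4) ^ Suc k\<close>, and the dyadic sum is 2 + (1/2 + 1/4 +
  ...).\<close>

lemma nn_integral_exp_minus_gauss_norm_le: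
  assumes I: "finite I" "J \<subseteq> I" and s: "0 \<le> s"
  shows "(\<integral>\<^sup>+w. ennreal (exp (- s * sqrt (\<Sum>c\<in>J. (w c)\<^sup>2))) \<partial>gauss_PiM I)
    \<le> ennreal (3 * exp (- s * sqrt (real (card J)) + s\<^sup>2 / 2))"
proof -
  let ?M = "gauss_PiM I"
  define n where "n = real (card J)"
  define X where "X w = max 0 (sqrt n - sqrt (\<Sum>c\<in>J. (w c)\<^sup>2))" for w :: "'a \<Rightarrow> real"
  define u where "u w = exp ((X w)\<^sup>2 / 2)" for w
  have X0: "X w \<ge> 0" for w
    by (simp add: X_def)
  have Xm [measurable]: "X \<in> borel_measurable ?M"
    unfolding X_def by (intro borel_measurable_max borel_measurable_const borel_measurable_diff gauss_norm_measurable I)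
  have um [measurable]: "u \<in> borel_measurable ?M"
    unfolding u_def by measurable
  have tail: "emeasure ?M {w \<in> space ?M. 2 ^ Suc k < u w} \<le> ennreal ((1 / 4) ^ Suc k)" for k
  proof -
    \<comment> \<open>Chosen so that \<open>exp (x\<^sup>2 / 2)\<close> is the level
      \<open>2 ^ Suc k\<close>; the tail \<open>exp (- x\<^sup>2)\<close> is then the inverse square
      of that level.\<close>
    define x where "x = sqrt (2 * (real (Suc k) * ln 2))"
    have x: "x > 0" and x2: "x\<^sup>2 = 2 * (real (Suc k) * ln 2)"
      by (auto simp: x_def)
    have e: "(2::real) ^ Suc k = exp (x\<^sup>2 / 2)"
      unfolding x2 by (simp add: exp_of_nat_mult del: of_nat_Suc power_Suc)
    have sub: "sqrt (\<Sum>c\<in>J. (w c)\<^sup>2) < sqrt n - x" if "2 ^ Suc k < u w" for w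
    proof -
      have "x\<^sup>2 < (X w)\<^sup>2"
        using that unfolding e u_def by simp
      then have "x < X w"
        using X0 [of w] by (rule power2_less_imp_less)
      then show ?thesis
        using x by (auto simp: X_def)
    qed
    show ?thesis
    proof (cases "x < sqrt n")
      case True
      have "emeasure ?M {w \<in> space ?M. 2 ^ Suc k < u w}
          \<le> emeasure ?M {w \<in> space ?M. sqrt (\<Sum>c\<in>J. (w c)\<^sup>2) \<le> sqrt n - x}"
      proof (rule emeasure_mono)
        show "{w \<in> space ?M. 2 ^ Suc k < u w} \<subseteq> {w \<in> space ?M. sqrt (\<Sum>c\<in>J. (w c)\<^sup>2) \<le> sqrt n - x}"
          using sub by (auto intro: less_imp_le simp del: power_Suc)
        show "{w \<in> space ?M. sqrt (\<Sum>c\<in>J. (w c)\<^sup>2) \<le> sqrt n - x} \<in> sets ?M"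
          by (intro borel_measurable_le gauss_norm_measurable I borel_measurable_const)
      qed
      also have "\<dots> \<le> ennreal (exp (- x\<^sup>2))"
        unfolding n_def using x True by (intro gauss_norm_lower_tail I) (auto simp: n_def)
      also have "exp (- x\<^sup>2) = (1 / 4) ^ Suc k"
      proof -
        have "exp (x\<^sup>2) = exp (x\<^sup>2 / 2) * exp (x\<^sup>2 / 2)"
          unfolding exp_add [symmetric] by simp
        also have "\<dots> = (2 * 2) ^ Suc k"
          unfolding e [symmetric] by (rule power_mult_distrib [symmetric])
        finally have "exp (- x\<^sup>2) = inverse (4 ^ Suc k)"
          unfolding exp_minus by simp
        also have "\<dots> = (1 / 4) ^ Suc k"
          by (simp add: power_one_over inverse_eq_divide)
        finally show ?thesis .
      qed
      finally show ?thesis .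
    next
      case False
      \<comment> \<open>A deficit larger than \<open>sqrt n\<close> would require a negative
        norm.\<close>
      have "{w \<in> space ?M. 2 ^ Suc k < u w} = {}"
      proof -
        have "\<not> 2 ^ Suc k < u w" for w
        proof
          assume "2 ^ Suc k < u w"
          from sub [OF this] have "sqrt (\<Sum>c\<in>J. (w c)\<^sup>2) < 0"
            using False by linarith
          then show False
            using sum_nonneg [of J "\<lambda>c. (w c)\<^sup>2"] by (simp add: not_less [symmetric])
        qed
        then show ?thesis by blast
      qed
      then show ?thesis
        by (simp only: emeasure_empty) simp
    qed
  qed
  have "(\<integral>\<^sup>+w. ennreal (u w) \<partial>?M) \<le> (\<integral>\<^sup>+w. 2 + (\<Sum>k. ennreal (2 ^ Suc k) * indicator {w \<in> space ?M. 2 ^ Suc k < u w} w) \<partial>?M)"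
  proof (rule nn_integral_mono)
    fix w assume w: "w \<in> space ?M"
    obtain n where "u w \<le> 2 ^ n"
      using real_arch_pow [of 2 "u w"] by (auto intro: less_imp_le)
    also have "\<dots> \<le> 2 ^ Suc n"
      by simp
    finally have "ennreal (u w) \<le> ennreal (2 + (\<Sum>k<n. 2 ^ Suc k * indicat_real {2 ^ Suc k<..} (u w)))"
      by (intro ennreal_leI le_sum_dyadic_indicators)
    also have "\<dots> = 2 + (\<Sum>k<n. ennreal (2 ^ Suc k * indicat_real {2 ^ Suc k<..} (u w)))"
      by (subst ennreal_plus) (auto intro!: sum_nonneg simp: sum_ennreal)
    also have "\<dots> = 2 + (\<Sum>k<n. ennreal (2 ^ Suc k) * indicator {w \<in> space ?M. 2 ^ Suc k < u w} w)"
      using w by (intro arg_cong2 [where f = "(+)"] refl sum.cong) (auto simp: indicator_def)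
    also have "\<dots> \<le> 2 + (\<Sum>k. ennreal (2 ^ Suc k) * indicator {w \<in> space ?M. 2 ^ Suc k < u w} w)"
      by (intro add_left_mono sum_le_suminf) auto
    finally show "ennreal (u w) \<le> 2 + (\<Sum>k. ennreal (2 ^ Suc k) * indicator {w \<in> space ?M. 2 ^ Suc k < u w} w)" .
  qed
  also have "\<dots> = 2 + (\<Sum>k. ennreal (2 ^ Suc k) * emeasure ?M {w \<in> space ?M. 2 ^ Suc k < u w})"
    by (subst nn_integral_add) (auto simp: nn_integral_suminf nn_integral_cmult_indicator)
  also have "\<dots> \<le> 2 + (\<Sum>k. ennreal ((1 / 2) ^ Suc k))"
  proof (intro add_left_mono suminf_le)
    fix k
    have "ennreal (2 ^ Suc k) * emeasure ?M {w \<in> space ?M. 2 ^ Suc k < u w} \<le> ennreal (2 ^ Suc k) * ennreal ((1 / 4) ^ Suc k)"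
      by (intro mult_left_mono tail) simp
    also have "\<dots> = ennreal ((1 / 2) ^ Suc k)"
      by (subst ennreal_mult [symmetric]) (simp_all add: power_mult_distrib [symmetric] del: power_Suc)
    finally show "ennreal (2 ^ Suc k) * emeasure ?M {w \<in> space ?M. 2 ^ Suc k < u w} \<le> ennreal ((1 / 2) ^ Suc k)" .
  qed auto
  also have "(\<Sum>k. ennreal ((1 / 2) ^ Suc k)) = 1"
    by (subst suminf_ennreal_eq [OF _ power_half_series]) simp_all
  finally have u3: "(\<integral>\<^sup>+w. ennreal (u w) \<partial>?M) \<le> 3"
    by simp
  have "(\<integral>\<^sup>+w. ennreal (exp (- s * sqrt (\<Sum>c\<in>J. (w c)\<^sup>2))) \<partial>?M)
      \<le> (\<integral>\<^sup>+w. ennreal (exp (- s * sqrt n + s\<^sup>2 / 2)) * ennreal (u w) \<partial>?M)"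
  proof (rule nn_integral_mono)
    fix w :: "'a \<Rightarrow> real"
    have "s * (sqrt n - sqrt (\<Sum>c\<in>J. (w c)\<^sup>2)) \<le> s * X w"
      using s by (intro mult_left_mono) (auto simp: X_def)
    also have "\<dots> \<le> s\<^sup>2 / 2 + (X w)\<^sup>2 / 2"
      using zero_le_power2 [of "s - X w"] by (simp add: power2_diff)
    finally have "- s * sqrt (\<Sum>c\<in>J. (w c)\<^sup>2) \<le> - s * sqrt n + s\<^sup>2 / 2 + (X w)\<^sup>2 / 2"
      by (simp add: right_diff_distrib)
    then show "ennreal (exp (- s * sqrt (\<Sum>c\<in>J. (w c)\<^sup>2))) \<le> ennreal (exp (- s * sqrt n + s\<^sup>2 / 2)) * ennreal (u w)"
      unfolding u_def by (simp add: ennreal_mult' [symmetric] exp_add [symmetric] ennreal_leI)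
  qed
  also have "\<dots> = ennreal (exp (- s * sqrt n + s\<^sup>2 / 2)) * (\<integral>\<^sup>+w. ennreal (u w) \<partial>?M)"
    by (rule nn_integral_cmult) simp
  also have "\<dots> \<le> ennreal (exp (- s * sqrt n + s\<^sup>2 / 2)) * 3"
    by (intro mult_left_mono u3) simp
  also have "\<dots> = ennreal (3 * exp (- s * sqrt n + s\<^sup>2 / 2))"
    by (simp add: ennreal_mult' mult.commute)
  finally show ?thesis
    by (simp add: n_def)
qed

text \<open>\<open>s * R \<le> s^2 / (4 * a) + a * R^2\<close> removes the root, and the exponential
  then factors over coordinates. The parameter \<open>a\<close> stays free: it is optimised for the
  concentration bound and sent to 1/2 when there are more rows than columns.\<close>

lemma nn_integral_exp_root_sum_squares_le:
  fixes \<psi> :: "'i \<Rightarrow> real \<Rightarrow> real"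
  assumes I: "finite I" "J \<subseteq> I" and a: "0 < a"
    and m: "\<And>c. c \<in> J \<Longrightarrow> \<psi> c \<in> borel_measurable borel"
    and B: "\<And>c. c \<in> J \<Longrightarrow> (\<integral>\<^sup>+u. ennreal (exp (a * (\<psi> c u)\<^sup>2)) \<partial>gauss) \<le> ennreal (b c)"
    and b: "\<And>c. c \<in> J \<Longrightarrow> 0 \<le> b c"
  shows "(\<integral>\<^sup>+w. ennreal (exp (s * sqrt (\<Sum>c\<in>J. (\<psi> c (w c))\<^sup>2))) \<partial>gauss_PiM I)
    \<le> ennreal (exp (s\<^sup>2 / (4 * a)) * (\<Prod>c\<in>J. b c))"
proof -
  let ?M = "gauss_PiM I"
  have J: "finite J"
    using I finite_subset by blast
  have m': "(\<lambda>u. ennreal (exp (a * (\<psi> c u)\<^sup>2))) \<in> borel_measurable borel" if "c \<in> J" for c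
    using m [OF that] by measurable
  have "(\<integral>\<^sup>+w. ennreal (exp (s * sqrt (\<Sum>c\<in>J. (\<psi> c (w c))\<^sup>2))) \<partial>?M)
      \<le> (\<integral>\<^sup>+w. ennreal (exp (s\<^sup>2 / (4 * a))) * (\<Prod>c\<in>J. ennreal (exp (a * (\<psi> c (w c))\<^sup>2))) \<partial>?M)"
  proof (rule nn_integral_mono)
    fix w :: "'i \<Rightarrow> real"
    define R where "R = sqrt (\<Sum>c\<in>J. (\<psi> c (w c))\<^sup>2)"
    have R2: "R\<^sup>2 = (\<Sum>c\<in>J. (\<psi> c (w c))\<^sup>2)"
      by (simp add: R_def sum_nonneg)
    have "0 \<le> (s - 2 * a * R)\<^sup>2 / (4 * a)"
      using a by simp
    also have "\<dots> = s\<^sup>2 / (4 * a) + a * R\<^sup>2 - s * R"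
      using a by (simp add: power2_diff power2_eq_square field_simps)
    finally have "exp (s * R) \<le> exp (s\<^sup>2 / (4 * a)) * exp (a * R\<^sup>2)"
      by (simp add: exp_add [symmetric])
    also have "exp (a * R\<^sup>2) = (\<Prod>c\<in>J. exp (a * (\<psi> c (w c))\<^sup>2))"
      unfolding R2 by (simp add: exp_sum [OF J] sum_distrib_left)
    finally show "ennreal (exp (s * sqrt (\<Sum>c\<in>J. (\<psi> c (w c))\<^sup>2)))
        \<le> ennreal (exp (s\<^sup>2 / (4 * a))) * (\<Prod>c\<in>J. ennreal (exp (a * (\<psi> c (w c))\<^sup>2)))"
      unfolding R_def by (simp add: ennreal_mult' [symmetric] prod_ennreal ennreal_leI)
  qed
  also have "\<dots> = ennreal (exp (s\<^sup>2 / (4 * a))) * (\<integral>\<^sup>+w. (\<Prod>c\<in>J. ennreal (exp (a * (\<psi> c (w c))\<^sup>2))) \<partial>?M)"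
  proof (rule nn_integral_cmult, rule borel_measurable_prod_ennreal)
    fix c assume c: "c \<in> J"
    then show "(\<lambda>w. ennreal (exp (a * (\<psi> c (w c))\<^sup>2))) \<in> borel_measurable ?M"
      using I(2) by (intro measurable_compose [OF measurable_gauss_component m' [OF c]]) auto
  qed
  also have "(\<integral>\<^sup>+w. (\<Prod>c\<in>J. ennreal (exp (a * (\<psi> c (w c))\<^sup>2))) \<partial>?M)
      = (\<Prod>c\<in>J. \<integral>\<^sup>+u. ennreal (exp (a * (\<psi> c u)\<^sup>2)) \<partial>gauss)"
    by (rule nn_integral_gauss_PiM_prod [OF I m'])
  also have "ennreal (exp (s\<^sup>2 / (4 * a))) * \<dots> \<le> ennreal (exp (s\<^sup>2 / (4 * a))) * (\<Prod>c\<in>J. ennreal (b c))"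
    by (intro mult_left_mono prod_mono_ennreal B) auto
  also have "\<dots> = ennreal (exp (s\<^sup>2 / (4 * a)) * (\<Prod>c\<in>J. b c))"
    using b by (simp add: ennreal_mult' prod_ennreal)
  finally show ?thesis .
qed

text \<open>The choice of \<open>a\<close> makes the linearisation of the square root exact at scale \<open>sqrt d\<close>, so that
  no constant is lost against Gaussian concentration.\<close>

lemma nn_integral_exp_root_sum_squares_concentration:
  fixes \<psi> :: "'i \<Rightarrow> real \<Rightarrow> real"
  assumes I: "finite I" "J \<subseteq> I" and s: "0 < s" and d: "0 < d" "(\<Sum>c\<in>J. e c) \<le> d"
    and m: "\<And>c. c \<in> J \<Longrightarrow> \<psi> c \<in> borel_measurable borel"
    and B: "\<And>c a. c \<in> J \<Longrightarrow> 0 \<le> a \<Longrightarrow> a < 1 / 2 \<Longrightarrow>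
      (\<integral>\<^sup>+u. ennreal (exp (a * (\<psi> c u)\<^sup>2)) \<partial>gauss) \<le> ennreal (exp (a / (1 - 2 * a) * e c))"
  shows "(\<integral>\<^sup>+w. ennreal (exp (s * sqrt (\<Sum>c\<in>J. (\<psi> c (w c))\<^sup>2))) \<partial>gauss_PiM I)
    \<le> ennreal (exp (s * sqrt d + s\<^sup>2 / 2))"
proof -
  have J: "finite J"
    using I finite_subset by blast
  \<comment> \<open>With \<open>a = 1 / (2 * (1 + k))\<close> the total exponent is
    \<open>s^2 * (1 + k) / 2 + d / (2 * k)\<close>, minimal at this \<open>k\<close>.\<close>
  define k where "k = sqrt d / s"
  define a where "a = 1 / (2 * (1 + k))"
  have k: "k > 0"
    using s d by (simp add: k_def)
  have a: "0 < a" "a < 1 / 2" and a1: "a / (1 - 2 * a) = 1 / (2 * k)" and a2: "1 / (4 * a) = (1 + k) / 2"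
    using k by (auto simp: a_def field_simps)
  have "(\<integral>\<^sup>+w. ennreal (exp (s * sqrt (\<Sum>c\<in>J. (\<psi> c (w c))\<^sup>2))) \<partial>gauss_PiM I)
      \<le> ennreal (exp (s\<^sup>2 / (4 * a)) * (\<Prod>c\<in>J. exp (a / (1 - 2 * a) * e c)))"
    using a by (intro nn_integral_exp_root_sum_squares_le I m B) auto
  also have "(\<Prod>c\<in>J. exp (a / (1 - 2 * a) * e c)) = exp (1 / (2 * k) * (\<Sum>c\<in>J. e c))"
    unfolding a1 by (simp add: exp_sum [OF J] sum_distrib_left)
  also have "exp (s\<^sup>2 / (4 * a)) * exp (1 / (2 * k) * (\<Sum>c\<in>J. e c)) \<le> exp (s\<^sup>2 / (4 * a)) * exp (1 / (2 * k) * d)"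
    using d k by (simp add: divide_right_mono)
  also have "\<dots> = exp (s * sqrt d + s\<^sup>2 / 2)"
  proof -
    have "s\<^sup>2 / (4 * a) = s\<^sup>2 * ((1 + k) / 2)"
      unfolding a2 [symmetric] by simp
    moreover have "s\<^sup>2 * k = s * sqrt d" and "d / k = s * sqrt d"
      using s d by (auto simp: k_def power2_eq_square field_simps)
    ultimately have "s\<^sup>2 / (4 * a) + 1 / (2 * k) * d = s * sqrt d + s\<^sup>2 / 2"
      by (simp add: field_simps)
    then show ?thesis
      by (simp only: exp_add [symmetric])
  qed
  finally show ?thesis
    by (simp add: ennreal_leI)
qed

section \<open>The kernel of a Gaussian matrix\<close>

lemma gauss_space_eq: "gauss_space m N = gauss_PiM ({..<m} \<times> {..<N})"
  by (simp add: gauss_space_def atLeast0LessThan)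

text \<open>The normalisation \<open>1 / sqrt m\<close> of the matrix is left out, as it does not
  change the kernel.\<close>

definition quad :: "nat \<Rightarrow> nat \<Rightarrow> (nat \<times> nat \<Rightarrow> real) \<Rightarrow> (nat \<Rightarrow> real) \<Rightarrow> real" where
  "quad m N w x = (\<Sum>i<m. (\<Sum>j<N. w (i, j) * x j)\<^sup>2)"

lemma quad_nonneg: "0 \<le> quad m N w x"
  by (simp add: quad_def sum_nonneg)

lemma quad_eq_0_iff: "quad m N w x = 0 \<longleftrightarrow> (\<forall>i<m. (\<Sum>j<N. w (i, j) * x j) = 0)"
  unfolding quad_def by (subst sum_nonneg_eq_0_iff) auto

lemma quad_measurable:
  assumes "{..<m} \<times> {..<N} \<subseteq> I"
  shows "(\<lambda>w. quad m N w x) \<in> borel_measurable (gauss_PiM I)"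
  unfolding quad_def using assms
  by (intro borel_measurable_sum borel_measurable_power borel_measurable_times borel_measurable_const
      measurable_gauss_component) auto

lemma continuous_on_quad: "continuous_on A (quad m N w)"
  unfolding quad_def
  by (intro continuous_intros continuous_on_subset [OF continuous_on_product_coordinates]) auto

lemma quad_cong:
  assumes "\<And>c. c \<in> {..<m} \<times> {..<N} \<Longrightarrow> w c = w' c"
  shows "quad m N w x = quad m N w' x"
  unfolding quad_def using assms by (intro sum.cong refl arg_cong [where f = "\<lambda>u. u\<^sup>2"]) auto

text \<open>Continuity in the product topology, where \<open>quad\<close> involves finitely many
  coordinates. It lets a countable dense subset stand for a whole set.\<close>

lemma quad_closure_less:
  assumes "x \<in> closure D" "quad m N w x < b"
  shows "\<exists>y\<in>D. quad m N w y < b"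
proof -
  have "open (quad m N w -` {..<b})"
    by (intro open_vimage continuous_on_quad) simp
  moreover have "quad m N w -` {..<b} \<inter> closure D \<noteq> {}"
    using assms by auto
  ultimately have "quad m N w -` {..<b} \<inter> D \<noteq> {}"
    using open_Int_closure_eq_empty by blast
  then show ?thesis
    by auto
qed

text \<open>The corner entry is independent of the event, so its factor \<open>exp (s^2 / 2)\<close>
  can be divided out; on the other side \<open>R\<close> and the last column use different entries
  and separate. Letting \<beta> tend to infinity removes the cardinality of \<open>T\<close>, which
  makes the bound fit for infinite sets.\<close>

lemma gordon_finite:
  fixes T :: "(nat \<Rightarrow> real) set" and R :: "(nat \<times> nat \<Rightarrow> real) \<Rightarrow> real"
  assumes I_def: "I = {..<Suc m} \<times> {..<Suc N}"
    and T: "finite T" and unit: "\<And>x. x \<in> T \<Longrightarrow> (\<Sum>j<N. (x j)\<^sup>2) = 1"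
    and s: "0 < s" and \<eta>: "0 < \<eta>"
    and Rm: "R \<in> borel_measurable (gauss_PiM I)"
    and R_dep: "\<And>w w'. (\<And>j. j < N \<Longrightarrow> w (m, j) = w' (m, j)) \<Longrightarrow> R w = R w'"
    and R: "\<And>w x. x \<in> T \<Longrightarrow> (\<Sum>j<N. w (m, j) * x j) \<le> R w"
    and H: "(\<integral>\<^sup>+w. ennreal (exp (- s * sqrt (\<Sum>i<m. (w (i, N))\<^sup>2))) \<partial>gauss_PiM I) \<le> ennreal H" "0 \<le> H"
    and B: "(\<integral>\<^sup>+w. ennreal (exp (s * R w)) \<partial>gauss_PiM I) \<le> ennreal B" "0 \<le> B"
  shows "measure (gauss_space m N) {w \<in> space (gauss_space m N). \<exists>x\<in>T. quad m N w x \<le> \<eta>\<^sup>2}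
    \<le> exp (2 * s * \<eta> - s\<^sup>2 / 2) * H * B"
proof (cases "T = {}")
  case True
  then show ?thesis
    using H B by simp
next
  case False
  define A where "A = {..<m} \<times> {..<N}"
  have finI: "finite I" and AI: "A \<subseteq> I"
    by (auto simp: I_def A_def)
  define E where "E = {w. \<exists>x\<in>T. quad m N w x \<le> \<eta>\<^sup>2}"
  define p where "p = measure (gauss_PiM A) {w \<in> space (gauss_PiM A). w \<in> E}"
  have Esets: "{w \<in> space (gauss_PiM J). w \<in> E} \<in> sets (gauss_PiM J)" if "A \<subseteq> J" for J
    unfolding E_def mem_Collect_eq
    by (intro sets.sets_Collect_finite_Ex T borel_measurable_le quad_measurable borel_measurable_const
        that [unfolded A_def])
  have Eind: "(indicator E :: _ \<Rightarrow> ennreal) \<in> borel_measurable (gauss_PiM I)"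
    using Esets [OF AI] by (intro borel_measurable_indicator') (simp add: Int_def conj_commute)
  have Econg: "w \<in> E \<longleftrightarrow> w' \<in> E" if "\<And>c. c \<in> A \<Longrightarrow> w c = w' c" for w w'
    using quad_cong [of m N w w'] that by (simp add: E_def A_def)
  have int_E: "(\<integral>\<^sup>+w. indicator E w \<partial>gauss_PiM I) = ennreal p"
  proof -
    have "(\<integral>\<^sup>+w. indicator E w \<partial>gauss_PiM I)
        = (\<integral>\<^sup>+w. indicator {w \<in> space (gauss_PiM A). w \<in> E} (restrict w A) \<partial>gauss_PiM I)"
    proof (intro nn_integral_cong)
      fix w :: "nat \<times> nat \<Rightarrow> real"
      have "restrict w A \<in> space (gauss_PiM A)"
        by (auto simp: space_PiM)
      then show "indicator E w = (indicator {w \<in> space (gauss_PiM A). w \<in> E} (restrict w A) :: ennreal)"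
        using Econg [of w "restrict w A"] by (simp add: indicator_def)
    qed
    also have "\<dots> = (\<integral>\<^sup>+w. indicator {w \<in> space (gauss_PiM A). w \<in> E} w \<partial>gauss_PiM A)"
      by (intro nn_integral_gauss_PiM_restrict finI AI borel_measurable_indicator Esets) simp
    also have "\<dots> = emeasure (gauss_PiM A) {w \<in> space (gauss_PiM A). w \<in> E}"
      by (rule nn_integral_indicator [OF Esets]) simp
    also have "\<dots> = ennreal p"
      unfolding p_def by (rule gauss_prod.emeasure_eq_measure)
    finally show ?thesis .
  qed
  have lin: "(\<integral>\<^sup>+w. ennreal (exp (- s * w (m, N))) \<partial>gauss_PiM I) = ennreal (exp (s\<^sup>2 / 2))"
    using nn_integral_gauss_PiM_prod [OF finI, of "{(m, N)}" "\<lambda>_ u. ennreal (exp (- s * u))"]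
    using nn_integral_gauss_exp_linear [of s] by (simp add: I_def)
  have lhs: "(\<integral>\<^sup>+w. indicator E w * ennreal (exp (- s * w (m, N))) \<partial>gauss_PiM I) = ennreal (p * exp (s\<^sup>2 / 2))"
  proof -
    have m: "(\<lambda>w. ennreal (exp (- s * w (m, N)))) \<in> borel_measurable (gauss_PiM I)"
      by (intro measurable_compose [OF measurable_gauss_component, of _ _ "\<lambda>u. ennreal (exp (- s * u))"])
        (auto simp: I_def)
    have "(\<integral>\<^sup>+w. indicator E w * ennreal (exp (- s * w (m, N))) \<partial>gauss_PiM I)
        = (\<integral>\<^sup>+w. indicator E w \<partial>gauss_PiM I) * (\<integral>\<^sup>+w. ennreal (exp (- s * w (m, N))) \<partial>gauss_PiM I)"
    proof (rule nn_integral_gauss_PiM_mult [OF finI AI Eind m])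
      show "indicator E w = (indicator E w' :: ennreal)" if "\<And>c. c \<in> A \<Longrightarrow> w c = w' c" for w w'
        using Econg [OF that] by (simp add: indicator_def)
      show "ennreal (exp (- s * w (m, N))) = ennreal (exp (- s * w' (m, N)))"
        if "\<And>c. c \<in> I - A \<Longrightarrow> w c = w' c" for w w' :: "nat \<times> nat \<Rightarrow> real"
        using that [of "(m, N)"] by (simp add: I_def A_def)
    qed
    then show ?thesis
      unfolding int_E lin by (simp add: ennreal_mult' p_def)
  qed
  have rhs: "(\<integral>\<^sup>+w. ennreal (exp (- s * sqrt (\<Sum>i<m. (w (i, N))\<^sup>2))) * ennreal (exp (s * R w)) \<partial>gauss_PiM I)
      \<le> ennreal (H * B)"
  proof -
    have h: "(\<lambda>w. \<Sum>i<m. (w (i, N))\<^sup>2) \<in> borel_measurable (gauss_PiM I)"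
      by (intro borel_measurable_sum borel_measurable_power measurable_gauss_component) (auto simp: I_def)
    have "(\<integral>\<^sup>+w. ennreal (exp (- s * sqrt (\<Sum>i<m. (w (i, N))\<^sup>2))) * ennreal (exp (s * R w)) \<partial>gauss_PiM I)
        = (\<integral>\<^sup>+w. ennreal (exp (- s * sqrt (\<Sum>i<m. (w (i, N))\<^sup>2))) \<partial>gauss_PiM I)
          * (\<integral>\<^sup>+w. ennreal (exp (s * R w)) \<partial>gauss_PiM I)"
    proof (rule nn_integral_gauss_PiM_mult [OF finI, of "{..<m} \<times> {N}"])
      show "(\<lambda>w. ennreal (exp (- s * sqrt (\<Sum>i<m. (w (i, N))\<^sup>2)))) \<in> borel_measurable (gauss_PiM I)"
        by (rule measurable_compose [OF h, of "\<lambda>u. ennreal (exp (- s * sqrt u))"]) simp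
      show "(\<lambda>w. ennreal (exp (s * R w))) \<in> borel_measurable (gauss_PiM I)"
        by (rule measurable_compose [OF Rm, of "\<lambda>u. ennreal (exp (s * u))"]) simp
      show "ennreal (exp (- s * sqrt (\<Sum>i<m. (w (i, N))\<^sup>2))) = ennreal (exp (- s * sqrt (\<Sum>i<m. (w' (i, N))\<^sup>2)))"
        if "\<And>c. c \<in> {..<m} \<times> {N} \<Longrightarrow> w c = w' c" for w w' :: "nat \<times> nat \<Rightarrow> real"
        using that by simp
      show "ennreal (exp (s * R w)) = ennreal (exp (s * R w'))"
        if "\<And>c. c \<in> I - {..<m} \<times> {N} \<Longrightarrow> w c = w' c" for w w'
        using R_dep [of w w'] that by (simp add: I_def)
    qed (auto simp: I_def)
    also have "\<dots> \<le> ennreal H * ennreal B"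
      by (intro mult_mono H B) auto
    finally show ?thesis
      using H by (simp add: ennreal_mult')
  qed
  define k where "k n = real (card T) powr inverse (real (Suc n))" for n
  have "p * exp (s\<^sup>2 / 2) \<le> exp (2 * s * \<eta>) * k n * (H * B)" for n
  proof -
    \<comment> \<open>This \<beta> makes \<open>K\<close> the root of order n + 1 of the
      cardinality. The smoothing \<delta> is set equal to the threshold
      \<open>\<eta>\<^sup>2\<close>, at the cost
      \<open>sqrt (2 * \<eta>\<^sup>2) \<le> 2 * \<eta>\<close>.\<close>
    interpret gordon_interpolation m N T s "s * real (Suc n)" "\<eta>\<^sup>2"
      using T False unit s \<eta> by unfold_locales (auto simp: mult_le_cancel_left1)
    have IX: "IX = I"
      by (simp add: IX_def I_def)
    have K: "K = k n"
      using s by (simp add: K_def k_def inverse_eq_divide del: of_nat_Suc)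
    have sq: "sqrt (\<eta>\<^sup>2 + \<eta>\<^sup>2) \<le> 2 * \<eta>"
      using \<eta> by (intro real_le_lsqrt) (auto simp: power2_eq_square)
    have "ennreal (p * exp (s\<^sup>2 / 2)) \<le> ennreal (exp (s * sqrt (\<eta>\<^sup>2 + \<eta>\<^sup>2)) * k n) * ennreal (H * B)"
      using order_trans [OF nn_integral_comparison [of R "\<eta>\<^sup>2", unfolded IX K, OF Rm R] mult_left_mono [OF rhs]]
      unfolding lhs [symmetric] E_def quad_def by simp
    also have "\<dots> = ennreal (exp (s * sqrt (\<eta>\<^sup>2 + \<eta>\<^sup>2)) * k n * (H * B))"
      by (rule ennreal_mult' [symmetric]) (simp add: k_def)
    finally have "p * exp (s\<^sup>2 / 2) \<le> exp (s * sqrt (\<eta>\<^sup>2 + \<eta>\<^sup>2)) * k n * (H * B)"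
      using H B by (subst (asm) ennreal_le_iff) (auto simp: k_def)
    also have "\<dots> \<le> exp (2 * s * \<eta>) * k n * (H * B)"
      using sq s H B mult_left_mono [OF sq, of s] by (intro mult_right_mono) (auto simp: k_def)
    finally show ?thesis .
  qed
  moreover have "(\<lambda>n. exp (2 * s * \<eta>) * k n * (H * B)) \<longlonglongrightarrow> exp (2 * s * \<eta>) * 1 * (H * B)"
  proof (intro tendsto_intros)
    have "0 < card T"
      using T False by (simp add: card_gt_0_iff)
    then have "(\<lambda>n. real (card T) powr inverse (real (Suc n))) \<longlonglongrightarrow> real (card T) powr 0"
      by (intro tendsto_powr tendsto_const LIMSEQ_inverse_real_of_nat) simp
    then show "k \<longlonglongrightarrow> 1"
      using \<open>0 < card T\<close> by (simp add: k_def [abs_def])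
  qed
  ultimately have "p * exp (s\<^sup>2 / 2) \<le> exp (2 * s * \<eta>) * 1 * (H * B)"
    by (intro LIMSEQ_le_const) auto
  then have "p * exp (s\<^sup>2 / 2) * exp (- (s\<^sup>2 / 2)) \<le> exp (2 * s * \<eta>) * 1 * (H * B) * exp (- (s\<^sup>2 / 2))"
    by (rule mult_right_mono) simp
  moreover have "p * exp (s\<^sup>2 / 2) * exp (- (s\<^sup>2 / 2)) = p"
    unfolding mult.assoc exp_add [symmetric] by simp
  moreover have "exp (2 * s * \<eta> - s\<^sup>2 / 2) = exp (2 * s * \<eta>) * exp (- (s\<^sup>2 / 2))"
    unfolding exp_add [symmetric] by simp
  ultimately have "p \<le> exp (2 * s * \<eta> - s\<^sup>2 / 2) * H * B"
    by (simp only: mult_ac mult_1_left)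
  then show ?thesis
    by (simp add: p_def E_def A_def gauss_space_eq)
qed

text \<open>A kernel vector in \<open>S\<close> need not belong to the countable dense set
  \<open>D\<close>, but some point of \<open>D\<close> has \<open>quad\<close> below
  \<open>\<eta>\<^sup>2\<close>; this is why \<open>gordon_finite\<close> treats a relaxed event.
  Finite subsets exhaust \<open>D\<close>, and then \<eta> tends to 0.\<close>

lemma gordon_null_space:
  fixes S :: "(nat \<Rightarrow> real) set" and R :: "(nat \<times> nat \<Rightarrow> real) \<Rightarrow> real"
  assumes I_def: "I = {..<Suc m} \<times> {..<Suc N}"
    and unit: "\<And>x. x \<in> S \<Longrightarrow> (\<Sum>j<N. (x j)\<^sup>2) = 1"
    and s: "0 < s"
    and Rm: "R \<in> borel_measurable (gauss_PiM I)"
    and R_dep: "\<And>w w'. (\<And>j. j < N \<Longrightarrow> w (m, j) = w' (m, j)) \<Longrightarrow> R w = R w'"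
    and R: "\<And>w x. x \<in> S \<Longrightarrow> (\<Sum>j<N. w (m, j) * x j) \<le> R w"
    and H: "(\<integral>\<^sup>+w. ennreal (exp (- s * sqrt (\<Sum>i<m. (w (i, N))\<^sup>2))) \<partial>gauss_PiM I) \<le> ennreal H" "0 \<le> H"
    and B: "(\<integral>\<^sup>+w. ennreal (exp (s * R w)) \<partial>gauss_PiM I) \<le> ennreal B" "0 \<le> B"
  shows "measure (gauss_space m N) {w \<in> space (gauss_space m N). \<exists>x\<in>S. quad m N w x = 0}
    \<le> exp (- s\<^sup>2 / 2) * H * B"
proof (cases "S = {}")
  case True
  then show ?thesis
    using H B by simp
next
  case False
  let ?M = "gauss_space m N"
  interpret M: prob_space ?M
    unfolding gauss_space_eq by (rule gauss_prod.prob_space_axioms)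
  obtain D where D: "countable D" "D \<subseteq> S" "S \<subseteq> closure D"
    by (rule separable)
  have D_ne: "D \<noteq> {}"
    using D False by auto
  define d where "d = from_nat_into D"
  have dD: "range d = D"
    unfolding d_def using D D_ne by (intro range_from_nat_into)
  have *: "measure ?M {w \<in> space ?M. \<exists>x\<in>S. quad m N w x = 0} \<le> exp (2 * s * \<eta> - s\<^sup>2 / 2) * H * B"
    if \<eta>: "0 < \<eta>" for \<eta>
  proof -
    define E where "E n = {w \<in> space ?M. \<exists>x\<in>d ` {..n}. quad m N w x \<le> \<eta>\<^sup>2}" for n
    have Esets: "E n \<in> sets ?M" for n
      unfolding E_def gauss_space_eq
      by (intro sets.sets_Collect_finite_Ex borel_measurable_le quad_measurable borel_measurable_const) auto
    have "incseq E"
      unfolding E_def incseq_def by fastforce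
    then have lim: "(\<lambda>n. measure ?M (E n)) \<longlonglongrightarrow> measure ?M (\<Union>n. E n)"
      using Esets by (intro M.finite_Lim_measure_incseq) auto
    have "{w \<in> space ?M. \<exists>x\<in>S. quad m N w x = 0} \<subseteq> (\<Union>n. E n)"
    proof safe
      fix w x assume w: "w \<in> space ?M" and x: "x \<in> S" "quad m N w x = 0"
      obtain y where y: "y \<in> D" "quad m N w y < \<eta>\<^sup>2"
        using quad_closure_less [of x D m N w "\<eta>\<^sup>2"] x \<eta> D by auto
      then obtain n where "y = d n"
        using dD by auto
      then have "w \<in> E n"
        using w y by (auto simp: E_def intro: less_imp_le)
      then show "w \<in> (\<Union>n. E n)"
        by blast
    qed
    then have "measure ?M {w \<in> space ?M. \<exists>x\<in>S. quad m N w x = 0} \<le> measure ?M (\<Union>n. E n)"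
      using Esets by (intro M.finite_measure_mono) auto
    also have "\<dots> \<le> exp (2 * s * \<eta> - s\<^sup>2 / 2) * H * B"
    proof (rule LIMSEQ_le_const2 [OF lim], intro exI allI impI)
      fix n
      have dS: "x \<in> S" if "x \<in> d ` {..n}" for x
        using that dD D(2) by auto
      show "measure ?M (E n) \<le> exp (2 * s * \<eta> - s\<^sup>2 / 2) * H * B"
        unfolding E_def
        by (rule gordon_finite [OF I_def _ unit s \<eta> Rm R_dep R H B])
          (auto intro: dS)
    qed
    finally show ?thesis .
  qed
  have "(\<lambda>n. exp (2 * s * inverse (real (Suc n)) - s\<^sup>2 / 2) * H * B) \<longlonglongrightarrow> exp (2 * s * 0 - s\<^sup>2 / 2) * H * B"
    by (intro tendsto_intros LIMSEQ_inverse_real_of_nat)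
  moreover have "measure ?M {w \<in> space ?M. \<exists>x\<in>S. quad m N w x = 0}
      \<le> exp (2 * s * inverse (real (Suc n)) - s\<^sup>2 / 2) * H * B" for n
    by (rule *) simp
  ultimately show ?thesis
    using LIMSEQ_le_const by fastforce
qed

text \<open>Reduction to countable quantifiers: on a compact set the infimum of \<open>quad\<close>
  is attained, so a zero exists as soon as \<open>D\<close> contains points with arbitrarily small
  \<open>quad\<close>.\<close>

lemma null_space_event_measurable:
  assumes S: "compact S"
  shows "{w \<in> space (gauss_space m N). \<exists>x\<in>S. quad m N w x = 0} \<in> sets (gauss_space m N)"
proof (cases "S = {}")
  case True
  then show ?thesis by simp
next
  case False
  let ?M = "gauss_space m N"
  obtain D where D: "countable D" "D \<subseteq> S" "S \<subseteq> closure D"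
    by (rule separable)
  have "{w \<in> space ?M. \<exists>x\<in>S. quad m N w x = 0}
      = {w \<in> space ?M. \<forall>n. \<exists>x\<in>D. quad m N w x \<le> inverse (real (Suc n))}"
  proof (intro Collect_cong conj_cong refl iffI allI)
    fix w n assume "\<exists>x\<in>S. quad m N w x = 0"
    then obtain x where x: "x \<in> S" "quad m N w x = 0"
      by blast
    have "x \<in> closure D" "quad m N w x < inverse (real (Suc n))"
      using x D by auto
    then show "\<exists>x\<in>D. quad m N w x \<le> inverse (real (Suc n))"
      using quad_closure_less less_imp_le by blast
  next
    fix w assume *: "\<forall>n. \<exists>x\<in>D. quad m N w x \<le> inverse (real (Suc n))"
    obtain x where x: "x \<in> S" "\<And>y. y \<in> S \<Longrightarrow> quad m N w x \<le> quad m N w y"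
      using continuous_attains_inf [OF S False continuous_on_quad] by blast
    have "quad m N w x \<le> inverse (real (Suc n))" for n
      using * D(2) x(2) order_trans by blast
    then have "quad m N w x \<le> 0"
      by (intro LIMSEQ_le_const [OF LIMSEQ_inverse_real_of_nat]) blast
    with x(1) quad_nonneg [of m N w x] show "\<exists>x\<in>S. quad m N w x = 0"
      by (intro bexI [of _ x]) auto
  qed
  also have "\<dots> \<in> sets ?M"
    unfolding gauss_space_eq
    by (intro sets.sets_Collect_countable_All sets.sets_Collect_countable_Ex' D borel_measurable_le quad_measurable
        borel_measurable_const order_refl)
  finally show ?thesis .
qed

section \<open>The descent cone\<close>

text \<open>For large \<open>s\<close> the concentration bound blows up, whereas this one decays
  with one power of \<open>s\<close> per coordinate. The Euclidean norm dominates the average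
  absolute value, so the integral factors.\<close>

lemma nn_integral_exp_minus_gauss_norm_crude:
  assumes I: "finite I" "J \<subseteq> I" and J: "J \<noteq> {}" and s: "0 < s"
  shows "(\<integral>\<^sup>+w. ennreal (exp (- s * sqrt (\<Sum>c\<in>J. (w c)\<^sup>2))) \<partial>gauss_PiM I)
    \<le> ennreal ((real (card J) / s) ^ card J)"
proof -
  have finJ: "finite J"
    using I finite_subset by blast
  define n where "n = real (card J)"
  have n: "n > 0"
    using finJ J by (simp add: n_def card_gt_0_iff)
  have "(\<integral>\<^sup>+w. ennreal (exp (- s * sqrt (\<Sum>c\<in>J. (w c)\<^sup>2))) \<partial>gauss_PiM I)
      \<le> (\<integral>\<^sup>+w. (\<Prod>c\<in>J. ennreal (exp (- (s / n) * \<bar>w c\<bar>))) \<partial>gauss_PiM I)"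
  proof (rule nn_integral_mono)
    fix w :: "'a \<Rightarrow> real"
    have "(\<Sum>c\<in>J. \<bar>w c\<bar>) \<le> (\<Sum>c\<in>J. sqrt (\<Sum>c\<in>J. (w c)\<^sup>2))"
    proof (rule sum_mono)
      fix c assume "c \<in> J"
      then have "(w c)\<^sup>2 \<le> (\<Sum>c\<in>J. (w c)\<^sup>2)"
        by (intro member_le_sum [of c J "\<lambda>c. (w c)\<^sup>2"] finJ) auto
      then show "\<bar>w c\<bar> \<le> sqrt (\<Sum>c\<in>J. (w c)\<^sup>2)"
        by (intro real_le_rsqrt) simp
    qed
    then have "(\<Sum>c\<in>J. \<bar>w c\<bar>) \<le> n * sqrt (\<Sum>c\<in>J. (w c)\<^sup>2)"
      by (simp add: n_def)
    then have "s / n * (\<Sum>c\<in>J. \<bar>w c\<bar>) \<le> s / n * (n * sqrt (\<Sum>c\<in>J. (w c)\<^sup>2))"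
      using s n by (intro mult_left_mono) auto
    then have "- s * sqrt (\<Sum>c\<in>J. (w c)\<^sup>2) \<le> (\<Sum>c\<in>J. - (s / n) * \<bar>w c\<bar>)"
      using n by (simp add: sum_distrib_left [symmetric] sum_divide_distrib [symmetric] sum_negf)
    then have "exp (- s * sqrt (\<Sum>c\<in>J. (w c)\<^sup>2)) \<le> (\<Prod>c\<in>J. exp (- (s / n) * \<bar>w c\<bar>))"
      by (simp only: exp_sum [OF finJ, symmetric] exp_le_cancel_iff)
    then show "ennreal (exp (- s * sqrt (\<Sum>c\<in>J. (w c)\<^sup>2))) \<le> (\<Prod>c\<in>J. ennreal (exp (- (s / n) * \<bar>w c\<bar>)))"
      by (subst prod_ennreal) (auto intro: ennreal_leI)
  qed
  also have "\<dots> = (\<Prod>c\<in>J. \<integral>\<^sup>+u. ennreal (exp (- (s / n) * \<bar>u\<bar>)) \<partial>gauss)"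
    by (rule nn_integral_gauss_PiM_prod [OF I]) simp
  also have "\<dots> \<le> (\<Prod>c\<in>J. ennreal (1 / (s / n)))"
    using s n by (intro prod_mono_ennreal nn_integral_exp_minus_abs_le) simp
  also have "\<dots> = ennreal ((n / s) ^ card J)"
    using s n by (simp add: ennreal_power)
  finally show ?thesis
    by (simp add: n_def)
qed

lemma sum_mult_le_sqrt:
  fixes x y :: "nat \<Rightarrow> real"
  assumes "\<And>j. j < N \<Longrightarrow> z j \<le> \<bar>y j\<bar> * \<bar>x j\<bar>" "(\<Sum>j<N. (x j)\<^sup>2) = 1"
  shows "(\<Sum>j<N. z j) \<le> sqrt (\<Sum>j<N. (y j)\<^sup>2)"
proof -
  have "(\<Sum>j<N. z j) \<le> (\<Sum>j<N. \<bar>y j\<bar> * \<bar>x j\<bar>)"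
    using assms(1) by (intro sum_mono) auto
  also have "\<dots> \<le> sqrt (\<Sum>j<N. (y j)\<^sup>2) * sqrt (\<Sum>j<N. (x j)\<^sup>2)"
    using L2_set_mult_ineq [of y x "{..<N}"] by (simp add: L2_set_def)
  finally show ?thesis
    by (simp add: assms(2))
qed

lemma sum_last_row: "(\<Sum>c\<in>{m} \<times> {..<N}. f c) = (\<Sum>j<N. f (m, j))"
  by (simp add: sum.cartesian_product [symmetric, where g = "\<lambda>i j. f (i, j)", simplified])

lemma sum_last_column: "(\<Sum>c\<in>{..<m} \<times> {N}. f c) = (\<Sum>i<m. f (i, N))"
  by (simp add: sum.cartesian_product [symmetric, where g = "\<lambda>i j. f (i, j)", simplified])

lemma root_sum_squares_measurable:
  fixes \<psi> :: "nat \<Rightarrow> real \<Rightarrow> real"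
  assumes "\<And>j. \<psi> j \<in> borel_measurable borel"
  shows "(\<lambda>w. sqrt (\<Sum>j<N. (\<psi> j (w (m, j)))\<^sup>2)) \<in> borel_measurable (gauss_PiM ({..<Suc m} \<times> {..<Suc N}))"
  by (intro measurable_compose [OF _ borel_measurable_sqrt] borel_measurable_sum borel_measurable_power
      measurable_compose [OF measurable_gauss_component assms]) auto

text \<open>For large \<open>s\<close> the factors are of order \<open>exp (- s^2 / 2)\<close>,
  \<open>1 / s ^ m\<close> and \<open>exp (s^2 / 2) * s ^ N\<close>, so the product is at most a
  constant over \<open>s\<close>. Taking the full norm of g for \<open>R\<close> covers any set of
  unit vectors.\<close>

lemma null_space_tall:
  assumes mN: "N < m" and unit: "\<And>x. x \<in> S \<Longrightarrow> (\<Sum>j<N. (x j)\<^sup>2) = 1"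
  shows "measure (gauss_space m N) {w \<in> space (gauss_space m N). \<exists>x\<in>S. quad m N w x = 0} = 0" (is "?p = 0")
proof -
  define I where "I = {..<Suc m} \<times> {..<Suc N}"
  have I: "finite I" "{..<m} \<times> {N} \<subseteq> I" "{m} \<times> {..<N} \<subseteq> I"
    by (auto simp: I_def)
  define c where "c = exp 1 * real m ^ m"
  have *: "?p \<le> c / s" if s: "2 \<le> s" for s
  proof -
    \<comment> \<open>Makes the one-dimensional moment \<open>1 / sqrt (1 - 2 * a)\<close> equal to
      \<open>s\<close>.\<close>
    define a where "a = (1 - 1 / s\<^sup>2) / 2"
    have s2: "s\<^sup>2 \<ge> 4"
      using power_mono [OF s, of 2] by simp
    have a: "0 < a" "a < 1 / 2" and a1: "1 - 2 * a = 1 / s\<^sup>2"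
      using s s2 by (auto simp: a_def field_simps)
    have H: "(\<integral>\<^sup>+w. ennreal (exp (- s * sqrt (\<Sum>i<m. (w (i, N))\<^sup>2))) \<partial>gauss_PiM I) \<le> ennreal ((real m / s) ^ m)"
      using nn_integral_exp_minus_gauss_norm_crude [OF I(1,2), of s] mN s
      by (simp add: sum_last_column card_cartesian_product lessThan_empty_iff)
    have b: "(\<integral>\<^sup>+u. ennreal (exp (a * u\<^sup>2)) \<partial>gauss) \<le> ennreal s"
    proof -
      have "has_bochner_integral gauss (\<lambda>u. exp (a * u\<^sup>2)) s"
        using gauss_exp_square [OF a(2), of 0] s unfolding a1 by (simp add: real_sqrt_divide)
      then show ?thesis
        by (subst nn_integral_eq_integral) (auto simp: has_bochner_integral_iff)
    qed
    have B: "(\<integral>\<^sup>+w. ennreal (exp (s * sqrt (\<Sum>j<N. (w (m, j))\<^sup>2))) \<partial>gauss_PiM I)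
        \<le> ennreal (exp (s\<^sup>2 / (4 * a)) * s ^ N)"
      using nn_integral_exp_root_sum_squares_le [OF I(1,3) a(1), of "\<lambda>_ u. u" "\<lambda>_. s" s] b s
      by (simp add: sum_last_row card_cartesian_product)
    have "?p \<le> exp (- s\<^sup>2 / 2) * (real m / s) ^ m * (exp (s\<^sup>2 / (4 * a)) * s ^ N)"
    proof (rule gordon_null_space [OF I_def, where R = "\<lambda>w. sqrt (\<Sum>j<N. (w (m, j))\<^sup>2)"])
      show "(\<lambda>w. sqrt (\<Sum>j<N. (w (m, j))\<^sup>2)) \<in> borel_measurable (gauss_PiM I)"
        unfolding I_def by (rule root_sum_squares_measurable [of "\<lambda>_ u. u"]) simp
      show "(\<Sum>j<N. w (m, j) * x j) \<le> sqrt (\<Sum>j<N. (w (m, j))\<^sup>2)" if "x \<in> S" for w x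
        using sum_mult_le_sqrt [OF _ unit [OF that], of "\<lambda>j. w (m, j) * x j" "\<lambda>j. w (m, j)"]
        by (simp add: abs_mult [symmetric])
    qed (use H B s unit in auto)
    also have "s\<^sup>2 / (4 * a) \<le> s\<^sup>2 / 2 + 1"
    proof -
      have "s\<^sup>2 \<le> (s\<^sup>2 / 2 + 1) * (4 * a)"
        using s s2 by (simp add: a_def field_simps)
      then show ?thesis
        using a by (simp add: divide_le_eq)
    qed
    also have "exp (- s\<^sup>2 / 2) * (real m / s) ^ m * (exp (s\<^sup>2 / 2 + 1) * s ^ N) = c * (s ^ N / s ^ m)"
      by (simp add: c_def exp_add exp_minus power_divide)
    also have "s ^ N / s ^ m \<le> 1 / s"
    proof -
      have "s ^ Suc N \<le> s ^ m"
        using s mN by (intro power_increasing) auto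
      then show ?thesis
        using s by (simp add: field_simps)
    qed
    finally show ?thesis
      using s by (simp add: c_def mult_left_mono)
  qed
  have "(\<lambda>n. c * inverse (real (Suc n))) \<longlonglongrightarrow> c * 0"
    by (intro tendsto_intros LIMSEQ_inverse_real_of_nat)
  moreover have "?p \<le> c * inverse (real (Suc n))" if "n \<ge> 1" for n
    using * [of "real (Suc n)"] that by (simp add: divide_inverse)
  ultimately have "?p \<le> c * 0"
    by (intro LIMSEQ_le_const) auto
  then show ?thesis
    by (simp add: measure_le_0_iff)
qed

text \<open>Unit directions feasible at \<open>x0\<close> that do not increase the norm. The upper
  box constraint is active on the top level and the lower one off the support; intermediate levels
  are free. On the box the l1 norm is the coordinate sum.\<close>

definition descent_section :: "nat \<Rightarrow> nat set \<Rightarrow> nat set \<Rightarrow> (nat \<Rightarrow> real) set" where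
  "descent_section N K KL = {x. (\<forall>j. j \<ge> N \<longrightarrow> x j = 0) \<and> (\<Sum>j<N. (x j)\<^sup>2) = 1
     \<and> (\<forall>j. j \<in> KL \<longrightarrow> x j \<le> 0) \<and> (\<forall>j. j \<notin> K \<longrightarrow> 0 \<le> x j) \<and> (\<Sum>j<N. x j) \<le> 0}"

lemma compact_descent_section: "compact (descent_section N K KL)"
proof -
  define C where "C = PiE UNIV (\<lambda>j. if j < N then {-1..1::real} else {0})"
  have "compactin (product_topology (\<lambda>_. euclidean) UNIV) C"
    unfolding C_def by (subst compactin_PiE) (auto simp: compactin_euclidean_iff)
  then have C: "compact C"
    by (simp add: euclidean_product_topology compactin_euclidean_iff)
  have cont: "continuous_on UNIV (\<lambda>x. x j)" for j :: nat
    by simp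
  have "closed (descent_section N K KL)"
    unfolding descent_section_def
    by (intro closed_Collect_conj closed_Collect_all closed_Collect_imp closed_Collect_eq closed_Collect_le
        open_Collect_const continuous_intros cont)
  moreover have "descent_section N K KL \<subseteq> C"
  proof
    fix x assume x: "x \<in> descent_section N K KL"
    have "x j \<in> (if j < N then {-1..1} else {0})" for j
    proof (cases "j < N")
      case True
      then have "(x j)\<^sup>2 \<le> (\<Sum>j<N. (x j)\<^sup>2)"
        by (intro member_le_sum [of j "{..<N}" "\<lambda>j. (x j)\<^sup>2"]) auto
      then have "\<bar>x j\<bar> \<le> 1"
        using x by (simp add: descent_section_def abs_square_le_1)
      with True show ?thesis
        by (simp add: abs_le_iff) 
    qed (use x in \<open>simp add: descent_section_def\<close>)
    then show "x \<in> C"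
      unfolding C_def by (intro PiE_I) auto
  qed
  ultimately show ?thesis
    using C by (metis compact_Int_closed inf.absorb_iff2)
qed

text \<open>The number \<open>d\<close> is kept apart from the functional of \<tau> because the
  infimum may be 0 or not attained, whereas \<open>s\<close> and \<open>sqrt d / s\<close> have to
  be positive.\<close>

lemma null_space_descent_section_le:
  fixes N m :: nat
  assumes KL: "KL \<subseteq> K" and K: "K \<subseteq> {0..<N}" and t: "0 \<le> \<tau>" and d: "0 < d" "d < real m"
    and delta: "real (card (K - KL)) * (1 + \<tau>\<^sup>2) + real (card KL) * (LBINT u:{..\<tau>}. (u - \<tau>)\<^sup>2 * phi u)
      + real (N - card K) * (LBINT u:{\<tau>..}. (u - \<tau>)\<^sup>2 * phi u) \<le> d"
  shows "measure (gauss_space m N)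
      {w \<in> space (gauss_space m N). \<exists>x\<in>descent_section N K KL. quad m N w x = 0}
    \<le> 3 * exp (- (sqrt (real m) - sqrt d)\<^sup>2 / 2)"
proof -
  define I where "I = {..<Suc m} \<times> {..<Suc N}"
  have I: "finite I" "{..<m} \<times> {N} \<subseteq> I" "{m} \<times> {..<N} \<subseteq> I"
    by (auto simp: I_def)
  define s where "s = sqrt (real m) - sqrt d"
  have s: "0 < s"
    using d by (simp add: s_def)
  define \<psi> where "\<psi> j u = (if j \<in> KL then max 0 (\<tau> - u) else if j \<in> K then u - \<tau> else max 0 (u - \<tau>))" for j and u :: real
  define e where "e j = (if j \<in> KL then (LBINT u:{..\<tau>}. (u - \<tau>)\<^sup>2 * phi u)
    else if j \<in> K then 1 + \<tau>\<^sup>2 else (LBINT u:{\<tau>..}. (u - \<tau>)\<^sup>2 * phi u))" for j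
  have \<psi>m: "\<psi> j \<in> borel_measurable borel" for j
    unfolding \<psi>_def [abs_def] by (cases "j \<in> KL"; cases "j \<in> K") simp_all
  have finK: "finite K" "finite KL"
    using finite_subset [OF K] finite_subset [OF KL] by auto
  have "(\<Sum>j<N. e j) = (\<Sum>j\<in>KL. e j) + (\<Sum>j\<in>K - KL. e j) + (\<Sum>j\<in>{..<N} - K. e j)"
    using sum.subset_diff [of K "{..<N}" e] sum.subset_diff [of KL K e] K KL finK
    by (simp add: atLeast0LessThan)
  also have "(\<Sum>j\<in>KL. e j) = real (card KL) * (LBINT u:{..\<tau>}. (u - \<tau>)\<^sup>2 * phi u)"
    by (simp add: e_def)
  also have "(\<Sum>j\<in>K - KL. e j) = real (card (K - KL)) * (1 + \<tau>\<^sup>2)"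
    by (simp add: e_def)
  also have "(\<Sum>j\<in>{..<N} - K. e j) = (\<Sum>j\<in>{..<N} - K. LBINT u:{\<tau>..}. (u - \<tau>)\<^sup>2 * phi u)"
    using KL by (intro sum.cong) (auto simp: e_def)
  also have "\<dots> = real (N - card K) * (LBINT u:{\<tau>..}. (u - \<tau>)\<^sup>2 * phi u)"
    using K finK by (simp add: card_Diff_subset atLeast0LessThan)
  finally have sum_e: "(\<Sum>c\<in>{m} \<times> {..<N}. e (snd c)) \<le> d"
    using delta by (simp add: sum_last_row)
  have mgf: "(\<integral>\<^sup>+u. ennreal (exp (a * (\<psi> j u)\<^sup>2)) \<partial>gauss) \<le> ennreal (exp (a / (1 - 2 * a) * e j))"
    if "0 \<le> a" "a < 1 / 2" for a j
    using nn_integral_exp_lower_part_le [OF that, of \<tau>] nn_integral_exp_upper_part_le [OF that, of \<tau>]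
      nn_integral_exp_square_le [OF that, of \<tau>]
    unfolding \<psi>_def e_def by (cases "j \<in> KL"; cases "j \<in> K") simp_all
  have B: "(\<integral>\<^sup>+w. ennreal (exp (s * sqrt (\<Sum>j<N. (\<psi> j (w (m, j)))\<^sup>2))) \<partial>gauss_PiM I)
      \<le> ennreal (exp (s * sqrt d + s\<^sup>2 / 2))"
    using nn_integral_exp_root_sum_squares_concentration
      [OF I(1,3) s d(1) sum_e, where \<psi> = "\<lambda>c. \<psi> (snd c)", OF \<psi>m mgf]
    by (simp add: sum_last_row)
  have H: "(\<integral>\<^sup>+w. ennreal (exp (- s * sqrt (\<Sum>i<m. (w (i, N))\<^sup>2))) \<partial>gauss_PiM I)
      \<le> ennreal (3 * exp (- s * sqrt (real m) + s\<^sup>2 / 2))"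
    using nn_integral_exp_minus_gauss_norm_le [OF I(1,2), of s] s
    by (simp add: sum_last_column card_cartesian_product)
  have "measure (gauss_space m N) {w \<in> space (gauss_space m N). \<exists>x\<in>descent_section N K KL. quad m N w x = 0}
    \<le> exp (- s\<^sup>2 / 2) * (3 * exp (- s * sqrt (real m) + s\<^sup>2 / 2)) * exp (s * sqrt d + s\<^sup>2 / 2)"
  proof (rule gordon_null_space [OF I_def _ s _ _ _ H _ B])
    show "(\<lambda>w. sqrt (\<Sum>j<N. (\<psi> j (w (m, j)))\<^sup>2)) \<in> borel_measurable (gauss_PiM I)"
      unfolding I_def by (rule root_sum_squares_measurable [OF \<psi>m])
    fix w :: "nat \<times> nat \<Rightarrow> real" and x
    assume x: "x \<in> descent_section N K KL"
    have "(\<Sum>j<N. w (m, j) * x j) \<le> (\<Sum>j<N. w (m, j) * x j) - \<tau> * (\<Sum>j<N. x j)"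
      using x t by (simp add: descent_section_def mult_nonneg_nonpos)
    also have "\<dots> = (\<Sum>j<N. (w (m, j) - \<tau>) * x j)"
      by (simp add: sum_distrib_left left_diff_distrib sum_subtractf)
    also have "\<dots> \<le> sqrt (\<Sum>j<N. (\<psi> j (w (m, j)))\<^sup>2)"
    proof (rule sum_mult_le_sqrt)
      show "(\<Sum>j<N. (x j)\<^sup>2) = 1"
        using x by (simp add: descent_section_def)
      fix j
      show "(w (m, j) - \<tau>) * x j \<le> \<bar>\<psi> j (w (m, j))\<bar> * \<bar>x j\<bar>"
      proof -
        consider "j \<in> KL" "x j \<le> 0" | "j \<notin> KL" "j \<in> K" | "j \<notin> KL" "j \<notin> K" "0 \<le> x j"
          using x by (auto simp: descent_section_def)
        then show ?thesis
        proof cases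
          case 1
          then have "(w (m, j) - \<tau>) * x j = (\<tau> - w (m, j)) * \<bar>x j\<bar>"
            by (simp add: algebra_simps)
          also have "\<dots> \<le> max 0 (\<tau> - w (m, j)) * \<bar>x j\<bar>"
            by (intro mult_right_mono) auto
          finally show ?thesis
            using 1 by (simp add: \<psi>_def)
        next
          case 2
          then show ?thesis
            by (simp add: \<psi>_def abs_mult [symmetric])
        next
          case 3
          then have "(w (m, j) - \<tau>) * x j \<le> max 0 (w (m, j) - \<tau>) * \<bar>x j\<bar>"
            by (simp add: mult_right_mono)
          then show ?thesis
            using 3 by (simp add: \<psi>_def)
        qed
      qed
    qed
    finally show "(\<Sum>j<N. w (m, j) * x j) \<le> sqrt (\<Sum>j<N. (\<psi> j (w (m, j)))\<^sup>2)" .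
  qed (auto simp: descent_section_def)
  also have "\<dots> = 3 * (exp (- s\<^sup>2 / 2) * exp (- s * sqrt (real m) + s\<^sup>2 / 2) * exp (s * sqrt d + s\<^sup>2 / 2))"
    by simp
  also have "exp (- s\<^sup>2 / 2) * exp (- s * sqrt (real m) + s\<^sup>2 / 2) * exp (s * sqrt d + s\<^sup>2 / 2)
      = exp (- (sqrt (real m) - sqrt d)\<^sup>2 / 2)"
  proof -
    have "- s\<^sup>2 / 2 + (- s * sqrt (real m) + s\<^sup>2 / 2) + (s * sqrt d + s\<^sup>2 / 2) = - (s * (sqrt (real m) - sqrt d)) + s\<^sup>2 / 2"
      by (simp add: algebra_simps)
    also have "\<dots> = - s\<^sup>2 / 2"
      unfolding s_def [symmetric] by (simp add: power2_eq_square)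
    finally show ?thesis
      unfolding exp_add [symmetric] s_def [symmetric] by simp
  qed
  finally show ?thesis .
qed

text \<open>A kernel vector d of the section yields the competitor \<open>x0 + d\<close>, whose norm
  is no larger; conversely a competitor y yields the normalised difference y -
  \<open>x0\<close>.\<close>

lemma unique_l1_solution_iff:
  fixes K :: "nat \<Rightarrow> nat set" and A :: "nat \<Rightarrow> nat \<Rightarrow> real"
  assumes L: "1 \<le> L"
    and Ksub: "\<And>i. i \<in> {1..L} \<Longrightarrow> K i \<subseteq> {0..<N}"
    and Kdisj: "\<And>i j. i \<in> {1..L} \<Longrightarrow> j \<in> {1..L} \<Longrightarrow> i \<noteq> j \<Longrightarrow> K i \<inter> K j = {}"
  defines "x0 \<equiv> (\<lambda>j. \<Sum>i=1..L. real i * indicat_real (K i) j)"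
  shows "unique_l1_solution N (feasible m N A (matvec N A x0) (real L)) x0
    \<longleftrightarrow> \<not> (\<exists>x\<in>descent_section N (\<Union>i\<in>{1..L}. K i) (K L). \<forall>i<m. (\<Sum>j<N. A i j * x j) = 0)"
proof -
  define U where "U = (\<Union>i\<in>{1..L}. K i)"
  define F where "F = feasible m N A (matvec N A x0) (real L)"
  let ?S = "descent_section N U (K L)"
  have x0_in: "x0 j = real i" if "i \<in> {1..L}" "j \<in> K i" for i j
  proof -
    have "real l * indicat_real (K l) j = (if l = i then real i else 0)" if "l \<in> {1..L}" for l
      using Kdisj [of l i] \<open>i \<in> {1..L}\<close> \<open>j \<in> K i\<close> that by (auto simp: indicator_def)
    then have "x0 j = (\<Sum>l=1..L. if l = i then real i else 0)"
      unfolding x0_def by (intro sum.cong) auto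
    then show ?thesis
      using that by simp
  qed
  have x0_out: "x0 j = 0" if "j \<notin> U" for j
    using that unfolding x0_def U_def by (intro sum.neutral) auto
  have x0_L: "x0 j = real L" if "j \<in> K L" for j
    using x0_in [of L j] L that by simp
  have x0_mid: "1 \<le> x0 j \<and> x0 j \<le> real L - 1" if j: "j \<in> U" "j \<notin> K L" for j
  proof -
    obtain i where i: "i \<in> {1..L}" "j \<in> K i"
      using j by (auto simp: U_def)
    with j have "i \<noteq> L"
      by auto
    with i have "1 \<le> i" "i + 1 \<le> L"
      by auto
    with x0_in [OF i] show ?thesis
      by simp
  qed
  have x0_N: "x0 j = 0" if "N \<le> j" for j
    using that Ksub by (intro x0_out) (force simp: U_def)
  have x0_range: "0 \<le> x0 j \<and> x0 j \<le> real L" for j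
    using x0_out [of j] x0_L [of j] x0_mid [of j] L by (cases "j \<in> U"; cases "j \<in> K L") auto
  have x0_F: "x0 \<in> F"
    using x0_N x0_range by (simp add: F_def feasible_def)
  have l1: "l1norm N y = (\<Sum>j<N. y j)" if "y \<in> F" for y
    unfolding l1norm_def using that by (intro sum.cong) (auto simp: F_def feasible_def)
  have mv: "matvec N A (\<lambda>j. x0 j + d j) i = matvec N A x0 i + (\<Sum>j<N. A i j * d j)" for d i
    by (simp add: matvec_def distrib_left sum.distrib)
  show ?thesis
    unfolding F_def [symmetric] U_def [symmetric]
  proof
    assume uniq: "unique_l1_solution N F x0"
    show "\<not> (\<exists>x\<in>?S. \<forall>i<m. (\<Sum>j<N. A i j * x j) = 0)"
    proof
      assume "\<exists>x\<in>?S. \<forall>i<m. (\<Sum>j<N. A i j * x j) = 0"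
      then obtain d where d: "d \<in> ?S" "\<And>i. i < m \<Longrightarrow> (\<Sum>j<N. A i j * d j) = 0"
        by blast
      \<comment> \<open>The levels of \<open>x0\<close> are integers, so its intermediate
        coordinates lie between 1 and \<open>L - 1\<close> and a step of unit length stays in the
        box without being shortened.\<close>
      have d1: "- 1 \<le> d j \<and> d j \<le> 1" if "j < N" for j
      proof -
        have "(d j)\<^sup>2 \<le> (\<Sum>j<N. (d j)\<^sup>2)"
          using that by (intro member_le_sum [of j "{..<N}" "\<lambda>j. (d j)\<^sup>2"]) auto
        then have "\<bar>d j\<bar> \<le> 1"
          using d(1) by (simp add: descent_section_def abs_square_le_1)
        then show ?thesis
          by (simp add: abs_le_iff) 
      qed
      define y where "y j = x0 j + d j" for j
      have yF: "y \<in> F"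
        unfolding F_def feasible_def mem_Collect_eq
      proof (intro conjI allI impI)
        show "y j = 0" if "j \<ge> N" for j
          using x0_N [OF that] d(1) that by (simp add: y_def descent_section_def)
        show "matvec N A y i = matvec N A x0 i" if "i < m" for i
          using mv [of d i] d(2) [OF that] by (simp add: y_def [abs_def])
        fix j assume j: "j < N"
        have "(j \<in> K L \<longrightarrow> d j \<le> 0) \<and> (j \<notin> U \<longrightarrow> 0 \<le> d j)"
          using d(1) by (simp add: descent_section_def)
        then show "0 \<le> y j" "y j \<le> real L"
          using x0_out [of j] x0_L [of j] x0_mid [of j] d1 [OF j] L
          unfolding y_def by (cases "j \<in> K L"; cases "j \<in> U"; force)+
      qed
      have le: "l1norm N y \<le> l1norm N x0"
        using d(1) by (simp add: l1 yF x0_F y_def sum.distrib descent_section_def)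
      have "\<forall>z\<in>F. l1norm N x0 \<le> l1norm N z"
        using uniq unfolding unique_l1_solution_def by blast
      with le yF have "y \<in> {x \<in> F. \<forall>y\<in>F. l1norm N x \<le> l1norm N y}"
        by (auto intro: order_trans)
      then have "y = x0"
        using uniq unfolding unique_l1_solution_def by blast
      then have "d j = 0" for j
        by (metis add_cancel_left_right y_def)
      then show False
        using d(1) by (simp add: descent_section_def)
    qed
  next
    assume no: "\<not> (\<exists>x\<in>?S. \<forall>i<m. (\<Sum>j<N. A i j * x j) = 0)"
    have less: "l1norm N x0 < l1norm N y" if y: "y \<in> F" "y \<noteq> x0" for y
    proof (rule ccontr)
      assume "\<not> l1norm N x0 < l1norm N y"
      then have le: "(\<Sum>j<N. y j) \<le> (\<Sum>j<N. x0 j)"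
        by (simp add: l1 y x0_F)
      define d where "d j = y j - x0 j" for j
      have y0: "y j = 0" if "N \<le> j" for j
        using y that by (simp add: F_def feasible_def)
      obtain j where j: "y j \<noteq> x0 j"
        using y(2) by blast
      then have "j < N"
        using y0 x0_N by (metis not_le)
      then have "0 < (\<Sum>j<N. (d j)\<^sup>2)"
        using j by (intro sum_pos2 [of _ j]) (auto simp: d_def)
      define r where "r = sqrt (\<Sum>j<N. (d j)\<^sup>2)"
      have r: "0 < r" and r2: "r\<^sup>2 = (\<Sum>j<N. (d j)\<^sup>2)"
        using \<open>0 < (\<Sum>j<N. (d j)\<^sup>2)\<close> by (auto simp: r_def)
      have dS: "(\<lambda>j. d j / r) \<in> ?S"
        unfolding descent_section_def mem_Collect_eq
      proof (intro conjI allI impI)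
        show "d j / r = 0" if "N \<le> j" for j
          using y0 x0_N that by (simp add: d_def)
        show "(\<Sum>j<N. (d j / r)\<^sup>2) = 1"
          using r by (simp add: power_divide sum_divide_distrib [symmetric] r2 [symmetric])
        show "d j / r \<le> 0" if "j \<in> K L" for j
        proof -
          have "j < N"
            using that Ksub [of L] L by auto
          then show ?thesis
            using y(1) x0_L [OF that] r by (simp add: d_def F_def feasible_def divide_le_0_iff)
        qed
        show "0 \<le> d j / r" if "j \<notin> U" for j
        proof -
          have "0 \<le> y j"
            using y(1) y0 [of j] by (cases "j < N") (auto simp: F_def feasible_def)
          then show ?thesis
            using x0_out [OF that] r by (simp add: d_def)
        qed
        show "(\<Sum>j<N. d j / r) \<le> 0"
          using le r by (simp add: sum_divide_distrib [symmetric] d_def sum_subtractf divide_le_0_iff)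
      qed
      have "(\<Sum>j<N. A i j * (d j / r)) = 0" if "i < m" for i
      proof -
        have "matvec N A y i = matvec N A x0 i"
          using y(1) that by (simp add: F_def feasible_def)
        then have "(\<Sum>j<N. A i j * d j) = 0"
          by (simp add: matvec_def d_def right_diff_distrib sum_subtractf)
        then show ?thesis
          by (simp add: sum_divide_distrib [symmetric])
      qed
      then have "\<exists>x\<in>?S. \<forall>i<m. (\<Sum>j<N. A i j * x j) = 0"
        by (intro bexI [OF _ dS]) simp
      with no show False
        by contradiction
    qed
    show "unique_l1_solution N F x0"
      unfolding unique_l1_solution_def
    proof (intro equalityI subsetI)
      fix x assume x: "x \<in> {x \<in> F. \<forall>y\<in>F. l1norm N x \<le> l1norm N y}"
      then have "l1norm N x \<le> l1norm N x0"
        using x0_F by blast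
      then show "x \<in> {x0}"
        using less [of x] x by auto
    next
      fix x assume "x \<in> {x0}"
      moreover have "l1norm N x0 \<le> l1norm N y" if "y \<in> F" for y
        using less [OF that] by (cases "y = x0") auto
      ultimately show "x \<in> {x \<in> F. \<forall>y\<in>F. l1norm N x \<le> l1norm N y}"
        using x0_F by blast
    qed
  qed
qed

theorem theorem4p4:
  fixes \<epsilon> :: real and L N m :: nat and K :: "nat \<Rightarrow> nat set"
  assumes eps: "\<epsilon> > 0"
    and L: "L \<ge> 1"
    and Ksub: "\<And>i. i \<in> {1..L} \<Longrightarrow> K i \<subseteq> {0..<N}"
    and Kdisj: "\<And>i j. i \<in> {1..L} \<Longrightarrow> j \<in> {1..L} \<Longrightarrow> i \<noteq> j \<Longrightarrow> K i \<inter> K j = {}"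
    and bound: "real m \<ge>
      (INF \<tau>\<in>{0::real..}.
          real (card ((\<Union>i\<in>{1..L}. K i) - K L)) * (1 + \<tau>\<^sup>2)
        + real (card (K L)) * (LBINT u:{..\<tau>}. (u - \<tau>)\<^sup>2 * phi u)
        + real (N - card (\<Union>i\<in>{1..L}. K i)) * (LBINT u:{\<tau>..}. (u - \<tau>)\<^sup>2 * phi u))
      + sqrt (8 * ln (4 / \<epsilon>) * real N)"
  shows "measure (gauss_space m N)
      {a \<in> space (gauss_space m N).
         (let x0 = (\<lambda>j. \<Sum>i=1..L. real i * indicator (K i) j);
              A = gauss_matrix m a
          in unique_l1_solution N (feasible m N A (matvec N A x0) (real L)) x0)}
    > 1 - \<epsilon>"
proof (cases "1 < \<epsilon>")
  \<comment> \<open>Here \<open>ln (4 / \<epsilon>)\<close> may fail to be positive, but the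
    probability bound to be proved is negative.\<close>
  case True
  then have "1 - \<epsilon> < 0"
    by simp
  then show ?thesis
    by (rule less_le_trans) (rule measure_nonneg)
next
  case False
  define U where "U = (\<Union>i\<in>{1..L}. K i)"
  define x0 where "x0 = (\<lambda>j. \<Sum>i=1..L. real i * indicat_real (K i) j)"
  define S where "S = descent_section N U (K L)"
  define \<Delta> where "\<Delta> \<tau> = real (card (U - K L)) * (1 + \<tau>\<^sup>2)
        + real (card (K L)) * (LBINT u:{..\<tau>}. (u - \<tau>)\<^sup>2 * phi u)
        + real (N - card U) * (LBINT u:{\<tau>..}. (u - \<tau>)\<^sup>2 * phi u)" for \<tau>
  define d0 where "d0 = (INF \<tau>\<in>{0::real..}. \<Delta> \<tau>)"
  define t where "t = sqrt (8 * ln (4 / \<epsilon>))"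
  let ?M = "gauss_space m N"
  define F where "F = {w \<in> space ?M. \<exists>x\<in>S. quad m N w x = 0}"
  interpret M: prob_space ?M
    unfolding gauss_space_eq by (rule gauss_prod.prob_space_axioms)
  have Fsets: "F \<in> sets ?M"
    unfolding F_def S_def by (intro null_space_event_measurable compact_descent_section)
  have unit: "(\<Sum>j<N. (x j)\<^sup>2) = 1" if "x \<in> S" for x
    using that by (simp add: S_def descent_section_def)
  have KLU: "K L \<subseteq> U"
    using L by (auto simp: U_def)
  have UN: "U \<subseteq> {0..<N}"
    unfolding U_def by (intro UN_least Ksub)
  have success: "{a \<in> space ?M. unique_l1_solution N
      (feasible m N (gauss_matrix m a) (matvec N (gauss_matrix m a) x0) (real L)) x0} = space ?M - F"
  proof -
    \<comment> \<open>The scaling by \<open>1 / sqrt m\<close> is harmless for positive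
      \<open>m\<close>; for \<open>m = 0\<close> both sides hold trivially.\<close>
    have "(\<forall>i<m. (\<Sum>j<N. gauss_matrix m a i j * x j) = 0) \<longleftrightarrow> quad m N a x = 0" for a x
    proof -
      have "(\<Sum>j<N. gauss_matrix m a i j * x j) = (\<Sum>j<N. a (i, j) * x j) / sqrt (real m)" for i
        by (simp add: gauss_matrix_def sum_divide_distrib)
      then show ?thesis
        unfolding quad_eq_0_iff by auto
    qed
    then have "unique_l1_solution N (feasible m N (gauss_matrix m a) (matvec N (gauss_matrix m a) x0) (real L)) x0
        \<longleftrightarrow> \<not> (\<exists>x\<in>S. quad m N a x = 0)" for a
      using unique_l1_solution_iff [OF L Ksub Kdisj, where m = m and A = "gauss_matrix m a"]
      unfolding x0_def S_def U_def by simp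
    then show ?thesis
      by (auto simp: F_def)
  qed
  have "measure ?M F < \<epsilon>"
  proof (cases "N = 0")
    \<comment> \<open>The margin in the hypothesis vanishes, but dimension 0 has no unit
      vectors.\<close>
    case True
    then have "F = {}"
      using unit by (auto simp: F_def)
    then show ?thesis
      using eps by simp
  next
    case N: False
    show ?thesis
    proof (cases "N < m")
      case True
      have "measure ?M F = 0"
        unfolding F_def by (rule null_space_tall [OF True unit])
      then show ?thesis
        using eps by simp
    next
      case mN: False
      have \<Delta>_nonneg: "0 \<le> \<Delta> \<tau>" for \<tau>
        unfolding \<Delta>_def LBINT_lower_moment LBINT_upper_moment
        by (intro add_nonneg_nonneg mult_nonneg_nonneg half_moment_nonneg) auto
      have d0: "0 \<le> d0"
        unfolding d0_def by (intro cINF_greatest \<Delta>_nonneg) simp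
      have "ln 4 \<le> ln (4 / \<epsilon>)" "0 < ln (4::real)"
        using eps False by (auto simp: ln_le_cancel_iff field_simps)
      then have ln: "0 < ln (4 / \<epsilon>)"
        by linarith
      have t: "0 < t" "t\<^sup>2 = 8 * ln (4 / \<epsilon>)"
        using ln by (auto simp: t_def)
      have m: "d0 + t * sqrt (real N) \<le> real m"
        using bound by (simp add: d0_def \<Delta>_def U_def t_def real_sqrt_mult)
      have tN: "0 < t * sqrt (real N)"
        using t N by simp
      have dm: "d0 < real m"
        using m tN by linarith
      have le: "measure ?M F \<le> 3 * exp (- (sqrt (real m) - sqrt d)\<^sup>2 / 2)" if d: "d0 < d" "d < real m" for d
      proof -
        obtain \<tau> where \<tau>: "0 \<le> \<tau>" "\<Delta> \<tau> < d"
          using cInf_lessD [of "\<Delta> ` {0..}" d] d unfolding d0_def by auto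
        show ?thesis
          unfolding F_def S_def
          by (rule null_space_descent_section_le [OF KLU UN \<tau>(1)]) (use d d0 \<tau>(2) in \<open>auto simp: \<Delta>_def\<close>)
      qed
      \<comment> \<open>The infimum \<open>d0\<close> need not be attained, so it is approached from
        the right.\<close>
      have "measure ?M F \<le> 3 * exp (- (sqrt (real m) - sqrt d0)\<^sup>2 / 2)"
      proof (rule tendsto_lowerbound)
        show "((\<lambda>d. 3 * exp (- (sqrt (real m) - sqrt d)\<^sup>2 / 2)) \<longlongrightarrow> 3 * exp (- (sqrt (real m) - sqrt d0)\<^sup>2 / 2)) (at_right d0)"
          by (intro tendsto_intros) auto
        show "eventually (\<lambda>d. measure ?M F \<le> 3 * exp (- (sqrt (real m) - sqrt d)\<^sup>2 / 2)) (at_right d0)"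
          using le dm by (auto simp: eventually_at_right intro!: exI [of _ "real m"])
      qed simp
      also have "\<dots> \<le> 3 * exp (- t\<^sup>2 / 8)"
      proof -
        \<comment> \<open>The hypothesis bounds a difference of squares below, and
          \<open>d0 < m \<le> N\<close> bounds the sum of the roots by \<open>2 * sqrt N\<close>;
          half of \<open>t\<close> remains for their difference.\<close>
        have "t * sqrt (real N) \<le> (sqrt (real m) - sqrt d0) * (sqrt (real m) + sqrt d0)"
          using m d0 by (simp add: algebra_simps)
        also have "\<dots> \<le> (sqrt (real m) - sqrt d0) * (2 * sqrt (real N))"
        proof (rule mult_left_mono)
          have "sqrt (real m) \<le> sqrt (real N)" "sqrt d0 \<le> sqrt (real m)"
            using mN dm by auto
          then show "sqrt (real m) + sqrt d0 \<le> 2 * sqrt (real N)" "0 \<le> sqrt (real m) - sqrt d0"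
            by linarith+
        qed
        finally have "t / 2 \<le> sqrt (real m) - sqrt d0"
          using N by simp
        then have "(t / 2)\<^sup>2 \<le> (sqrt (real m) - sqrt d0)\<^sup>2"
          using t by (intro power_mono) auto
        then show ?thesis
          by (simp add: power_divide)
      qed
      \<comment> \<open>The factor 3 of the lower-tail estimate against the 4 under the logarithm
        gives the strict inequality.\<close>
      also have "\<dots> = 3 * \<epsilon> / 4"
        unfolding t(2) using eps by (simp add: exp_minus)
      also have "\<dots> < \<epsilon>"
        using eps by simp
      finally show ?thesis .
    qed
  qed
  then have "1 - \<epsilon> < measure ?M (space ?M - F)"
    using M.prob_compl [OF Fsets] by simp
  then show ?thesis
    unfolding Let_def x0_def [symmetric] success by simp
qed

end
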